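(* Let $M=SU(2)/I^*$ be the Poincaré dodecahedral space with its spherical metric $g_0$ and let $E=E_{168}(g_0)$. The seed operator $A_0=B(q_o)\in\mathscr B\subset\operatorname{Sym}(E)$ has simple lowest eigenvalue, and its lowest eigendirection is the line $\mathbb RF_0$, where $F_0\in E$ is a nonzero generator of the unique $I^*$-invariant line in $E$.
   Context: $I^*\subset SU(2)$ is the binary icosahedral group; $SU(2)\cong S^3$ has the round metric of curvature $1$, and $M=SU(2)/I^*$ (left cosets $aI^*$) carries the induced metric $g_0$. $E=E_{168}(g_0)$ is the real eigenspace of the nonnegative Laplacian of $g_0$ for its first positive eigenvalue $168$; $\dim E=13$. $E$ is equipped with the $L^2(M,g_0)$ inner product, and $\operatorname{Sym}(E)$ is the space of self-adjoint operators on $E$. The group $SU(2)$ acts orthogonally on $E$ by $(L_af)(x)=f(a^{-1}x)$; the subspace of $E$ fixed by $I^*$ under this action is one-dimensional, and this is the unique $I^*$-invariant line. $\mathcal P=\operatorname{span}\{fg: f,g\in E\}\subset L^2(M,g_0)$ (finite-dimensional). For $q\in C^\infty(M)$ define $B(q)\in\operatorname{Sym}(E)$ by $\langle B(q)f,g\rangle_{L^2(M,g_0)}=-\int_M q\,fg\,dV_{g_0}$ for $f,g\in E$, and let $\mathscr B=B(\mathcal P)\subset\operatorname{Sym}(E)$. Let $o=eI^*\in M$. Let $q_o\in\mathcal P$ be the unique element with $h(o)=\int_M q_o\,h\,dV_{g_0}$ for all $h\in\mathcal P$. The seed operator is $A_0=B(q_o)$. *)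

theory Defs
  imports
    "HOL-Analysis.Analysis"
    "HOL-Combinatorics.Permutations"
    "HOL-Library.FuncSet"
begin

section \<open>The group SU(2) and its identification with the unit 3-sphere\<close>

definition SU2 :: "(complex ^ 2 ^ 2) set" where
  "SU2 = {A. A ** (\<chi> i j. cnj (A $ j $ i)) = mat 1 \<and> det A = 1}"

text \<open>The quaternion \<open>x1 + x2 i + x3 j + x4 k\<close> as a complex matrix. This map restricts to a bijection
  from the unit sphere of \<open>\<real>\<^sup>4\<close> onto \<open>SU2\<close>; the round metric of curvature 1 on \<open>SU2\<close> is
  the one that makes this bijection an isometry.\<close>

definition quat :: "real ^ 4 \<Rightarrow> complex ^ 2 ^ 2" where
  "quat x = vector [vector [Complex (x $ 1) (x $ 2), Complex (x $ 3) (x $ 4)],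
                    vector [Complex (- (x $ 3)) (x $ 4), Complex (x $ 1) (- (x $ 2))]]"

text \<open>The binary icosahedral group as the 120 unit icosians: the 24 Hurwitz units and the 96
  quaternions obtained from \<open>(0, \<plusminus>1, \<plusminus>1/\<phi>, \<plusminus>\<phi>)/2\<close> by even permutations of the coordinates,
  where \<open>\<phi>\<close> is the golden ratio.\<close>

definition golden :: real where
  "golden = (1 + sqrt 5) / 2"

definition unit_icosians :: "(real ^ 4) set" where
  "unit_icosians =
     {s *\<^sub>R axis i 1 | s i. s \<in> {-1, 1}}
   \<union> {\<chi> i. s i / 2 | s. \<forall>i. s i \<in> {-1, 1}}
   \<union> {\<chi> i. s i * (vector [0, 1, 1 / golden, golden] :: real ^ 4) $ p i / 2 | s p.
        (\<forall>i. s i \<in> {-1, 1}) \<and> p permutes UNIV \<and> evenperm p}"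

definition binary_icosahedral :: "(complex ^ 2 ^ 2) set" where
  "binary_icosahedral = quat ` unit_icosians"

section \<open>The Poincare dodecahedral space\<close>

typedef dodecahedral_space = "{(\<lambda>h. a ** h) ` binary_icosahedral | a. a \<in> SU2}"
proof -
  have "(mat 1 :: complex ^ 2 ^ 2) \<in> SU2"
    by (simp add: SU2_def) (simp add: vec_eq_iff matrix_matrix_mult_def mat_def sum_2 forall_2)
  then show ?thesis by blast
qed

definition coset :: "complex ^ 2 ^ 2 \<Rightarrow> dodecahedral_space" where
  "coset a = Abs_dodecahedral_space ((\<lambda>h. a ** h) ` binary_icosahedral)"

definition base_point :: dodecahedral_space where
  "base_point = coset (mat 1)"

subsection \<open>Smooth functions and the Laplacian\<close>

primrec Ck_on :: "nat \<Rightarrow> (real ^ 4) set \<Rightarrow> (real ^ 4 \<Rightarrow> real) \<Rightarrow> bool" where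
  "Ck_on 0 S f = continuous_on S f"
| "Ck_on (Suc k) S f =
     ((\<forall>x\<in>S. f differentiable (at x)) \<and> (\<forall>v. Ck_on k S (\<lambda>x. frechet_derivative f (at x) v)))"

text \<open>The maps from \<open>\<real>\<^sup>4 - {0}\<close> to the sphere and from the sphere to the quotient are smooth surjective
  submersions, so \<open>f\<close> is smooth iff its pullback to the open set \<open>\<real>\<^sup>4 - {0}\<close> is
  (\<open>sgn x\<close> is \<open>x\<close> divided by its norm).\<close>

definition smooth_functions :: "(dodecahedral_space \<Rightarrow> real) set" where
  "smooth_functions = {f. \<forall>k. Ck_on k (- {0}) (\<lambda>x. f (coset (quat (sgn x))))}"

text \<open>The nonnegative Laplacian of the round metric, as minus the trace of the Hessian:
  \<open>Hess F (v, v)\<close> is the second derivative of \<open>F\<close> along the geodesic with initial velocity \<open>v\<close>.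
  The left translates \<open>a i\<close>, \<open>a j\<close>, \<open>a k\<close> of the quaternion units form an orthonormal basis of the
  tangent space at \<open>a\<close>, and the geodesic with initial velocity \<open>a u\<close> is the great circle
  \<open>a (cos t + sin t u)\<close>.\<close>

definition laplacian_SU2 :: "(complex ^ 2 ^ 2 \<Rightarrow> real) \<Rightarrow> complex ^ 2 ^ 2 \<Rightarrow> real" where
  "laplacian_SU2 F a =
     - (\<Sum>m\<in>{2, 3, 4 :: 4}.
          (deriv ^^ 2) (\<lambda>t. F (a ** quat (cos t *\<^sub>R axis 1 1 + sin t *\<^sub>R axis m 1))) 0)"

text \<open>The projection \<open>coset\<close> is a local isometry, so the Laplacian of the quotient is computed
  upstairs.\<close>

definition laplace_eigenspace :: "real \<Rightarrow> (dodecahedral_space \<Rightarrow> real) set" where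
  "laplace_eigenspace \<mu> =
     {f \<in> smooth_functions. \<forall>a\<in>SU2. laplacian_SU2 (\<lambda>b. f (coset b)) a = \<mu> * f (coset a)}"

abbreviation E168 :: "(dodecahedral_space \<Rightarrow> real) set" where
  "E168 \<equiv> laplace_eigenspace 168"

subsection \<open>Integration\<close>

text \<open>The Riemannian volume of a subset of the unit sphere of \<open>\<real>\<^sup>4\<close> is four times the
  Lebesgue measure of the cone over it.\<close>

definition sphere_volume :: "(real ^ 4) measure" where
  "sphere_volume =
     distr (scale_measure 4 (restrict_space lborel (ball 0 1 - {0})))
       (restrict_space borel (sphere 0 1)) sgn"

text \<open>The projection from the sphere to the quotient is a Riemannian covering whose degree is the
  order of the binary icosahedral group.\<close>

definition integral_M :: "(dodecahedral_space \<Rightarrow> real) \<Rightarrow> real" where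
  "integral_M f = (LINT x|sphere_volume. f (coset (quat x))) / real (card binary_icosahedral)"

definition L2_inner :: "(dodecahedral_space \<Rightarrow> real) \<Rightarrow> (dodecahedral_space \<Rightarrow> real) \<Rightarrow> real" where
  "L2_inner f g = integral_M (\<lambda>x. f x * g x)"

section \<open>The action of SU(2) on functions\<close>

definition act :: "complex ^ 2 ^ 2 \<Rightarrow> dodecahedral_space \<Rightarrow> dodecahedral_space" where
  "act a x = Abs_dodecahedral_space ((\<lambda>b. a ** b) ` Rep_dodecahedral_space x)"

definition left_translate ::
  "complex ^ 2 ^ 2 \<Rightarrow> (dodecahedral_space \<Rightarrow> real) \<Rightarrow> dodecahedral_space \<Rightarrow> real" where
  "left_translate a f = (\<lambda>x. f (act (matrix_inv a) x))"

definition icosahedral_invariants :: "(dodecahedral_space \<Rightarrow> real) set" where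
  "icosahedral_invariants = {f \<in> E168. \<forall>a\<in>binary_icosahedral. left_translate a f = f}"

section \<open>The seed operator\<close>

definition line_through :: "(dodecahedral_space \<Rightarrow> real) \<Rightarrow> (dodecahedral_space \<Rightarrow> real) set" where
  "line_through f = {\<lambda>x. c * f x | c. True}"

definition product_span :: "(dodecahedral_space \<Rightarrow> real) set" where
  "product_span =
     {\<lambda>x. \<Sum>i<n. c i * (f i x * g i x) | (n :: nat) c f g. \<forall>i<n. f i \<in> E168 \<and> g i \<in> E168}"

text \<open>Operators on \<open>E168\<close> are extensional functions: they are \<open>undefined\<close> off \<open>E168\<close>.\<close>

type_synonym op = "(dodecahedral_space \<Rightarrow> real) \<Rightarrow> (dodecahedral_space \<Rightarrow> real)"

definition Sym_E :: "op set" where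
  "Sym_E = {T \<in> E168 \<rightarrow>\<^sub>E E168.
     (\<forall>f\<in>E168. \<forall>g\<in>E168. \<forall>c d.
        T (\<lambda>x. c * f x + d * g x) = (\<lambda>x. c * T f x + d * T g x)) \<and>
     (\<forall>f\<in>E168. \<forall>g\<in>E168. L2_inner (T f) g = L2_inner f (T g))}"

definition B_op :: "(dodecahedral_space \<Rightarrow> real) \<Rightarrow> op" where
  "B_op q = (\<lambda>f\<in>E168. THE h. h \<in> E168 \<and>
     (\<forall>g\<in>E168. L2_inner h g = - integral_M (\<lambda>x. q x * (f x * g x))))"

definition B_space :: "op set" where
  "B_space = B_op ` product_span"

definition q_base :: "dodecahedral_space \<Rightarrow> real" where
  "q_base = (THE q. q \<in> product_span \<and>
     (\<forall>h\<in>product_span. h base_point = integral_M (\<lambda>x. q x * h x)))"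

definition seed_operator :: op where
  "seed_operator = B_op q_base"

definition op_eigenspace :: "op \<Rightarrow> real \<Rightarrow> (dodecahedral_space \<Rightarrow> real) set" where
  "op_eigenspace T \<mu> = {f \<in> E168. T f = (\<lambda>x. \<mu> * f x)}"

definition is_eigenvalue :: "op \<Rightarrow> real \<Rightarrow> bool" where
  "is_eigenvalue T \<mu> \<longleftrightarrow> (\<exists>f \<in> op_eigenspace T \<mu>. f \<noteq> (\<lambda>_. 0))"

definition is_lowest_eigenvalue :: "op \<Rightarrow> real \<Rightarrow> bool" where
  "is_lowest_eigenvalue T \<mu> \<longleftrightarrow> is_eigenvalue T \<mu> \<and> (\<forall>\<nu>. is_eigenvalue T \<nu> \<longrightarrow> \<mu> \<le> \<nu>)"

text \<open>For a self-adjoint operator algebraic and geometric multiplicity agree, so simplicity means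
  that the eigenspace is a line.\<close>

definition is_simple_eigenvalue :: "op \<Rightarrow> real \<Rightarrow> bool" where
  "is_simple_eigenvalue T \<mu> \<longleftrightarrow> (\<exists>f. f \<noteq> (\<lambda>_. 0) \<and> op_eigenspace T \<mu> = line_through f)"

end

theory Submission
  imports Defs
begin

text \<open>
  For \<open>f, g\<close> in the eigenspace \<open>E168\<close> the product \<open>f g\<close> lies in \<open>product_span\<close>, where \<open>q_base\<close> represents
  evaluation at the base point \<open>o\<close>. Hence \<open>\<langle>A f, g\<rangle> = - f(o) g(o)\<close> for the seed operator \<open>A\<close>, that is,
  \<open>A f = - f(o) k\<close>, where \<open>k \<in> E168\<close> represents the evaluation functional, \<open>\<langle>k, f\<rangle> = f(o)\<close>. So \<open>A\<close>
  has rank at most one, and as soon as \<open>k\<close> is not zero its lowest eigenvalue is \<open>- k(o) = - \<langle>k, k\<rangle> < 0\<close>, with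
  eigenspace the line through \<open>k\<close>. What remains is to construct \<open>k\<close>, to see that it is not zero, and to
  show that the invariants of the binary icosahedral group \<open>I\<close> in \<open>E168\<close> are exactly its multiples.

  All of this takes place on the unit sphere of quaternions. An eigenfunction \<open>F\<close> with eigenvalue
  \<open>\<mu>\<close> is tested against the functions \<open>x \<mapsto> \<langle>x, v\<rangle>\<^sup>n\<close>, on which the Laplacian acts by
  \<open>n (n + 2) \<langle>x, v\<rangle>\<^sup>n - n (n - 1) \<langle>x, v\<rangle>\<^sup>n\<^sup>-\<^sup>2\<close> for \<open>v\<close> of norm one. Its symmetry turns this into a recursion for the moments
  \<open>\<integral> F(x) \<langle>x, v\<rangle>\<^sup>n\<close> (\<open>weak_eigen\<close>). For \<open>\<mu> = 168 = 12 \<cdot> 14\<close> the moments below 12 vanish and the twelfth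
  moment determines all later ones, hence, by Weierstrass approximation of a bump near \<open>v\<close>, the
  value \<open>F(v)\<close>. Comparison with the zonal function \<open>x \<mapsto> U\<^sub>1\<^sub>2(\<langle>x, v\<rangle>)\<close> gives the reproducing formula
  \<open>\<integral> F(x) U\<^sub>1\<^sub>2(\<langle>x, v\<rangle>) = \<kappa> F(v)\<close> (\<open>zonal_reproducing\<close>) with \<open>\<kappa>\<close> one thirteenth of the volume. It shows at
  once that eigenfunctions are polynomials of degree 12, so that \<open>E168\<close> and \<open>product_span\<close> have finite
  dimension and the representing elements exist, and that \<open>k\<close> is a multiple of the sum of the
  characters \<open>x \<mapsto> \<chi>(x h) = U\<^sub>1\<^sub>2(Re (x h))\<close> over \<open>h \<in> I\<close>. Its value at \<open>o\<close> is a multiple of \<open>\<Sum>h \<in> I. \<chi>(h)\<close>,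
  which equals 120, the order of \<open>I\<close>: the 13-dimensional representation of \<open>SU(2)\<close> contains the trivial
  representation of \<open>I\<close> exactly once.

  Therefore \<open>k\<close> is invariant under \<open>I\<close> from both sides, and an invariant \<open>f\<close> differs from a multiple of \<open>k\<close> by a bi-invariant
  eigenfunction that vanishes at \<open>o\<close>. Such a function is zero (\<open>biinvariant_zero\<close>) because the space of
  bi-invariant eigenfunctions has dimension one: the trace of the projection onto it is an
  integral of \<open>\<chi>(g v h v\<^sup>-\<^sup>1)\<close> over \<open>v\<close>, averaged over \<open>g, h \<in> I\<close>, and the integral factorizes as
  \<open>\<kappa> \<chi>(g) \<chi>(h)\<close> (\<open>integral_character_conjugate\<close>).
\<close>

section \<open>Unit quaternions and SU(2)\<close>

lemma vector_4 [simp]: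
  "(vector [w, x, y, z] :: 'a::zero ^ 4) $ 1 = w"
  "(vector [w, x, y, z] :: 'a::zero ^ 4) $ 2 = x"
  "(vector [w, x, y, z] :: 'a::zero ^ 4) $ 3 = y"
  "(vector [w, x, y, z] :: 'a::zero ^ 4) $ 4 = z"
  unfolding vector_def by simp_all

text \<open>
  Quaternion multiplication in the coordinates of \<open>quat\<close>, so that \<open>quat\<close> turns it into matrix
  multiplication (\<open>quat_qmul\<close>).
\<close>

definition qmul :: "real ^ 4 \<Rightarrow> real ^ 4 \<Rightarrow> real ^ 4" (infixl "\<odot>" 70) where
  "x \<odot> y = vector
     [x $ 1 * y $ 1 - x $ 2 * y $ 2 - x $ 3 * y $ 3 - x $ 4 * y $ 4,
      x $ 1 * y $ 2 + x $ 2 * y $ 1 + x $ 3 * y $ 4 - x $ 4 * y $ 3,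
      x $ 1 * y $ 3 - x $ 2 * y $ 4 + x $ 3 * y $ 1 + x $ 4 * y $ 2,
      x $ 1 * y $ 4 + x $ 2 * y $ 3 - x $ 3 * y $ 2 + x $ 4 * y $ 1]"

definition qcnj :: "real ^ 4 \<Rightarrow> real ^ 4" where
  "qcnj x = vector [x $ 1, - x $ 2, - x $ 3, - x $ 4]"

abbreviation qone :: "real ^ 4" where "qone \<equiv> axis 1 1"

abbreviation S3 :: "(real ^ 4) set" where "S3 \<equiv> sphere 0 1"

lemma qmul_nth [simp]:
  "(x \<odot> y) $ 1 = x $ 1 * y $ 1 - x $ 2 * y $ 2 - x $ 3 * y $ 3 - x $ 4 * y $ 4"
  "(x \<odot> y) $ 2 = x $ 1 * y $ 2 + x $ 2 * y $ 1 + x $ 3 * y $ 4 - x $ 4 * y $ 3"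
  "(x \<odot> y) $ 3 = x $ 1 * y $ 3 - x $ 2 * y $ 4 + x $ 3 * y $ 1 + x $ 4 * y $ 2"
  "(x \<odot> y) $ 4 = x $ 1 * y $ 4 + x $ 2 * y $ 3 - x $ 3 * y $ 2 + x $ 4 * y $ 1"
  by (simp_all add: qmul_def)

lemma qcnj_nth [simp]:
  "qcnj x $ 1 = x $ 1" "qcnj x $ 2 = - x $ 2" "qcnj x $ 3 = - x $ 3" "qcnj x $ 4 = - x $ 4"
  by (simp_all add: qcnj_def)

lemma qone_nth [simp]: "qone $ 1 = 1" "qone $ 2 = 0" "qone $ 3 = 0" "qone $ 4 = 0"
  by (simp_all add: axis_def)

lemma vec4_eq_iff: "(x :: 'a ^ 4) = y \<longleftrightarrow> x $ 1 = y $ 1 \<and> x $ 2 = y $ 2 \<and> x $ 3 = y $ 3 \<and> x $ 4 = y $ 4"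
  by (simp add: vec_eq_iff forall_4)

lemma inner_4: "(x :: real ^ 4) \<bullet> y = x $ 1 * y $ 1 + x $ 2 * y $ 2 + x $ 3 * y $ 3 + x $ 4 * y $ 4"
  by (simp add: inner_vec_def sum_4)

lemma qmul_assoc: "(x \<odot> y) \<odot> z = x \<odot> (y \<odot> z)"
  by (simp add: vec4_eq_iff algebra_simps)

lemma qmul_one [simp]: "qone \<odot> x = x" "x \<odot> qone = x"
  by (simp_all add: vec4_eq_iff)

lemma qcnj_qcnj [simp]: "qcnj (qcnj x) = x"
  by (simp add: vec4_eq_iff)

lemma qcnj_qmul: "qcnj (x \<odot> y) = qcnj y \<odot> qcnj x"
  by (simp add: vec4_eq_iff algebra_simps)

lemma inner_qcnj: "qcnj x \<bullet> qcnj y = x \<bullet> y"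
  by (simp add: inner_4)

lemma norm_qcnj [simp]: "norm (qcnj x) = norm x"
  by (simp add: norm_eq_sqrt_inner inner_qcnj)

lemma inner_qmul_left: "(x \<odot> y) \<bullet> z = y \<bullet> (qcnj x \<odot> z)"
  by (simp add: inner_4 algebra_simps)

lemma inner_qone: "x \<bullet> qone = x $ 1" "qone \<bullet> x = x $ 1"
  by (simp_all add: inner_4)

lemma qcnj_mul_self: "qcnj x \<odot> x = (x \<bullet> x) *\<^sub>R qone" "x \<odot> qcnj x = (x \<bullet> x) *\<^sub>R qone"
  by (simp_all add: vec4_eq_iff inner_4 algebra_simps)

lemma S3_iff: "x \<in> S3 \<longleftrightarrow> x \<bullet> x = 1"
  by (simp add: norm_eq_1)

lemma qcnj_S3 [simp]:
  assumes "x \<in> S3"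
  shows "qcnj x \<odot> x = qone" "x \<odot> qcnj x = qone"
  using assms unfolding S3_iff by (simp_all add: qcnj_mul_self)

lemma qcnj_cancel [simp]:
  assumes "x \<in> S3"
  shows "qcnj x \<odot> (x \<odot> y) = y" "x \<odot> (qcnj x \<odot> y) = y" "y \<odot> qcnj x \<odot> x = y" "y \<odot> x \<odot> qcnj x = y"
  using assms by (simp_all flip: qmul_assoc add: qmul_assoc[of y])

lemma qmul_scaleR [simp]: "(c *\<^sub>R x) \<odot> y = c *\<^sub>R (x \<odot> y)" "x \<odot> (c *\<^sub>R y) = c *\<^sub>R (x \<odot> y)"
  by (simp_all add: vec4_eq_iff algebra_simps)

lemma qmul_add: "(x + x') \<odot> y = x \<odot> y + x' \<odot> y" "x \<odot> (y + y') = x \<odot> y + x \<odot> y'"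
  by (simp_all add: vec4_eq_iff algebra_simps)

lemma qmul_minus [simp]: "(- x) \<odot> y = - (x \<odot> y)" "x \<odot> (- y) = - (x \<odot> y)"
  by (simp_all add: vec4_eq_iff)

text \<open>
  Left multiplication by \<open>x\<close> has the adjoint \<open>y \<mapsto> qcnj x \<odot> y\<close>, and \<open>qcnj x \<odot> x\<close> is the scalar \<open>\<langle>x, x\<rangle>\<close>.
\<close>

lemma norm_qmul: "norm (x \<odot> y) = norm x * norm y"
proof -
  have "(x \<odot> y) \<bullet> (x \<odot> y) = (x \<bullet> x) * (y \<bullet> y)"
    by (simp add: inner_qmul_left[of x y] qcnj_mul_self flip: qmul_assoc)
  then show ?thesis by (simp add: norm_eq_sqrt_inner real_sqrt_mult)
qed

lemma S3_qmul [simp]: "x \<in> S3 \<Longrightarrow> y \<in> S3 \<Longrightarrow> x \<odot> y \<in> S3"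
  by (simp add: norm_qmul)

lemma S3_qcnj [simp]: "x \<in> S3 \<Longrightarrow> qcnj x \<in> S3" by simp

lemma S3_qone [simp]: "qone \<in> S3" by (simp add: norm_axis_1)

lemma bounded_bilinear_qmul: "bounded_bilinear (\<odot>)"
  by standard (auto simp: qmul_add norm_qmul intro!: exI[of _ 1])

lemmas continuous_on_qmul [continuous_intros] = bounded_bilinear.continuous_on[OF bounded_bilinear_qmul]

lemma bounded_linear_qcnj: "bounded_linear qcnj"
  by (rule bounded_linear_intro[where K = 1]) (auto simp: vec4_eq_iff)

lemmas continuous_on_qcnj [continuous_intros] = bounded_linear.continuous_on[OF bounded_linear_qcnj]

lemma matrix_mult_2: "(A ** B) $ i $ j = A $ i $ 1 * B $ 1 $ j + A $ i $ 2 * (B :: 'a::semiring_1 ^ 2 ^ 2) $ 2 $ j"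
  by (simp add: matrix_matrix_mult_def sum_2)

lemma quat_nth [simp]:
  "quat x $ 1 $ 1 = Complex (x $ 1) (x $ 2)" "quat x $ 1 $ 2 = Complex (x $ 3) (x $ 4)"
  "quat x $ 2 $ 1 = Complex (- (x $ 3)) (x $ 4)" "quat x $ 2 $ 2 = Complex (x $ 1) (- (x $ 2))"
  by (simp_all add: quat_def)

lemma quat_qmul: "quat x ** quat y = quat (x \<odot> y)"
  by (simp add: vec_eq_iff forall_2 matrix_mult_2 complex_eq_iff algebra_simps)

lemma quat_qone: "quat qone = mat 1"
  by (simp add: vec_eq_iff forall_2 mat_def complex_eq_iff)

lemma inj_quat: "inj quat"
  by (rule injI) (auto simp: vec_eq_iff forall_2 forall_4 complex_eq_iff)

lemma quat_SU2: "x \<in> S3 \<Longrightarrow> quat x \<in> SU2"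
  unfolding S3_iff
  by (simp add: SU2_def vec_eq_iff forall_2 matrix_mult_2 mat_def complex_eq_iff det_2 inner_4 algebra_simps)

text \<open>
  The inverse of a unitary matrix of determinant one is both its adjoint and its adjugate;
  comparing the second rows gives the shape of \<open>quat\<close>.
\<close>

lemma SU2_eq: "SU2 = quat ` S3"
proof
  show "SU2 \<subseteq> quat ` S3"
  proof
    fix A assume A: "A \<in> SU2"
    define a b c d where "a = A $ 1 $ 1" "b = A $ 1 $ 2" "c = A $ 2 $ 1" "d = A $ 2 $ 2"
    note abcd = this
    have eq: "(A ** (\<chi> i j. cnj (A $ j $ i))) $ i $ j = mat 1 $ i $ j" for i j
      using A by (simp add: SU2_def)
    have 1: "a * cnj a + b * cnj b = 1"
      using eq[of 1 1] by (simp add: matrix_mult_2 mat_def abcd)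
    have 2: "c * cnj a + d * cnj b = 0"
      using eq[of 2 1] by (simp add: matrix_mult_2 mat_def abcd)
    have 3: "a * d - b * c = 1"
      using A by (simp add: SU2_def det_2 abcd)
    have "d = d * (a * cnj a + b * cnj b)" by (simp add: 1)
    also have "\<dots> = cnj a * (a * d - b * c) + b * (c * cnj a + d * cnj b)" by algebra
    finally have d: "d = cnj a" by (simp add: 2 3)
    have "c = c * (a * cnj a + b * cnj b)" by (simp add: 1)
    also have "\<dots> = - cnj b * (a * d - b * c) + a * (c * cnj a + d * cnj b)" by algebra
    finally have c: "c = - cnj b" by (simp add: 2 3)
    have "A = quat (vector [Re a, Im a, Re b, Im b])"
      using c d by (simp add: vec_eq_iff forall_2 complex_eq_iff abcd)
    moreover have "vector [Re a, Im a, Re b, Im b] \<in> S3"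
      using 1 unfolding S3_iff by (simp add: inner_4 complex_eq_iff)
    ultimately show "A \<in> quat ` S3" by blast
  qed
qed (use quat_SU2 in blast)

lemma matrix_inv_quat:
  assumes "x \<in> S3" shows "matrix_inv (quat x) = quat (qcnj x)"
proof -
  have 1: "quat x ** quat (qcnj x) = mat 1" "quat (qcnj x) ** quat x = mat 1"
    using assms by (simp_all add: quat_qmul quat_qone)
  then have "quat x ** matrix_inv (quat x) = mat 1 \<and> matrix_inv (quat x) ** quat x = mat 1"
    unfolding matrix_inv_def by (rule_tac someI[of "\<lambda>B. quat x ** B = mat 1 \<and> B ** quat x = mat 1"]) auto
  then have "matrix_inv (quat x) = (quat (qcnj x) ** quat x) ** matrix_inv (quat x)"
    by (simp add: 1)
  also have "\<dots> = quat (qcnj x)"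
    using \<open>_ \<and> _\<close> by (simp flip: matrix_mul_assoc)
  finally show ?thesis .
qed

section \<open>The volume measure of the 3-sphere\<close>

abbreviation \<sigma> :: "(real ^ 4) measure" where "\<sigma> \<equiv> sphere_volume"

abbreviation pball :: "(real ^ 4) set" where "pball \<equiv> ball 0 1 - {0}"

lemma sgn_S3: "x \<noteq> 0 \<Longrightarrow> sgn x \<in> S3"
  by (simp add: norm_sgn)

lemma measurable_sgn_cone:
  "sgn \<in> scale_measure 4 (restrict_space lborel pball) \<rightarrow>\<^sub>M restrict_space borel S3"
proof (rule measurable_restrict_space2)
  show "sgn \<in> scale_measure 4 (restrict_space lborel pball) \<rightarrow>\<^sub>M (borel :: (real ^ 4) measure)"
    unfolding sgn_div_norm measurable_cong_sets[OF sets_scale_measure refl]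
    by (rule measurable_restrict_space1) measurable
qed (auto simp: space_scale_measure space_restrict_space norm_sgn)

lemma sets_sphere_volume: "sets \<sigma> = sets (restrict_space borel S3)"
  and space_sphere_volume [simp]: "space \<sigma> = S3"
  by (simp_all add: sphere_volume_def space_restrict_space)

lemma emeasure_sphere_volume:
  assumes "A \<in> sets \<sigma>"
  shows "emeasure \<sigma> A = 4 * emeasure lborel (sgn -` A \<inter> pball)"
proof -
  have "sgn -` A \<inter> pball \<in> sets (restrict_space lborel pball)"
    using measurable_sets[OF measurable_sgn_cone, of A] assms
    by (simp add: sets_sphere_volume sets_scale_measure space_scale_measure space_restrict_space)
  then show ?thesis
    using assms unfolding sphere_volume_def
    by (subst emeasure_distr[OF measurable_sgn_cone])
       (auto simp: space_scale_measure space_restrict_space emeasure_restrict_space sets_restrict_space_iff)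
qed

lemma sgn_cone_borel:
  assumes "A \<in> sets \<sigma>" shows "sgn -` A \<inter> pball \<in> sets borel"
proof -
  have "sgn -` A \<inter> pball \<in> sets (restrict_space lborel pball)"
    using measurable_sets[OF measurable_sgn_cone, of A] assms
    by (simp add: sets_sphere_volume sets_scale_measure space_scale_measure space_restrict_space)
  then show ?thesis by (subst (asm) sets_restrict_space_iff) auto
qed

interpretation \<sigma>: finite_measure \<sigma>
proof
  have "emeasure \<sigma> (space \<sigma>) = 4 * emeasure lborel (sgn -` space \<sigma> \<inter> pball)"
    by (rule emeasure_sphere_volume) (rule sets.top)
  also have "\<dots> \<le> 4 * emeasure lborel (ball 0 1 :: (real ^ 4) set)"
    by (intro mult_left_mono emeasure_mono) auto
  also have "\<dots> < \<infinity>"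
    using emeasure_lborel_ball_finite[of "0 :: real ^ 4" 1] by (simp add: ennreal_mult_less_top)
  finally show "emeasure \<sigma> (space \<sigma>) \<noteq> \<infinity>" by simp
qed

lemma measurable_cont: "continuous_on S3 f \<Longrightarrow> f \<in> borel_measurable \<sigma>"
  for f :: "real ^ 4 \<Rightarrow> 'b::topological_space"
  using borel_measurable_continuous_on_restrict[of S3 f] 
  by (simp cong: measurable_cong_sets add: sets_sphere_volume)

lemma bounded_cont:
  fixes f :: "real ^ 4 \<Rightarrow> real"
  assumes "continuous_on S3 f"
  obtains C where "\<And>x. x \<in> S3 \<Longrightarrow> \<bar>f x\<bar> \<le> C"
proof -
  have "bounded (f ` S3)"
    by (intro compact_imp_bounded compact_continuous_image assms) simp
  then obtain C where "\<forall>x\<in>S3. \<bar>f x\<bar> \<le> C" unfolding bounded_iff by auto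
  then show ?thesis using that by blast
qed

lemma integrable_cont:
  fixes f :: "real ^ 4 \<Rightarrow> real"
  assumes "continuous_on S3 f" shows "integrable \<sigma> f"
proof -
  obtain C where "\<And>x. x \<in> S3 \<Longrightarrow> \<bar>f x\<bar> \<le> C" using bounded_cont[OF assms] by blast
  then show ?thesis
    by (intro \<sigma>.integrable_const_bound[where B = C] measurable_cont assms AE_I2) simp
qed

lemma integral_cong_S3: "(\<And>x. x \<in> S3 \<Longrightarrow> f x = g x) \<Longrightarrow> integral\<^sup>L \<sigma> f = integral\<^sup>L \<sigma> (g :: _ \<Rightarrow> real)"
  by (rule Bochner_Integration.integral_cong) simp_all

text \<open>
  An orthogonal map commutes with the radial projection \<open>sgn\<close>, so the preimage of the cone over
  a set is the cone over the preimage, and the invariance of Lebesgue measure applies.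
\<close>

lemma distr_sphere_volume:
  assumes T: "orthogonal_transformation T"
  shows "distr \<sigma> \<sigma> T = \<sigma>"
proof (rule measure_eqI)
  have n: "norm (T x) = norm x" for x using T by (rule orthogonal_transformation_norm)
  have T0: "T x = 0 \<longleftrightarrow> x = 0" for x using n[of x] by (metis norm_eq_zero)
  have cT: "continuous_on A T" for A
    by (intro linear_continuous_on linear_linear[THEN iffD2] orthogonal_transformation_linear T)
  have sgnT: "T (sgn x) = sgn (T x)" for x
    using orthogonal_transformation_linear[OF T] by (simp add: sgn_div_norm n linear_scale)
  have mT: "T \<in> \<sigma> \<rightarrow>\<^sub>M \<sigma>"
  proof -
    have "T \<in> \<sigma> \<rightarrow>\<^sub>M restrict_space borel S3"
      by (rule measurable_restrict_space2) (auto simp: n intro!: measurable_cont cT)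
    then show ?thesis by (simp cong: measurable_cong_sets add: sets_sphere_volume)
  qed
  show "sets (distr \<sigma> \<sigma> T) = sets \<sigma>" by simp
  fix A assume "A \<in> sets (distr \<sigma> \<sigma> T)"
  then have A: "A \<in> sets \<sigma>" by simp
  let ?X = "sgn -` A \<inter> pball"
  have bij: "bij T" using T by (rule orthogonal_transformation_bij)
  have AS: "A \<subseteq> S3" using sets.sets_into_space[OF A] by simp
  have pre: "sgn -` (T -` A \<inter> space \<sigma>) \<inter> pball = inv T ` ?X"
  proof -
    have "inv T ` ?X = T -` ?X" by (rule bij_vimage_eq_inv_image[OF bij, symmetric])
    also have "\<dots> = sgn -` (T -` A \<inter> space \<sigma>) \<inter> pball"
      by (auto simp: sgnT norm_sgn n T0)
    finally show ?thesis ..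
  qed
  have X: "?X \<in> lmeasurable"
  proof (rule bounded_set_imp_lmeasurable)
    show "bounded ?X" by (rule bounded_subset[OF bounded_ball]) auto
    show "?X \<in> sets lebesgue"
      using sgn_cone_borel[OF A] by (intro sets_completionI_sets) simp
  qed
  have oi: "orthogonal_transformation (inv T)" using T by (rule orthogonal_transformation_inv)
  have "emeasure lebesgue (inv T ` ?X) = emeasure lebesgue ?X"
    using measurable_orthogonal_image[OF oi X] measure_orthogonal_image[OF oi X] X
    by (simp add: emeasure_eq_measure2 fmeasurableD fmeasurableD2)
  moreover have "inv T ` ?X \<in> sets borel"
    unfolding pre[symmetric] by (rule sgn_cone_borel) (rule measurable_sets[OF mT A])
  ultimately have "emeasure lborel (inv T ` ?X) = emeasure lborel ?X"
    using sgn_cone_borel[OF A] by simp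
  then show "emeasure (distr \<sigma> \<sigma> T) A = emeasure \<sigma> A"
    unfolding emeasure_distr[OF mT A] emeasure_sphere_volume[OF A]
      emeasure_sphere_volume[OF measurable_sets[OF mT A]] pre by simp
qed

lemma integral_orthogonal:
  fixes f :: "real ^ 4 \<Rightarrow> real"
  assumes T: "orthogonal_transformation T" and f: "continuous_on S3 f"
  shows "(LINT x|\<sigma>. f (T x)) = (LINT x|\<sigma>. f x)"
proof -
  have "continuous_on A T" for A
    by (intro linear_continuous_on linear_linear[THEN iffD2] orthogonal_transformation_linear T)
  then have "T \<in> \<sigma> \<rightarrow>\<^sub>M restrict_space borel S3"
    by (intro measurable_restrict_space2) (auto simp: orthogonal_transformation_norm[OF T] intro!: measurable_cont)
  then have "T \<in> \<sigma> \<rightarrow>\<^sub>M \<sigma>" by (simp cong: measurable_cong_sets add: sets_sphere_volume)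
  from integral_distr[OF this measurable_cont[OF f]] show ?thesis
    by (simp add: distr_sphere_volume[OF T])
qed

lemma orthogonal_qmul:
  assumes "a \<in> S3"
  shows "orthogonal_transformation (\<lambda>x. a \<odot> x)" "orthogonal_transformation (\<lambda>x. x \<odot> a)"
  using assms
  by (auto simp: orthogonal_transformation norm_qmul intro: bounded_linear.linear
      bounded_bilinear.bounded_linear_left[OF bounded_bilinear_qmul]
      bounded_bilinear.bounded_linear_right[OF bounded_bilinear_qmul])

lemmas integral_qmul_left = integral_orthogonal[OF orthogonal_qmul(1)]

lemmas integral_qmul_right = integral_orthogonal[OF orthogonal_qmul(2)]

text \<open>
  The cone over a nonempty open subset of the sphere is open in \<open>\<real>\<^sup>4\<close>, hence not a null set.
\<close>

lemma integral_zero_imp_zero: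
  fixes f :: "real ^ 4 \<Rightarrow> real"
  assumes f: "continuous_on S3 f" "\<And>x. x \<in> S3 \<Longrightarrow> 0 \<le> f x" and int: "(LINT x|\<sigma>. f x) = 0"
    and x0: "x0 \<in> S3"
  shows "f x0 = 0"
proof (rule ccontr)
  assume ne: "f x0 \<noteq> 0"
  have "AE x in \<sigma>. 0 \<le> f x" using f(2) by (intro AE_I2) simp
  then have "AE x in \<sigma>. f x = 0"
    using int integral_nonneg_eq_0_iff_AE[OF integrable_cont[OF f(1)]] by simp
  moreover have "openin (top_of_set S3) (S3 \<inter> f -` (- {0}))"
    by (rule continuous_openin_preimage_gen[OF f(1)]) auto
  then obtain V where V: "open V" "S3 \<inter> f -` (- {0}) = S3 \<inter> V"
    unfolding openin_open by blast
  have VS: "S3 \<inter> V \<in> sets \<sigma>"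
    using V(1) by (auto simp: sets_sphere_volume sets_restrict_space)
  moreover have "{x \<in> space \<sigma>. \<not> f x = 0} = S3 \<inter> V"
    unfolding V(2)[symmetric] by auto
  ultimately have "emeasure \<sigma> (S3 \<inter> V) = 0"
    using VS AE_iff_measurable[of "S3 \<inter> V" \<sigma> "\<lambda>x. f x = 0"] by simp
  then have 0: "emeasure lborel (sgn -` (S3 \<inter> V) \<inter> pball) = 0"
    using emeasure_sphere_volume[OF VS] by simp
  have eq: "sgn -` (S3 \<inter> V) \<inter> pball = pball \<inter> sgn -` V"
    by (auto simp: norm_sgn)
  have cs: "continuous_on pball (sgn :: real ^ 4 \<Rightarrow> _)"
    by (intro continuous_intros) auto
  have op: "open (pball \<inter> sgn -` V)"
    by (rule continuous_open_preimage[OF cs _ V(1)]) (auto intro: open_Diff)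
  have "(1 / 2) *\<^sub>R x0 \<in> pball \<inter> sgn -` V"
  proof -
    have "x0 \<in> S3 \<inter> f -` (- {0})" using x0 ne by simp
    then have "x0 \<in> V" unfolding V(2) by simp
    then show ?thesis using x0 by (auto simp: sgn_div_norm)
  qed
  then have "\<not> negligible (pball \<inter> sgn -` V)" using open_not_negligible[OF op] by blast
  moreover have "pball \<inter> sgn -` V \<in> null_sets lborel"
    using 0 op unfolding eq by (auto intro: null_setsI)
  then have "negligible (pball \<inter> sgn -` V)"
    by (simp add: negligible_iff_null_sets null_sets_completionI)
  ultimately show False by blast
qed

section \<open>Second derivatives along great circles\<close>

text \<open>
  The one-parameter group \<open>exp (t e)\<close>. The great circles through \<open>x\<close> are the curves \<open>x \<odot> circ e t\<close>, which
  for the three \<open>e \<in> imag_units\<close> leave \<open>x\<close> in orthonormal directions.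
\<close>

definition circ :: "real ^ 4 \<Rightarrow> real \<Rightarrow> real ^ 4" where
  "circ e t = cos t *\<^sub>R qone + sin t *\<^sub>R e"

abbreviation imag_units :: "(real ^ 4) set" where
  "imag_units \<equiv> {axis 2 1, axis 3 1, axis 4 1}"

lemma imag_unit:
  assumes "e \<in> imag_units" shows "e \<in> S3" "qcnj e = - e" "e \<bullet> qone = 0" "e \<odot> e = - qone" "qone \<bullet> e = 0"
  using assms by (auto simp: vec4_eq_iff axis_def inner_4 norm_eq_sqrt_inner)

lemma circ_S3: "e \<in> imag_units \<Longrightarrow> circ e t \<in> S3"
  using imag_unit[of e] unfolding S3_iff circ_def
  by (simp add: inner_add_left inner_add_right norm_eq_1 flip: power2_eq_square)

lemma qcnj_circ: "e \<in> imag_units \<Longrightarrow> qcnj (circ e t) = circ e (- t)"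
  by (auto simp: circ_def vec4_eq_iff axis_def)

lemma circ_0 [simp]: "circ e 0 = qone" by (simp add: circ_def)

lemma circ_deriv: "((\<lambda>t. x \<odot> circ e t) has_vector_derivative x \<odot> circ e t \<odot> e) (at t)"
  if "e \<in> imag_units"
proof -
  have "((\<lambda>t. x \<odot> circ e t) has_vector_derivative x \<odot> (- sin t *\<^sub>R qone + cos t *\<^sub>R e)) (at t)"
    unfolding circ_def
    by (intro bounded_linear.has_vector_derivative[OF bounded_bilinear.bounded_linear_right[OF bounded_bilinear_qmul]]
        has_vector_derivative_add has_vector_derivative_scaleR[THEN has_vector_derivative_eq_rhs] 
        derivative_eq_intros) (auto intro!: derivative_eq_intros)
  also have "x \<odot> (- sin t *\<^sub>R qone + cos t *\<^sub>R e) = x \<odot> circ e t \<odot> e"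
    unfolding circ_def qmul_assoc qmul_add qmul_scaleR imag_unit(4)[OF that] by simp
  finally show ?thesis .
qed

lemma continuous_circ: "continuous_on A (\<lambda>t. x \<odot> circ e t)"
  unfolding circ_def by (intro continuous_intros)

text \<open>
  \<open>F2\<close> is the second derivative of \<open>F\<close> under right translation by \<open>circ e t\<close>. The first derivative
  \<open>F1\<close> is required to be a function of the point alone: it is the derivative of \<open>F\<close> along the left-invariant
  vector field of \<open>e\<close>.
\<close>

definition second_deriv_along :: "real ^ 4 \<Rightarrow> (real ^ 4 \<Rightarrow> real) \<Rightarrow> (real ^ 4 \<Rightarrow> real) \<Rightarrow> bool" where
  "second_deriv_along e F F2 \<longleftrightarrow> continuous_on S3 F \<and> continuous_on S3 F2 \<and>
     (\<exists>F1. \<forall>x\<in>S3. \<forall>t.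
        ((\<lambda>t. F (x \<odot> circ e t)) has_real_derivative F1 (x \<odot> circ e t)) (at t) \<and>
        ((\<lambda>t. F1 (x \<odot> circ e t)) has_real_derivative F2 (x \<odot> circ e t)) (at t))"

text \<open>
  Taylor's formula for the even function \<open>t \<mapsto> F (x \<odot> circ e t) + F (x \<odot> circ e (- t))\<close>, whose first
  derivative vanishes at 0. The remainder is bounded by a supremum of \<open>F2\<close>, uniformly in \<open>x\<close>.
\<close>

lemma second_difference:
  assumes F: "second_deriv_along e F F2" and e: "e \<in> imag_units" and x: "x \<in> S3" and h: "h > 0"
  obtains t where "0 < t" "t \<le> h"
    "F (x \<odot> circ e h) + F (x \<odot> circ e (- h)) - 2 * F x =
       h\<^sup>2 * ((F2 (x \<odot> circ e t) + F2 (x \<odot> circ e (- t))) / 2)"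
proof -
  obtain F1 where F1: "\<And>t. ((\<lambda>t. F (x \<odot> circ e t)) has_real_derivative F1 (x \<odot> circ e t)) (at t)"
    "\<And>t. ((\<lambda>t. F1 (x \<odot> circ e t)) has_real_derivative F2 (x \<odot> circ e t)) (at t)"
    using F x unfolding second_deriv_along_def by blast
  define D where "D = (\<lambda>m::nat. if m = 0 then (\<lambda>t. F (x \<odot> circ e t) + F (x \<odot> circ e (- t)))
    else if m = 1 then (\<lambda>t. F1 (x \<odot> circ e t) - F1 (x \<odot> circ e (- t)))
    else (\<lambda>t. F2 (x \<odot> circ e t) + F2 (x \<odot> circ e (- t))))"
  have neg: "((\<lambda>t. G (x \<odot> circ e (- t))) has_real_derivative - G' (x \<odot> circ e (- t))) (at t)"
    if "\<And>t. ((\<lambda>t. G (x \<odot> circ e t)) has_real_derivative G' (x \<odot> circ e t)) (at t)" for G G' t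
    using DERIV_chain2[where f = "\<lambda>t. G (x \<odot> circ e t)" and g = uminus and x = t and s = UNIV,
        OF that[of "- t"] DERIV_minus[OF DERIV_ident]] by simp
  have "\<forall>m t. m < 2 \<and> 0 \<le> t \<and> t \<le> h \<longrightarrow> DERIV (D m) t :> D (Suc m) t"
  proof (intro allI impI)
    fix m :: nat and t assume "m < 2 \<and> 0 \<le> t \<and> t \<le> h"
    then consider "m = 0" | "m = 1" by linarith
    then show "DERIV (D m) t :> D (Suc m) t"
    proof cases
      case 1
      show ?thesis unfolding 1 D_def
        using DERIV_add[OF F1(1)[of t] neg[OF F1(1), of t]] by simp
    next
      case 2
      show ?thesis unfolding 2 D_def
        using DERIV_diff[OF F1(2)[of t] neg[OF F1(2), of t]] by simp
    qed
  qed
  from Maclaurin2[OF h refl this]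
  obtain t where t: "0 < t" "t \<le> h" "D 0 h = (\<Sum>m<2. D m 0 / fact m * h ^ m) + D 2 t / fact 2 * h\<^sup>2"
    by blast
  show ?thesis
    by (rule that[OF t(1,2)]) (use t(3) in \<open>simp add: D_def numeral_2_eq_2 power2_eq_square field_simps\<close>)
qed

text \<open>
  Dominated convergence, with the bound that \<open>second_difference\<close> supplies.
\<close>

lemma second_difference_integral:
  assumes F: "second_deriv_along e F F2" and e: "e \<in> imag_units" and P: "continuous_on S3 P"
  shows "(\<lambda>n. (real (Suc n))\<^sup>2 * (LINT x|\<sigma>. (F (x \<odot> circ e (1 / Suc n)) + F (x \<odot> circ e (- (1 / Suc n))) - 2 * F x) * P x))
    \<longlonglongrightarrow> (LINT x|\<sigma>. F2 x * P x)"
proof -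
  have cF: "continuous_on S3 F" "continuous_on S3 F2" using F by (auto simp: second_deriv_along_def)
  have cR: "continuous_on S3 (\<lambda>x. G (x \<odot> circ e t))" if "continuous_on S3 G" for G :: "real ^ 4 \<Rightarrow> real" and t
    by (rule continuous_on_compose2[OF that]) (use circ_S3[OF e] in \<open>auto intro!: continuous_intros simp: norm_qmul\<close>)
  define D where "D = (\<lambda>n x. (real (Suc n))\<^sup>2 * ((F (x \<odot> circ e (1 / Suc n)) + F (x \<odot> circ e (- (1 / Suc n))) - 2 * F x) * P x))"
  have cD: "continuous_on S3 (D n)" for n
    unfolding D_def by (intro continuous_intros cR cF P)
  have mean: "\<exists>t. 0 < t \<and> t \<le> 1 / Suc n \<and> D n x = (F2 (x \<odot> circ e t) + F2 (x \<odot> circ e (- t))) / 2 * P x"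
    if x: "x \<in> S3" for n x
  proof -
    obtain t where t: "0 < t" "t \<le> 1 / Suc n"
      "F (x \<odot> circ e (1 / Suc n)) + F (x \<odot> circ e (- (1 / Suc n))) - 2 * F x =
       (1 / Suc n)\<^sup>2 * ((F2 (x \<odot> circ e t) + F2 (x \<odot> circ e (- t))) / 2)"
      using second_difference[OF F e x, of "1 / Suc n"] by auto
    have "(real (Suc n))\<^sup>2 * (1 / Suc n)\<^sup>2 = (1 :: real)" by (simp flip: power_mult_distrib)
    then have "D n x = (F2 (x \<odot> circ e t) + F2 (x \<odot> circ e (- t))) / 2 * P x"
      unfolding D_def t(3) by (simp flip: mult.assoc)
    then show ?thesis using t by blast
  qed
  obtain A where A: "\<And>x. x \<in> S3 \<Longrightarrow> \<bar>F2 x\<bar> \<le> A" using bounded_cont[OF cF(2)] by blast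
  obtain B where B: "\<And>x. x \<in> S3 \<Longrightarrow> \<bar>P x\<bar> \<le> B" using bounded_cont[OF P] by blast
  have "(\<lambda>n. LINT x|\<sigma>. D n x) \<longlonglongrightarrow> (LINT x|\<sigma>. F2 x * P x)"
  proof (rule integral_dominated_convergence)
    show "(\<lambda>x. F2 x * P x) \<in> borel_measurable \<sigma>"
      by (intro measurable_cont continuous_intros cF P)
    show "D n \<in> borel_measurable \<sigma>" for n by (intro measurable_cont cD)
    show "integrable \<sigma> (\<lambda>_. A * B)" by simp
    show "AE x in \<sigma>. norm (D n x) \<le> A * B" for n
    proof (rule AE_I2)
      fix x assume "x \<in> space \<sigma>" then have x: "x \<in> S3" by simp
      from mean[OF x, of n] obtain t where
        D: "D n x = (F2 (x \<odot> circ e t) + F2 (x \<odot> circ e (- t))) / 2 * P x" by blast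
      have half: "\<bar>a\<bar> \<le> A \<Longrightarrow> \<bar>b\<bar> \<le> A \<Longrightarrow> \<bar>(a + b) / 2\<bar> \<le> A" for a b :: real
        unfolding abs_le_iff by (auto simp: field_simps)
      have "\<bar>F2 (x \<odot> circ e t)\<bar> \<le> A" "\<bar>F2 (x \<odot> circ e (- t))\<bar> \<le> A"
        by (intro A S3_qmul x circ_S3 e)+
      then have "\<bar>(F2 (x \<odot> circ e t) + F2 (x \<odot> circ e (- t))) / 2\<bar> \<le> A" by (rule half)
      then show "norm (D n x) \<le> A * B"
        unfolding D real_norm_def abs_mult by (intro mult_mono B x) auto
    qed
    show "AE x in \<sigma>. (\<lambda>n. D n x) \<longlonglongrightarrow> F2 x * P x"
    proof (rule AE_I2)
      fix x assume "x \<in> space \<sigma>" then have x: "x \<in> S3" by simp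
      from mean[OF x] obtain t where t: "\<And>n. 0 < t n" "\<And>n. t n \<le> 1 / Suc n"
        "\<And>n. D n x = (F2 (x \<odot> circ e (t n)) + F2 (x \<odot> circ e (- t n))) / 2 * P x" by metis
      have t0: "t \<longlonglongrightarrow> 0"
        by (rule tendsto_sandwich[OF _ _ tendsto_const LIMSEQ_inverse_real_of_nat])
           (use t in \<open>auto intro!: always_eventually simp: less_imp_le inverse_eq_divide\<close>)
      have "continuous_on UNIV (\<lambda>t. F2 (x \<odot> circ e t))"
        by (rule continuous_on_compose2[OF cF(2) continuous_circ]) (use circ_S3[OF e] x in \<open>auto simp: norm_qmul\<close>)
      then have c: "isCont (\<lambda>t. F2 (x \<odot> circ e t)) 0"
        by (simp add: continuous_on_eq_continuous_at)
      have "(\<lambda>n. F2 (x \<odot> circ e (t n))) \<longlonglongrightarrow> F2 x"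
        using isCont_tendsto_compose[OF c t0] by simp
      moreover have "(\<lambda>n. F2 (x \<odot> circ e (- t n))) \<longlonglongrightarrow> F2 x"
        using isCont_tendsto_compose[OF c, of "\<lambda>n. - t n"] tendsto_minus[OF t0] by simp
      ultimately have "(\<lambda>n. (F2 (x \<odot> circ e (t n)) + F2 (x \<odot> circ e (- t n))) / 2 * P x) \<longlonglongrightarrow> (F2 x + F2 x) / 2 * P x"
        by (intro tendsto_intros) auto
      then show "(\<lambda>n. D n x) \<longlonglongrightarrow> F2 x * P x" by (simp add: t(3))
    qed
  qed
  then show ?thesis unfolding D_def by simp
qed

text \<open>
  For second difference quotients symmetry is translation invariance of the integral: replacing
  \<open>x\<close> by \<open>x \<odot> circ e (- t)\<close> moves the translation from \<open>F\<close> to \<open>P\<close>. The limit \<open>t \<rightarrow> 0\<close> gives the claim.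
\<close>

lemma second_deriv_symmetric:
  assumes F: "second_deriv_along e F F2" and P: "second_deriv_along e P P2" and e: "e \<in> imag_units"
  shows "(LINT x|\<sigma>. F2 x * P x) = (LINT x|\<sigma>. F x * P2 x)"
proof -
  have cF: "continuous_on S3 F" "continuous_on S3 P"
    using F P by (auto simp: second_deriv_along_def)
  have cR: "continuous_on S3 (\<lambda>x. G (x \<odot> circ e t))" if "continuous_on S3 G" for G :: "real ^ 4 \<Rightarrow> real" and t
    by (rule continuous_on_compose2[OF that]) (use circ_S3[OF e] in \<open>auto intro!: continuous_intros simp: norm_qmul\<close>)
  have shift: "(LINT x|\<sigma>. F (x \<odot> circ e t) * P x) = (LINT x|\<sigma>. F x * P (x \<odot> circ e (- t)))" for t
  proof -
    have "(LINT x|\<sigma>. F x * P (x \<odot> circ e (- t))) = (LINT x|\<sigma>. F (x \<odot> circ e t) * P (x \<odot> circ e t \<odot> circ e (- t)))"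
      by (rule integral_qmul_right[OF circ_S3[OF e], symmetric]) (intro continuous_intros cF cR)
    also have "\<dots> = (LINT x|\<sigma>. F (x \<odot> circ e t) * P x)"
      using qcnj_cancel(4)[OF circ_S3[OF e]] by (simp add: qcnj_circ[OF e])
    finally show ?thesis ..
  qed
  have "(LINT x|\<sigma>. (F (x \<odot> circ e t) + F (x \<odot> circ e (- t)) - 2 * F x) * P x) =
        (LINT x|\<sigma>. (P (x \<odot> circ e t) + P (x \<odot> circ e (- t)) - 2 * P x) * F x)" for t
  proof -
    have i: "integrable \<sigma> (\<lambda>x. G (x \<odot> circ e t) * H x)" "integrable \<sigma> (\<lambda>x. 2 * (G x * H x))"
      if "continuous_on S3 G" "continuous_on S3 H" for G H :: "real ^ 4 \<Rightarrow> real" and t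
      by (intro integrable_cont continuous_intros cR that)+
    have ex: "(LINT x|\<sigma>. (G (x \<odot> circ e t) + G (x \<odot> circ e (- t)) - 2 * G x) * H x) =
      (LINT x|\<sigma>. G (x \<odot> circ e t) * H x) + (LINT x|\<sigma>. G (x \<odot> circ e (- t)) * H x) - (LINT x|\<sigma>. 2 * (G x * H x))"
      if "continuous_on S3 G" "continuous_on S3 H" for G H :: "real ^ 4 \<Rightarrow> real"
      unfolding left_diff_distrib distrib_right mult.assoc
      using i[OF that] by (simp add: Bochner_Integration.integral_add Bochner_Integration.integral_diff)
    show ?thesis
      unfolding ex[OF cF] ex[OF cF(2,1)] shift[of t] shift[of "- t"] by (simp add: mult.commute)
  qed
  then have "(\<lambda>n. (real (Suc n))\<^sup>2 * (LINT x|\<sigma>. (F (x \<odot> circ e (1 / Suc n)) + F (x \<odot> circ e (- (1 / Suc n))) - 2 * F x) * P x))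
     = (\<lambda>n. (real (Suc n))\<^sup>2 * (LINT x|\<sigma>. (P (x \<odot> circ e (1 / Suc n)) + P (x \<odot> circ e (- (1 / Suc n))) - 2 * P x) * F x))"
    by simp
  then show ?thesis
    using LIMSEQ_unique[OF second_difference_integral[OF F e cF(2)]] second_difference_integral[OF P e cF(1)]
    by (simp add: mult.commute)
qed

section \<open>Moments of eigenfunctions\<close>

text \<open>
  The chain rule, with \<open>x \<odot> e \<odot> e = - x\<close> for the second derivative of the inner product.
\<close>

lemma zonal_second_deriv:
  fixes g g' g'' :: "real \<Rightarrow> real"
  assumes g: "\<And>s. (g has_real_derivative g' s) (at s)" "\<And>s. (g' has_real_derivative g'' s) (at s)"
    and g'': "continuous_on UNIV g''" and e: "e \<in> imag_units"
  shows "second_deriv_along e (\<lambda>x. g (x \<bullet> v)) (\<lambda>x. g'' (x \<bullet> v) * ((x \<odot> e) \<bullet> v)\<^sup>2 - g' (x \<bullet> v) * (x \<bullet> v))"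
proof -
  have cont: "continuous_on UNIV g" "continuous_on UNIV g'"
    using g by (auto intro!: DERIV_continuous_on[where s = UNIV])
  have comp: "continuous_on S3 (\<lambda>x. f (x \<bullet> v))" if "continuous_on UNIV f" for f :: "real \<Rightarrow> real"
    by (rule continuous_on_compose2[OF that]) (auto intro!: continuous_intros)
  have d1: "((\<lambda>t. (x \<odot> circ e t) \<bullet> v) has_real_derivative (x \<odot> circ e t \<odot> e) \<bullet> v) (at t)" for x t
    using bounded_linear.has_vector_derivative[OF bounded_linear_inner_left circ_deriv[OF e]]
    by (simp add: has_real_derivative_iff_has_vector_derivative)
  have d2: "((\<lambda>t. (x \<odot> circ e t \<odot> e) \<bullet> v) has_real_derivative - ((x \<odot> circ e t) \<bullet> v)) (at t)" for x t
  proof -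
    have "((\<lambda>t. (x \<odot> circ e t) \<odot> e) has_vector_derivative (x \<odot> circ e t \<odot> e) \<odot> e) (at t)"
      by (rule bounded_linear.has_vector_derivative[OF bounded_bilinear.bounded_linear_left[OF bounded_bilinear_qmul] circ_deriv[OF e]])
    then have "((\<lambda>t. (x \<odot> circ e t \<odot> e) \<bullet> v) has_vector_derivative ((x \<odot> circ e t \<odot> e) \<odot> e) \<bullet> v) (at t)"
      by (rule bounded_linear.has_vector_derivative[OF bounded_linear_inner_left])
    then show ?thesis
      using imag_unit(4)[OF e] by (simp add: has_real_derivative_iff_has_vector_derivative qmul_assoc)
  qed
  show ?thesis
    unfolding second_deriv_along_def
  proof (intro conjI exI[of _ "\<lambda>x. g' (x \<bullet> v) * ((x \<odot> e) \<bullet> v)"] ballI allI)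
    show "continuous_on S3 (\<lambda>x. g (x \<bullet> v))" by (rule comp[OF cont(1)])
    show "continuous_on S3 (\<lambda>x. g'' (x \<bullet> v) * ((x \<odot> e) \<bullet> v)\<^sup>2 - g' (x \<bullet> v) * (x \<bullet> v))"
      by (intro continuous_intros comp cont g'')
    fix x t
    show "((\<lambda>t. g ((x \<odot> circ e t) \<bullet> v)) has_real_derivative
        g' ((x \<odot> circ e t) \<bullet> v) * ((x \<odot> circ e t \<odot> e) \<bullet> v)) (at t)"
      by (rule DERIV_chain2[OF g(1) d1])
    show "((\<lambda>t. g' ((x \<odot> circ e t) \<bullet> v) * ((x \<odot> circ e t \<odot> e) \<bullet> v)) has_real_derivative
        g'' ((x \<odot> circ e t) \<bullet> v) * ((x \<odot> circ e t \<odot> e) \<bullet> v)\<^sup>2 -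
        g' ((x \<odot> circ e t) \<bullet> v) * ((x \<odot> circ e t) \<bullet> v)) (at t)"
      by (rule DERIV_cong[OF DERIV_mult[OF DERIV_chain2[OF g(2) d1] d2]])
         (simp add: power2_eq_square algebra_simps)
  qed
qed

lemma sum_imag_units: "(\<Sum>e\<in>imag_units. f e) = f (axis 2 1) + f (axis 3 1) + (f (axis 4 1) :: 'b :: comm_monoid_add)"
proof -
  have "axis 2 1 \<noteq> (axis 3 1 :: real ^ 4)" "axis 2 1 \<noteq> (axis 4 1 :: real ^ 4)" "axis 3 1 \<noteq> (axis 4 1 :: real ^ 4)"
    by (simp_all add: vec4_eq_iff axis_def)
  then show ?thesis by (simp add: add.assoc)
qed

text \<open>
  Parseval's identity for \<open>v\<close>: the vectors \<open>x\<close> and \<open>x \<odot> e\<close> form an orthonormal basis of \<open>\<real>\<^sup>4\<close>.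
\<close>

lemma sum_tangent_squares:
  assumes "x \<in> S3" "v \<in> S3"
  shows "(\<Sum>e\<in>imag_units. ((x \<odot> e) \<bullet> v)\<^sup>2) = 1 - (x \<bullet> v)\<^sup>2"
proof -
  have "(\<Sum>e\<in>imag_units. ((x \<odot> e) \<bullet> v)\<^sup>2) + (x \<bullet> v)\<^sup>2 = (x \<bullet> x) * (v \<bullet> v)"
    unfolding sum_imag_units by (simp add: inner_4 axis_def power2_eq_square algebra_simps)
  then show ?thesis using assms unfolding S3_iff by simp
qed

definition moment :: "(real ^ 4 \<Rightarrow> real) \<Rightarrow> real ^ 4 \<Rightarrow> nat \<Rightarrow> real" where
  "moment F v n = (LINT x|\<sigma>. F x * (x \<bullet> v) ^ n)"

text \<open>
  The equation \<open>\<Delta> F = \<mu> F\<close> tested against the functions \<open>x \<mapsto> \<langle>x, v\<rangle>\<^sup>n\<close>. No derivative of \<open>F\<close> occurs,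
  so the property passes to integrals over a parameter by exchanging the order of integration
  (\<open>weak_eigen_integral\<close>). For \<open>n < 2\<close> the truncated exponent \<open>n - 2\<close> is harmless because of the factor \<open>n (n - 1)\<close>.
\<close>

definition weak_eigen :: "real \<Rightarrow> (real ^ 4 \<Rightarrow> real) \<Rightarrow> bool" where
  "weak_eigen \<mu> F \<longleftrightarrow> continuous_on S3 F \<and>
     (\<forall>v\<in>S3. \<forall>n. (real n * (real n + 2) - \<mu>) * moment F v n = real n * (real n - 1) * moment F v (n - 2))"

lemma weak_eigen_cont: "weak_eigen \<mu> F \<Longrightarrow> continuous_on S3 F"
  by (simp add: weak_eigen_def)

lemma integrable_prod: "continuous_on S3 F \<Longrightarrow> continuous_on S3 P \<Longrightarrow> integrable \<sigma> (\<lambda>x. F x * P x)"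
  for F P :: "real ^ 4 \<Rightarrow> real"
  by (intro integrable_cont continuous_intros)

text \<open>
  Symmetry moves the Laplacian from \<open>F\<close> to the power \<open>\<langle>x, v\<rangle>\<^sup>n\<close>, where \<open>sum_tangent_squares\<close> evaluates it.
\<close>

lemma eigen_imp_weak_eigen:
  assumes F: "continuous_on S3 F" "\<And>e. e \<in> imag_units \<Longrightarrow> second_deriv_along e F (F2 e)"
    and eig: "\<And>x. x \<in> S3 \<Longrightarrow> (\<Sum>e\<in>imag_units. F2 e x) = - \<mu> * F x"
  shows "weak_eigen \<mu> F"
  unfolding weak_eigen_def
proof (intro conjI ballI allI F(1))
  fix v n assume v: "v \<in> S3"
  let ?P = "\<lambda>x. (x \<bullet> v) ^ n"
  let ?P2 = "\<lambda>e x. real n * (real n - 1) * (x \<bullet> v) ^ (n - 2) * ((x \<odot> e) \<bullet> v)\<^sup>2 - real n * (x \<bullet> v) ^ (n - 1) * (x \<bullet> v)"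
  have P: "second_deriv_along e ?P (?P2 e)" if "e \<in> imag_units" for e
  proof (rule zonal_second_deriv[OF _ _ _ that])
    show "((\<lambda>s::real. s ^ n) has_real_derivative real n * s ^ (n - 1)) (at s)" for s
      by (auto intro!: derivative_eq_intros)
    show "((\<lambda>s::real. real n * s ^ (n - 1)) has_real_derivative real n * (real n - 1) * s ^ (n - 2)) (at s)" for s
      by (cases n) (auto intro!: derivative_eq_intros simp: numeral_2_eq_2)
  qed (intro continuous_intros)
  have c: "continuous_on S3 (F2 e)" "continuous_on S3 (?P2 e)" "continuous_on S3 ?P" if "e \<in> imag_units" for e
    using F(2)[OF that] P[OF that] by (simp_all only: second_deriv_along_def)
  have P2: "(\<Sum>e\<in>imag_units. ?P2 e x) = real n * (real n - 1) * (x \<bullet> v) ^ (n - 2) - real n * (real n + 2) * (x \<bullet> v) ^ n"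
    if x: "x \<in> S3" for x
  proof -
    have "(\<Sum>e\<in>imag_units. ?P2 e x) =
      real n * (real n - 1) * (x \<bullet> v) ^ (n - 2) * (1 - (x \<bullet> v)\<^sup>2) - 3 * (real n * (x \<bullet> v) ^ (n - 1) * (x \<bullet> v))"
      unfolding sum_tangent_squares[OF x v, symmetric] sum_imag_units by (simp add: algebra_simps)
    moreover have "real n * (x \<bullet> v) ^ (n - 1) * (x \<bullet> v) = real n * (x \<bullet> v) ^ n"
      by (cases n) simp_all
    moreover have "real n * (real n - 1) * (x \<bullet> v) ^ (n - 2) * (x \<bullet> v)\<^sup>2 = real n * (real n - 1) * (x \<bullet> v) ^ n"
    proof -
      consider "n = 0" | "n = 1" | "n \<ge> 2" by linarith
      then show ?thesis
      proof cases
        case 3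
        then have "(x \<bullet> v) ^ (n - 2) * (x \<bullet> v)\<^sup>2 = (x \<bullet> v) ^ n"
          by (metis power_add le_add_diff_inverse2)
        then show ?thesis by (simp only: mult.assoc)
      qed auto
    qed
    ultimately have "(\<Sum>e\<in>imag_units. ?P2 e x) =
      real n * (real n - 1) * (x \<bullet> v) ^ (n - 2) - real n * (real n - 1) * (x \<bullet> v) ^ n - 3 * (real n * (x \<bullet> v) ^ n)"
      by (simp only: right_diff_distrib mult_1_right)
    also have "\<dots> = real n * (real n - 1) * (x \<bullet> v) ^ (n - 2) - real n * (real n + 2) * (x \<bullet> v) ^ n"
      by (simp add: algebra_simps)
    finally show ?thesis .
  qed
  have "- \<mu> * moment F v n = (LINT x|\<sigma>. (\<Sum>e\<in>imag_units. F2 e x) * ?P x)"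
    unfolding moment_def integral_mult_right_zero[symmetric]
    by (rule integral_cong_S3) (simp add: eig)
  also have "\<dots> = (\<Sum>e\<in>imag_units. LINT x|\<sigma>. F2 e x * ?P x)"
    unfolding sum_distrib_right by (rule Bochner_Integration.integral_sum) (rule integrable_prod, (fact c)+)
  also have "\<dots> = (\<Sum>e\<in>imag_units. LINT x|\<sigma>. F x * ?P2 e x)"
    by (rule sum.cong[OF refl]) (rule second_deriv_symmetric[OF F(2) P])
  also have "\<dots> = (LINT x|\<sigma>. (\<Sum>e\<in>imag_units. F x * ?P2 e x))"
    by (rule Bochner_Integration.integral_sum[symmetric]) (rule integrable_prod[OF F(1)], fact c)
  also have "\<dots> = (LINT x|\<sigma>. real n * (real n - 1) * (F x * (x \<bullet> v) ^ (n - 2)) - real n * (real n + 2) * (F x * ?P x))"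
    unfolding sum_distrib_left[symmetric] by (rule integral_cong_S3) (simp only: P2, simp add: algebra_simps)
  also have "\<dots> = real n * (real n - 1) * moment F v (n - 2) - real n * (real n + 2) * moment F v n"
    unfolding moment_def
    by (subst Bochner_Integration.integral_diff)
       (auto intro!: integrable_cont continuous_intros F(1))
  finally show "(real n * (real n + 2) - \<mu>) * moment F v n = real n * (real n - 1) * moment F v (n - 2)"
    by (simp add: algebra_simps)
qed

lemma moment_lin:
  assumes "continuous_on S3 F" "continuous_on S3 G"
  shows "moment (\<lambda>x. a * F x + b * G x) v n = a * moment F v n + b * moment G v n"
proof -
  have "moment (\<lambda>x. a * F x + b * G x) v n = (LINT x|\<sigma>. a * (F x * (x \<bullet> v) ^ n) + b * (G x * (x \<bullet> v) ^ n))"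
    unfolding moment_def by (rule integral_cong_S3) (simp add: algebra_simps)
  also have "\<dots> = a * moment F v n + b * moment G v n"
    unfolding moment_def
    by (subst Bochner_Integration.integral_add) (auto intro!: integrable_cont continuous_intros assms)
  finally show ?thesis .
qed

lemma weak_eigen_lin:
  assumes "weak_eigen \<mu> F" "weak_eigen \<mu> G"
  shows "weak_eigen \<mu> (\<lambda>x. a * F x + b * G x)"
  unfolding weak_eigen_def
proof (intro conjI ballI allI)
  have c: "continuous_on S3 F" "continuous_on S3 G" using assms by (auto simp: weak_eigen_def)
  show "continuous_on S3 (\<lambda>x. a * F x + b * G x)" by (intro continuous_intros c)
  fix v n assume "v \<in> S3"
  then have "a * ((real n * (real n + 2) - \<mu>) * moment F v n) + b * ((real n * (real n + 2) - \<mu>) * moment G v n)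
    = a * (real n * (real n - 1) * moment F v (n - 2)) + b * (real n * (real n - 1) * moment G v (n - 2))"
    using assms by (simp add: weak_eigen_def)
  then show "(real n * (real n + 2) - \<mu>) * moment (\<lambda>x. a * F x + b * G x) v n
    = real n * (real n - 1) * moment (\<lambda>x. a * F x + b * G x) v (n - 2)"
    unfolding moment_lin[OF c] by (simp add: algebra_simps)
qed

text \<open>
  Vanishing moments annihilate all polynomials in \<open>\<langle>x, v\<rangle>\<close>, and these are uniformly dense in the
  continuous functions of \<open>\<langle>x, v\<rangle> \<in> [-1, 1]\<close>.
\<close>

lemma integral_poly_inner_zero:
  assumes F: "continuous_on S3 F" and m: "\<And>n. moment F v n = 0" and v: "v \<in> S3"
    and \<phi>: "continuous_on {-1..1} \<phi>"
  shows "(LINT x|\<sigma>. F x * \<phi> (x \<bullet> v)) = 0"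
proof -
  have rng: "x \<bullet> v \<in> {-1..1}" if "x \<in> S3" for x
    using Cauchy_Schwarz_ineq2[of x v] that v by auto
  have c\<phi>: "continuous_on S3 (\<lambda>x. \<phi> (x \<bullet> v))"
    by (rule continuous_on_compose2[OF \<phi>]) (use rng in \<open>auto intro!: continuous_intros\<close>)
  define A where "A = (LINT x|\<sigma>. \<bar>F x\<bar>)"
  have A: "A \<ge> 0" by (simp add: A_def)
  have "\<bar>LINT x|\<sigma>. F x * \<phi> (x \<bullet> v)\<bar> \<le> A * e" if e: "e > 0" for e
  proof -
    obtain p where p: "real_polynomial_function p" "\<And>s. s \<in> {-1..1} \<Longrightarrow> \<bar>\<phi> s - p s\<bar> < e"
      using Stone_Weierstrass_real_polynomial_function[OF compact_Icc \<phi> e] by blast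
    obtain a n where pa: "p = (\<lambda>s. \<Sum>i\<le>n. a i * s ^ i)"
      using p(1) unfolding real_polynomial_function_iff_sum by blast
    have cp: "continuous_on S3 (\<lambda>x. p (x \<bullet> v))" unfolding pa by (intro continuous_intros)
    have "(LINT x|\<sigma>. F x * p (x \<bullet> v)) = (LINT x|\<sigma>. (\<Sum>i\<le>n. a i * (F x * (x \<bullet> v) ^ i)))"
      unfolding pa by (rule integral_cong_S3) (simp add: sum_distrib_left algebra_simps)
    also have "\<dots> = (\<Sum>i\<le>n. LINT x|\<sigma>. a i * (F x * (x \<bullet> v) ^ i))"
      by (rule Bochner_Integration.integral_sum) (intro integrable_cont continuous_intros F)
    also have "\<dots> = 0" using m by (simp add: moment_def)
    finally have "(LINT x|\<sigma>. F x * \<phi> (x \<bullet> v)) = (LINT x|\<sigma>. F x * \<phi> (x \<bullet> v)) - (LINT x|\<sigma>. F x * p (x \<bullet> v))"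
      by simp
    also have "\<dots> = (LINT x|\<sigma>. F x * (\<phi> (x \<bullet> v) - p (x \<bullet> v)))"
      unfolding right_diff_distrib
      by (rule Bochner_Integration.integral_diff[symmetric]) (intro integrable_cont continuous_intros F c\<phi> cp)+
    also have "\<bar>\<dots>\<bar> \<le> (LINT x|\<sigma>. \<bar>F x * (\<phi> (x \<bullet> v) - p (x \<bullet> v))\<bar>)" by (rule integral_abs_bound)
    also have "\<dots> \<le> (LINT x|\<sigma>. \<bar>F x\<bar> * e)"
    proof (rule integral_mono)
      show "integrable \<sigma> (\<lambda>x. \<bar>F x * (\<phi> (x \<bullet> v) - p (x \<bullet> v))\<bar>)" "integrable \<sigma> (\<lambda>x. \<bar>F x\<bar> * e)"
        by (intro integrable_cont continuous_intros F c\<phi> cp)+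
      fix x assume "x \<in> space \<sigma>"
      then have "\<bar>\<phi> (x \<bullet> v) - p (x \<bullet> v)\<bar> < e" using rng p(2) by simp
      then show "\<bar>F x * (\<phi> (x \<bullet> v) - p (x \<bullet> v))\<bar> \<le> \<bar>F x\<bar> * e"
        unfolding abs_mult by (intro mult_left_mono) auto
    qed
    also have "\<dots> = A * e" by (simp add: A_def)
    finally show ?thesis .
  qed
  then have bound: "\<bar>LINT x|\<sigma>. F x * \<phi> (x \<bullet> v)\<bar> \<le> A * e" if "e > 0" for e using that by blast
  show ?thesis
  proof (rule ccontr)
    define I where "I = \<bar>LINT x|\<sigma>. F x * \<phi> (x \<bullet> v)\<bar>"
    assume "(LINT x|\<sigma>. F x * \<phi> (x \<bullet> v)) \<noteq> 0"
    then have "I > 0" by (simp add: I_def)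
    moreover have "I \<le> A * (I / (A + 1))"
      using bound[of "I / (A + 1)"] \<open>I > 0\<close> A by (simp add: I_def)
    ultimately show False using A by (simp add: field_simps)
  qed
qed

text \<open>
  If \<open>F v > 0\<close>, integrate \<open>F\<close> against a continuous function of \<open>\<langle>x, v\<rangle>\<close> that is positive at \<open>v\<close> and
  supported in a cap where \<open>F\<close> is positive.
\<close>

lemma moments_determine_value:
  assumes F: "continuous_on S3 F" and m: "\<And>n. moment F v n = 0" and v: "v \<in> S3"
  shows "F v = 0"
proof -
  have *: "\<not> G v > 0" if G: "continuous_on S3 G" and m: "\<And>n. moment G v n = 0" for G
  proof
    assume pos: "G v > 0"
    from G v pos obtain d where d: "d > 0" "\<And>x. x \<in> S3 \<Longrightarrow> dist x v < d \<Longrightarrow> dist (G x) (G v) < G v"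
      unfolding continuous_on_iff by metis
    \<comment> \<open>On the sphere, \<open>|x - v|\<^sup>2 = 2 - 2 \<langle>x, v\<rangle>\<close>, so this vanishes at distance \<open>d\<close> or more from \<open>v\<close>.\<close>
    define \<phi> where "\<phi> = (\<lambda>s::real. max 0 (s - (1 - d\<^sup>2 / 2)))"
    have c\<phi>: "continuous_on UNIV \<phi>" unfolding \<phi>_def by (intro continuous_intros)
    have int: "(LINT x|\<sigma>. G x * \<phi> (x \<bullet> v)) = 0"
      by (rule integral_poly_inner_zero[OF G m v continuous_on_subset[OF c\<phi>]]) auto
    have cont: "continuous_on S3 (\<lambda>x. G x * \<phi> (x \<bullet> v))"
      by (intro continuous_intros G continuous_on_compose2[OF c\<phi>]) auto
    have nonneg: "0 \<le> G x * \<phi> (x \<bullet> v)" if x: "x \<in> S3" for x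
    proof (cases "dist x v < d")
      case True
      then have "0 < G x" using d(2)[OF x True] by (simp add: dist_real_def)
      then show ?thesis by (simp add: \<phi>_def)
    next
      case False
      then have "d\<^sup>2 \<le> (dist x v)\<^sup>2" using d(1) by (intro power_mono) auto
      also have "(dist x v)\<^sup>2 = 2 - 2 * (x \<bullet> v)"
        using x v unfolding S3_iff dist_norm by (simp add: power2_norm_eq_inner inner_diff algebra_simps inner_commute)
      finally have "\<phi> (x \<bullet> v) = 0" by (simp add: \<phi>_def)
      then show ?thesis by simp
    qed
    have "G v * \<phi> (v \<bullet> v) = 0" by (rule integral_zero_imp_zero[OF cont nonneg int v])
    moreover have "\<phi> (v \<bullet> v) > 0" using v d(1) unfolding S3_iff by (simp add: \<phi>_def)
    ultimately show False using pos by simp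
  qed
  have "moment (\<lambda>x. - F x) v n = 0" for n
    using moment_lin[OF F F, of "-1" 0 v n] m by simp
  then have "\<not> - F v > 0" by (intro *) (auto intro!: continuous_intros F)
  then show ?thesis using *[OF F m] by simp
qed

section \<open>The zonal function of degree twelve\<close>

text \<open>
  The Chebyshev polynomial of the second kind, \<open>U\<^sub>1\<^sub>2 (cos t) = sin (13 t) / sin t\<close>. At the real part
  of a unit quaternion it is the character of the irreducible representation of \<open>SU(2)\<close> of dimension 13.
\<close>

definition U12 :: "real \<Rightarrow> real" where
  "U12 s = 4096 * s ^ 12 - 11264 * s ^ 10 + 11520 * s ^ 8 - 5376 * s ^ 6 + 1120 * s ^ 4 - 84 * s\<^sup>2 + 1"

definition dU12 :: "real \<Rightarrow> real" where
  "dU12 s = 49152 * s ^ 11 - 112640 * s ^ 9 + 92160 * s ^ 7 - 32256 * s ^ 5 + 4480 * s ^ 3 - 168 * s"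

definition ddU12 :: "real \<Rightarrow> real" where
  "ddU12 s = 540672 * s ^ 10 - 1013760 * s ^ 8 + 645120 * s ^ 6 - 161280 * s ^ 4 + 13440 * s\<^sup>2 - 168"

lemma U12_deriv: "(U12 has_real_derivative dU12 s) (at s)" "(dU12 has_real_derivative ddU12 s) (at s)"
  unfolding U12_def[abs_def] dU12_def[abs_def] ddU12_def by (auto intro!: derivative_eq_intros)

text \<open>
  The Laplace eigenvalue equation for functions of \<open>s = \<langle>x, v\<rangle>\<close>.
\<close>

lemma U12_ode: "(1 - s\<^sup>2) * ddU12 s - 3 * s * dU12 s = - 168 * U12 s"
  unfolding U12_def dU12_def ddU12_def by (simp add: algebra_simps eval_nat_numeral)

lemma U12_1 [simp]: "U12 1 = 13" by (simp add: U12_def)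

lemma continuous_U12 [continuous_intros]: "continuous_on A f \<Longrightarrow> continuous_on A (\<lambda>x. U12 (f x))"
  unfolding U12_def by (intro continuous_intros)

abbreviation zonal :: "real ^ 4 \<Rightarrow> real ^ 4 \<Rightarrow> real" where
  "zonal v x \<equiv> U12 (x \<bullet> v)"

lemma zonal_second_deriv_U12:
  assumes "e \<in> imag_units"
  shows "second_deriv_along e (zonal v) (\<lambda>x. ddU12 (x \<bullet> v) * ((x \<odot> e) \<bullet> v)\<^sup>2 - dU12 (x \<bullet> v) * (x \<bullet> v))"
  by (rule zonal_second_deriv[OF U12_deriv _ assms]) (unfold ddU12_def[abs_def], intro continuous_intros)

lemma zonal_eigen:
  assumes "x \<in> S3" "v \<in> S3"
  shows "(\<Sum>e\<in>imag_units. ddU12 (x \<bullet> v) * ((x \<odot> e) \<bullet> v)\<^sup>2 - dU12 (x \<bullet> v) * (x \<bullet> v)) = - 168 * zonal v x"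
proof -
  have "(\<Sum>e\<in>imag_units. ddU12 (x \<bullet> v) * ((x \<odot> e) \<bullet> v)\<^sup>2 - dU12 (x \<bullet> v) * (x \<bullet> v))
    = ddU12 (x \<bullet> v) * (\<Sum>e\<in>imag_units. ((x \<odot> e) \<bullet> v)\<^sup>2) - 3 * (x \<bullet> v) * dU12 (x \<bullet> v)"
    unfolding sum_imag_units by (simp add: algebra_simps)
  then show ?thesis
    unfolding sum_tangent_squares[OF assms] U12_ode[symmetric] by (simp add: mult.commute)
qed

lemma weak_eigen_zonal: "v \<in> S3 \<Longrightarrow> weak_eigen 168 (zonal v)"
  by (rule eigen_imp_weak_eigen[OF _ zonal_second_deriv_U12 zonal_eigen]) (auto intro!: continuous_intros)

lemma weak_eigen_const: "weak_eigen 0 (\<lambda>_. 1)"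
  by (rule eigen_imp_weak_eigen[where ?F2.0 = "\<lambda>_ _. 0"])
     (auto simp: second_deriv_along_def intro!: exI[of _ "\<lambda>_. 0"] continuous_intros)

text \<open>
  The factor \<open>n (n + 2) - 168\<close> vanishes only for \<open>n = 12\<close>, so the recursion started at \<open>n = 0, 1\<close> gives
  zero up to 11.
\<close>

lemma moment_below_12:
  assumes F: "weak_eigen 168 F" and v: "v \<in> S3"
  shows "n < 12 \<Longrightarrow> moment F v n = 0"
proof (induction n rule: less_induct)
  case (less n)
  have "real n * (real n - 1) * moment F v (n - 2) = 0"
  proof -
    consider "n = 0" | "n = 1" | "n \<ge> 2" by linarith
    then show ?thesis
    proof cases
      case 3
      then show ?thesis using less.IH[of "n - 2"] less.prems by simp
    qed auto
  qed
  then have "(real n * (real n + 2) - 168) * moment F v n = 0"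
    using F v unfolding weak_eigen_def by simp
  moreover have "real n * (real n + 2) < 12 * 14"
    using less.prems by (intro mult_strict_mono) auto
  ultimately show ?case by simp
qed

lemma moment_12_determines:
  assumes F: "weak_eigen 168 F" and v: "v \<in> S3" and 12: "moment F v 12 = 0"
  shows "moment F v n = 0"
proof (induction n rule: less_induct)
  case (less n)
  consider "n < 12" | "n = 12" | "n > 12" by linarith
  then show ?case
  proof cases
    case 3
    then have "(real n * (real n + 2) - 168) * moment F v n = 0"
      using F v less.IH[of "n - 2"] unfolding weak_eigen_def by simp
    moreover have "real n * (real n + 2) > 12 * 14"
      using 3 by (intro mult_strict_mono) auto
    ultimately show ?thesis by simp
  qed (use 12 moment_below_12[OF F v] in auto)
qed

lemma integral_zonal_moment:
  assumes F: "weak_eigen 168 F" and v: "v \<in> S3"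
  shows "(LINT x|\<sigma>. F x * zonal v x) = 4096 * moment F v 12"
proof -
  have c: "continuous_on S3 F" using F by (rule weak_eigen_cont)
  have i: "integrable \<sigma> (\<lambda>x. F x * (x \<bullet> v) ^ n)" for n
    by (intro integrable_cont continuous_intros c)
  have "(LINT x|\<sigma>. F x * zonal v x) = (LINT x|\<sigma>. 4096 * (F x * (x \<bullet> v) ^ 12) - 11264 * (F x * (x \<bullet> v) ^ 10)
    + 11520 * (F x * (x \<bullet> v) ^ 8) - 5376 * (F x * (x \<bullet> v) ^ 6) + 1120 * (F x * (x \<bullet> v) ^ 4) - 84 * (F x * (x \<bullet> v) ^ 2)
    + F x * (x \<bullet> v) ^ 0)"
    by (rule integral_cong_S3) (simp add: U12_def algebra_simps)
  also have "\<dots> = 4096 * moment F v 12 - 11264 * moment F v 10 + 11520 * moment F v 8 - 5376 * moment F v 6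
    + 1120 * moment F v 4 - 84 * moment F v 2 + moment F v 0"
    unfolding moment_def using i
    by (simp only: Bochner_Integration.integral_add Bochner_Integration.integral_diff
        Bochner_Integration.integrable_add Bochner_Integration.integrable_diff
        integrable_mult_right integral_mult_right_zero)
  also have "\<dots> = 4096 * moment F v 12"
    by (simp add: moment_below_12[OF F v])
  finally show ?thesis .
qed

text \<open>
  The constant of the reproducing formula \<open>zonal_reproducing\<close>: volume divided by dimension.
\<close>

definition \<kappa> :: real where "\<kappa> = measure \<sigma> S3 / 13"

text \<open>
  The recursion of \<open>weak_eigen\<close> for the constant function, whose eigenvalue is 0.
\<close>

lemma moment_const:
  assumes v: "v \<in> S3" and n: "n > 0"
  shows "moment (\<lambda>_. 1) v n = (real n - 1) / (real n + 2) * moment (\<lambda>_. 1) v (n - 2)"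
proof -
  have "real n * ((real n + 2) * moment (\<lambda>_. 1) v n) = real n * ((real n - 1) * moment (\<lambda>_. 1) v (n - 2))"
    using weak_eigen_const v unfolding weak_eigen_def by (simp add: mult.assoc)
  then have "(real n + 2) * moment (\<lambda>_. 1) v n = (real n - 1) * moment (\<lambda>_. 1) v (n - 2)"
    using n by simp
  then show ?thesis by (simp add: field_simps)
qed

text \<open>
  Against \<open>zonal v\<close> only its leading term contributes, by \<open>integral_zonal_moment\<close>; the remaining
  twelfth moment of \<open>U12\<close> is a combination of moments of the constant function. This is the
  orthonormality of characters for one character.
\<close>

lemma integral_zonal_square:
  assumes v: "v \<in> S3"
  shows "(LINT x|\<sigma>. zonal v x * zonal v x) = 13 * \<kappa>"
proof -
  let ?m = "moment (\<lambda>_. 1) v"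
  have i: "integrable \<sigma> (\<lambda>x. 1 * (x \<bullet> v) ^ n)" for n
    by (intro integrable_cont continuous_intros)
  have "moment (zonal v) v 12 = (LINT x|\<sigma>. 4096 * (1 * (x \<bullet> v) ^ 24) - 11264 * (1 * (x \<bullet> v) ^ 22)
    + 11520 * (1 * (x \<bullet> v) ^ 20) - 5376 * (1 * (x \<bullet> v) ^ 18) + 1120 * (1 * (x \<bullet> v) ^ 16) - 84 * (1 * (x \<bullet> v) ^ 14)
    + 1 * (x \<bullet> v) ^ 12)"
    unfolding moment_def
    by (rule integral_cong_S3) (simp add: U12_def algebra_simps flip: power_add)
  also have "\<dots> = 4096 * ?m 24 - 11264 * ?m 22 + 11520 * ?m 20 - 5376 * ?m 18
    + 1120 * ?m 16 - 84 * ?m 14 + ?m 12"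
    unfolding moment_def using i
    by (simp only: Bochner_Integration.integral_add Bochner_Integration.integral_diff
        Bochner_Integration.integrable_add Bochner_Integration.integrable_diff
        integrable_mult_right integral_mult_right_zero)
  also have "4096 * \<dots> = 13 * \<kappa>"
  proof -
    have m0: "?m 0 = 13 * \<kappa>" by (simp add: moment_def \<kappa>_def)
    note r = moment_const[OF v]
    have "?m 2 = 1 / 4 * ?m 0" "?m 4 = 1 / 2 * ?m 2" "?m 6 = 5 / 8 * ?m 4" "?m 8 = 7 / 10 * ?m 6"
      "?m 10 = 9 / 12 * ?m 8" "?m 12 = 11 / 14 * ?m 10" "?m 14 = 13 / 16 * ?m 12" "?m 16 = 15 / 18 * ?m 14"
      "?m 18 = 17 / 20 * ?m 16" "?m 20 = 19 / 22 * ?m 18" "?m 22 = 21 / 24 * ?m 20" "?m 24 = 23 / 26 * ?m 22"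
      using r[of 2] r[of 4] r[of 6] r[of 8] r[of 10] r[of 12] r[of 14] r[of 16] r[of 18] r[of 20] r[of 22] r[of 24]
      by simp_all
    then show ?thesis using m0 by simp
  qed
  finally show ?thesis unfolding integral_zonal_moment[OF weak_eigen_zonal[OF v] v] .
qed

lemma \<kappa>_pos: "\<kappa> > 0"
proof (rule ccontr)
  assume "\<not> \<kappa> > 0"
  then have "measure \<sigma> S3 = 0" unfolding \<kappa>_def using measure_nonneg[of \<sigma> S3] by simp
  then have "(LINT x|\<sigma>. (1 :: real)) = 0" by simp
  from integral_zero_imp_zero[OF _ _ this S3_qone] show False by simp
qed

text \<open>
  The combination \<open>a F - b Z\<close> of \<open>F\<close> and \<open>Z = zonal v\<close> with vanishing twelfth moment at \<open>v\<close> has all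
  moments zero there, so it vanishes at \<open>v\<close>. Since \<open>Z(v) = 13\<close>, this expresses the twelfth moment of \<open>F\<close> by
  \<open>F v\<close>.
\<close>

lemma zonal_reproducing:
  assumes F: "weak_eigen 168 F" and v: "v \<in> S3"
  shows "(LINT x|\<sigma>. F x * zonal v x) = \<kappa> * F v"
proof -
  define a where "a = moment (zonal v) v 12"
  define b where "b = moment F v 12"
  have a: "4096 * a = 13 * \<kappa>"
    unfolding a_def integral_zonal_moment[OF weak_eigen_zonal[OF v] v, symmetric] by (rule integral_zonal_square[OF v])
  have w: "weak_eigen 168 (\<lambda>x. a * F x + - b * zonal v x)"
    by (rule weak_eigen_lin[OF F weak_eigen_zonal[OF v]])
  have "moment (\<lambda>x. a * F x + - b * zonal v x) v 12 = 0"
    unfolding moment_lin[OF weak_eigen_cont[OF F] weak_eigen_cont[OF weak_eigen_zonal[OF v]]]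
    by (simp add: a_def b_def)
  from moments_determine_value[OF weak_eigen_cont[OF w] moment_12_determines[OF w v this] v]
  have "a * F v = 13 * b" using v unfolding S3_iff by simp
  then have "13 * (4096 * b) = 4096 * a * F v" by simp
  then show ?thesis
    unfolding integral_zonal_moment[OF F v] b_def[symmetric] a by simp
qed

lemma weak_eigen_eq_moment:
  assumes F: "weak_eigen 168 F" and v: "v \<in> S3"
  shows "F v = 4096 / \<kappa> * (LINT x|\<sigma>. F x * (x \<bullet> v) ^ 12)"
  using zonal_reproducing[OF F v] integral_zonal_moment[OF F v] \<kappa>_pos
  by (simp add: moment_def field_simps)

lemma weak_eigen_sum:
  assumes "finite A" "\<And>i. i \<in> A \<Longrightarrow> weak_eigen \<mu> (F i)"
  shows "weak_eigen \<mu> (\<lambda>x. \<Sum>i\<in>A. F i x)"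
  using assms
proof (induction A rule: finite_induct)
  case empty
  then show ?case by (simp add: weak_eigen_def moment_def)
next
  case (insert i A)
  then show ?case using weak_eigen_lin[of \<mu> "F i" "\<lambda>x. \<Sum>i\<in>A. F i x" 1 1] by simp
qed

section \<open>Class functions\<close>

text \<open>
  Any \<open>w \<noteq> 0\<close> with \<open>x \<odot> w = w \<odot> y\<close> can be normalized to a conjugating element. For \<open>x = s + p\<close> and
  \<open>y = s + r i\<close> with \<open>p\<close> purely imaginary of norm \<open>r\<close>, the choice \<open>w = r - p i\<close> works unless it is zero, that is, unless
  \<open>p = - r i\<close>; then \<open>w = j\<close> works.
\<close>

lemma conjugate_if_same_real_part:
  assumes x: "x \<in> S3"
  obtains u where "u \<in> S3" "x = u \<odot> vector [x $ 1, sqrt (1 - (x $ 1)\<^sup>2), 0, 0] \<odot> qcnj u"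
proof -
  note witness = that
  define r where "r = sqrt (1 - (x $ 1)\<^sup>2)"
  define y where "y = (vector [x $ 1, r, 0, 0] :: real ^ 4)"
  have sq: "x $ 1 * x $ 1 + x $ 2 * x $ 2 + x $ 3 * x $ 3 + x $ 4 * x $ 4 = 1"
    using x unfolding S3_iff inner_4 .
  then have "1 - (x $ 1)\<^sup>2 = (x $ 2)\<^sup>2 + (x $ 3)\<^sup>2 + (x $ 4)\<^sup>2" by (simp add: power2_eq_square)
  then have r: "r * r = x $ 2 * x $ 2 + x $ 3 * x $ 3 + x $ 4 * x $ 4"
    unfolding r_def by (simp add: power2_eq_square)
  have *: ?thesis if w: "w \<noteq> 0" "x \<odot> w = w \<odot> y" for w
  proof (rule witness[of "sgn w"])
    show u: "sgn w \<in> S3" using w(1) by (simp add: norm_sgn)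
    have "x \<odot> sgn w = sgn w \<odot> y" using w(2) by (simp add: sgn_div_norm)
    then have "sgn w \<odot> y \<odot> qcnj (sgn w) = x \<odot> sgn w \<odot> qcnj (sgn w)" by simp
    also have "\<dots> = x" by (rule qcnj_cancel(4)[OF u])
    finally show "x = sgn w \<odot> vector [x $ 1, sqrt (1 - (x $ 1)\<^sup>2), 0, 0] \<odot> qcnj (sgn w)"
      by (simp add: y_def r_def)
  qed
  show ?thesis
  proof (cases "r + x $ 2 = 0")
    case True
    then have "x $ 3 * x $ 3 + x $ 4 * x $ 4 = 0" using r by (simp add: add_eq_0_iff)
    then have "x $ 3 = 0" "x $ 4 = 0" by (simp_all add: sum_squares_eq_zero_iff)
    then show ?thesis
      using True by (intro *[of "axis 3 1"]) (auto simp: vec4_eq_iff axis_def y_def)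
  next
    case False
    show ?thesis
    proof (rule *[of "vector [r + x $ 2, 0, - x $ 4, x $ 3]"])
      show "vector [r + x $ 2, 0, - x $ 4, x $ 3] \<noteq> (0 :: real ^ 4)"
        using False by (auto simp: vec4_eq_iff)
      show "x \<odot> vector [r + x $ 2, 0, - x $ 4, x $ 3] = vector [r + x $ 2, 0, - x $ 4, x $ 3] \<odot> y"
        using r by (simp add: vec4_eq_iff y_def algebra_simps)
    qed
  qed
qed

text \<open>
  By the reproducing formula all moments of \<open>D\<close> at the identity vanish, so \<open>D\<close> is orthogonal to every
  continuous function of the real part. A class function is itself such a function, hence
  \<open>\<integral> D\<^sup>2 = 0\<close>.
\<close>

lemma class_function_zero:
  assumes D: "weak_eigen 168 D" and cl: "\<And>u y. u \<in> S3 \<Longrightarrow> y \<in> S3 \<Longrightarrow> D (u \<odot> y \<odot> qcnj u) = D y"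
    and one: "D qone = 0" and x: "x \<in> S3"
  shows "D x = 0"
proof -
  have c: "continuous_on S3 D" using D by (rule weak_eigen_cont)
  have "moment D qone 12 = 0"
    using weak_eigen_eq_moment[OF D S3_qone] one \<kappa>_pos by (simp add: moment_def)
  then have m: "moment D qone n = 0" for n by (rule moment_12_determines[OF D S3_qone])
  \<comment> \<open>A continuous choice of a representative for each conjugacy class.\<close>
  define p where "p = (\<lambda>s. vector [s, sqrt (1 - s\<^sup>2), 0, 0] :: real ^ 4)"
  have pS: "p s \<in> S3" if "s \<in> {-1..1}" for s
  proof -
    have "s\<^sup>2 \<le> 1" using that by (simp add: abs_square_le_1 abs_le_iff)
    then show ?thesis unfolding S3_iff by (simp add: p_def inner_4 power2_eq_square)
  qed
  have cp: "continuous_on A p" for A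
  proof -
    have "p = (\<lambda>s. s *\<^sub>R qone + sqrt (1 - s\<^sup>2) *\<^sub>R axis 2 1)"
      by (rule ext) (simp add: p_def vec4_eq_iff axis_def)
    then show ?thesis by (simp only:) (intro continuous_intros)
  qed
  have "continuous_on {-1..1} (\<lambda>s. D (p s))"
    by (rule continuous_on_compose2[OF c cp]) (use pS in blast)
  from integral_poly_inner_zero[OF c m S3_qone this]
  have "(LINT x|\<sigma>. D x * D (p (x \<bullet> qone))) = 0" .
  moreover have Dp: "D (p (x \<bullet> qone)) = D x" if x: "x \<in> S3" for x
  proof -
    have "x $ 1 \<in> {-1..1}" using component_le_norm_cart[of x 1] x by (auto simp: abs_le_iff)
    then have "p (x $ 1) \<in> S3" by (rule pS)
    then show ?thesis
      using conjugate_if_same_real_part[OF x] cl unfolding inner_qone p_def by metis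
  qed
  ultimately have int: "(LINT x|\<sigma>. D x * D x) = 0"
    using integral_cong_S3[of "\<lambda>x. D x * D (p (x \<bullet> qone))" "\<lambda>x. D x * D x"] by simp
  have "continuous_on S3 (\<lambda>x. D x * D x)" by (intro continuous_intros c)
  from integral_zero_imp_zero[OF this _ int x] show ?thesis by simp
qed

section \<open>Integrals depending on a parameter\<close>

text \<open>
  The identity is measurable from the product of the sphere measures to the Borel sets of the
  product space, which reduces the claim to continuous functions on a subspace.
\<close>

lemma measurable_pair_cont:
  fixes K :: "(real ^ 4) \<times> (real ^ 4) \<Rightarrow> real"
  assumes "continuous_on (S3 \<times> S3) K"
  shows "K \<in> borel_measurable (\<sigma> \<Otimes>\<^sub>M \<sigma>)"
proof -
  have id: "(\<lambda>x. x) \<in> \<sigma> \<rightarrow>\<^sub>M borel" by (intro measurable_cont continuous_on_id)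
  have "(\<lambda>p. (fst p, snd p)) \<in> (\<sigma> \<Otimes>\<^sub>M \<sigma>) \<rightarrow>\<^sub>M (borel \<Otimes>\<^sub>M borel)"
    by (rule measurable_Pair) (rule measurable_compose[OF measurable_fst id] measurable_compose[OF measurable_snd id])+
  then have "(\<lambda>p. p) \<in> (\<sigma> \<Otimes>\<^sub>M \<sigma>) \<rightarrow>\<^sub>M (borel :: ((real ^ 4) \<times> (real ^ 4)) measure)"
    by (simp add: borel_prod)
  then have "(\<lambda>p. p) \<in> (\<sigma> \<Otimes>\<^sub>M \<sigma>) \<rightarrow>\<^sub>M restrict_space borel (S3 \<times> S3)"
    by (intro measurable_restrict_space2) (auto simp: space_pair_measure)
  from measurable_compose[OF this borel_measurable_continuous_on_restrict[OF assms]]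
  show ?thesis .
qed

lemma integral_swap:
  fixes K :: "real ^ 4 \<Rightarrow> real ^ 4 \<Rightarrow> real"
  assumes K: "continuous_on (S3 \<times> S3) (\<lambda>(y, v). K y v)"
  shows "(LINT y|\<sigma>. LINT v|\<sigma>. K y v) = (LINT v|\<sigma>. LINT y|\<sigma>. K y v)"
proof -
  interpret pair_sigma_finite \<sigma> \<sigma> by standard
  interpret P: finite_measure "\<sigma> \<Otimes>\<^sub>M \<sigma>" by (intro finite_measure_pair_measure \<sigma>.finite_measure_axioms)
  have "bounded ((\<lambda>(y, v). K y v) ` (S3 \<times> S3))"
    by (intro compact_imp_bounded compact_continuous_image K compact_Times) simp_all
  then obtain C where "\<forall>y\<in>S3. \<forall>v\<in>S3. \<bar>K y v\<bar> \<le> C"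
    unfolding bounded_iff by auto
  then have C: "\<bar>K y v\<bar> \<le> C" if "y \<in> S3" "v \<in> S3" for y v using that by blast
  have "integrable (\<sigma> \<Otimes>\<^sub>M \<sigma>) (\<lambda>(y, v). K y v)"
    by (rule P.integrable_const_bound[where B = C])
       (auto intro!: AE_I2 measurable_pair_cont K C simp: space_pair_measure)
  from Fubini_integral[OF this] show ?thesis by simp
qed

lemma continuous_parametric_integral:
  fixes K :: "real ^ 4 \<Rightarrow> real ^ 4 \<Rightarrow> real"
  assumes K: "continuous_on (S3 \<times> S3) (\<lambda>(y, v). K y v)"
  shows "continuous_on S3 (\<lambda>y. LINT v|\<sigma>. K y v)"
proof (subst continuous_on_sequentially, intro allI ballI impI)
  fix s y assume y: "y \<in> S3" and s: "(\<forall>n. s n \<in> S3) \<and> s \<longlonglongrightarrow> y"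
  have "bounded ((\<lambda>(y, v). K y v) ` (S3 \<times> S3))"
    by (intro compact_imp_bounded compact_continuous_image K compact_Times) simp_all
  then obtain C where "\<forall>y\<in>S3. \<forall>v\<in>S3. \<bar>K y v\<bar> \<le> C"
    unfolding bounded_iff by auto
  then have C: "\<bar>K y v\<bar> \<le> C" if "y \<in> S3" "v \<in> S3" for y v using that by blast
  have cv: "continuous_on S3 (K y)" if "y \<in> S3" for y
    by (rule continuous_on_compose2[OF K, of _ "\<lambda>v. (y, v)", simplified]) (use that in \<open>auto intro!: continuous_intros\<close>)
  have cy: "continuous_on S3 (\<lambda>y. K y v)" if "v \<in> S3" for v
    by (rule continuous_on_compose2[OF K, of _ "\<lambda>y. (y, v)", simplified]) (use that in \<open>auto intro!: continuous_intros\<close>)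
  have "(\<lambda>n. LINT v|\<sigma>. K (s n) v) \<longlonglongrightarrow> (LINT v|\<sigma>. K y v)"
  proof (rule integral_dominated_convergence)
    show "K y \<in> borel_measurable \<sigma>" by (rule measurable_cont[OF cv[OF y]])
    show "K (s n) \<in> borel_measurable \<sigma>" for n using s by (intro measurable_cont cv) auto
    show "integrable \<sigma> (\<lambda>_. C)" by simp
    show "AE v in \<sigma>. (\<lambda>n. K (s n) v) \<longlonglongrightarrow> K y v"
    proof (rule AE_I2)
      fix v assume "v \<in> space \<sigma>"
      then have "continuous_on S3 (\<lambda>y. K y v)" by (intro cy) simp
      then show "(\<lambda>n. K (s n) v) \<longlonglongrightarrow> K y v"
        using s y unfolding continuous_on_sequentially o_def by blast
    qed
    show "AE v in \<sigma>. norm (K (s n) v) \<le> C" for n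
      by (rule AE_I2) (use C s in auto)
  qed
  then show "((\<lambda>y. LINT v|\<sigma>. K y v) \<circ> s) \<longlonglongrightarrow> (LINT v|\<sigma>. K y v)" by (simp add: o_def)
qed

lemma weak_eigen_integral:
  fixes K :: "real ^ 4 \<Rightarrow> real ^ 4 \<Rightarrow> real"
  assumes K: "continuous_on (S3 \<times> S3) (\<lambda>(y, v). K y v)"
    and w: "\<And>v. v \<in> S3 \<Longrightarrow> weak_eigen \<mu> (\<lambda>y. K y v)"
  shows "weak_eigen \<mu> (\<lambda>y. LINT v|\<sigma>. K y v)"
  unfolding weak_eigen_def
proof (intro conjI ballI allI)
  show "continuous_on S3 (\<lambda>y. LINT v|\<sigma>. K y v)" by (rule continuous_parametric_integral[OF K])
  fix u n assume u: "u \<in> S3"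
  have m: "moment (\<lambda>y. LINT v|\<sigma>. K y v) u n = (LINT v|\<sigma>. moment (\<lambda>y. K y v) u n)" for n
  proof -
    have "moment (\<lambda>y. LINT v|\<sigma>. K y v) u n = (LINT y|\<sigma>. LINT v|\<sigma>. K y v * (y \<bullet> u) ^ n)"
      by (simp add: moment_def)
    also have "\<dots> = (LINT v|\<sigma>. LINT y|\<sigma>. K y v * (y \<bullet> u) ^ n)"
      using K unfolding case_prod_unfold
      by (intro integral_swap) (auto simp: case_prod_unfold intro!: continuous_intros)
    finally show ?thesis by (simp add: moment_def)
  qed
  have "(real n * (real n + 2) - \<mu>) * (LINT v|\<sigma>. moment (\<lambda>y. K y v) u n)
     = (LINT v|\<sigma>. (real n * (real n + 2) - \<mu>) * moment (\<lambda>y. K y v) u n)" by simp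
  also have "\<dots> = (LINT v|\<sigma>. real n * (real n - 1) * moment (\<lambda>y. K y v) u (n - 2))"
    by (rule integral_cong_S3) (use w u in \<open>simp add: weak_eigen_def\<close>)
  finally show "(real n * (real n + 2) - \<mu>) * moment (\<lambda>y. LINT v|\<sigma>. K y v) u n
     = real n * (real n - 1) * moment (\<lambda>y. LINT v|\<sigma>. K y v) u (n - 2)"
    unfolding m by simp
qed

section \<open>Conjugation averages of the character\<close>

abbreviation char12 :: "real ^ 4 \<Rightarrow> real" where "char12 x \<equiv> U12 (x $ 1)"

lemma qmul_fst_commute: "(x \<odot> y) $ 1 = (y \<odot> x) $ 1"
  by (simp add: algebra_simps)

lemma char12_qmul: "char12 (x \<odot> a) = zonal (qcnj a) x"
  by (simp add: inner_4)

lemma weak_eigen_char12: "a \<in> S3 \<Longrightarrow> weak_eigen 168 (\<lambda>x. char12 (x \<odot> a))"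
  unfolding char12_qmul by (rule weak_eigen_zonal) simp

text \<open>
  As a function of \<open>g\<close> the left side is an eigenfunction and a class function (the latter by
  invariance of the integral), and at the identity it is the volume times \<open>\<chi>(h)\<close>. By \<open>class_function_zero\<close> it is the multiple
  of the character with that value.
\<close>

lemma integral_character_conjugate:
  assumes g: "g \<in> S3" and h: "h \<in> S3"
  shows "(LINT v|\<sigma>. char12 (g \<odot> (v \<odot> h \<odot> qcnj v))) = \<kappa> * char12 g * char12 h"
proof -
  define s where "s = (\<lambda>y. LINT v|\<sigma>. char12 (y \<odot> (v \<odot> h \<odot> qcnj v)))"
  have K: "continuous_on (S3 \<times> S3) (\<lambda>(y, v). char12 (y \<odot> (v \<odot> h \<odot> qcnj v)))"
    unfolding case_prod_unfold by (intro continuous_intros)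
  have s: "weak_eigen 168 s"
    unfolding s_def by (rule weak_eigen_integral[OF K]) (intro weak_eigen_char12 S3_qmul S3_qcnj h)
  have s_class: "s (u \<odot> y \<odot> qcnj u) = s y" if u: "u \<in> S3" for u y
  proof -
    have "s (u \<odot> y \<odot> qcnj u) = (LINT v|\<sigma>. char12 (y \<odot> ((qcnj u \<odot> v) \<odot> h \<odot> qcnj (qcnj u \<odot> v))))"
      unfolding s_def
    proof (rule integral_cong_S3)
      fix v
      have "(u \<odot> (y \<odot> qcnj u \<odot> (v \<odot> h \<odot> qcnj v))) $ 1 = ((y \<odot> qcnj u \<odot> (v \<odot> h \<odot> qcnj v)) \<odot> u) $ 1"
        by (rule qmul_fst_commute)
      then show "char12 (u \<odot> y \<odot> qcnj u \<odot> (v \<odot> h \<odot> qcnj v)) =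
          char12 (y \<odot> ((qcnj u \<odot> v) \<odot> h \<odot> qcnj (qcnj u \<odot> v)))"
        by (simp only: qcnj_qmul qcnj_qcnj qmul_assoc)
    qed
    also have "\<dots> = s y"
      unfolding s_def
      by (rule integral_qmul_left[OF S3_qcnj[OF u], of "\<lambda>v. char12 (y \<odot> (v \<odot> h \<odot> qcnj v))"]) (intro continuous_intros)
    finally show ?thesis .
  qed
  have s1: "s qone = 13 * \<kappa> * char12 h"
  proof -
    have "s qone = (LINT v|\<sigma>. char12 h)"
      unfolding s_def
    proof (rule integral_cong_S3)
      fix v assume v: "v \<in> S3"
      have "(v \<odot> h \<odot> qcnj v) $ 1 = (qcnj v \<odot> (v \<odot> h)) $ 1" by (rule qmul_fst_commute)
      also have "qcnj v \<odot> (v \<odot> h) = h" using v by (rule qcnj_cancel)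
      finally show "char12 (qone \<odot> (v \<odot> h \<odot> qcnj v)) = char12 h" by (simp only: qmul_one)
    qed
    then show ?thesis by (simp add: \<kappa>_def)
  qed
  \<comment> \<open>Subtract the multiple of the character that has the same value at the identity.\<close>
  let ?D = "\<lambda>y. 1 * s y + - (\<kappa> * char12 h) * char12 (y \<odot> qone)"
  have "weak_eigen 168 ?D"
    by (intro weak_eigen_lin s weak_eigen_char12 S3_qone)
  moreover have "?D (u \<odot> y \<odot> qcnj u) = ?D y" if "u \<in> S3" for u y
  proof -
    have "(u \<odot> y \<odot> qcnj u) $ 1 = (qcnj u \<odot> (u \<odot> y)) $ 1" by (rule qmul_fst_commute)
    also have "qcnj u \<odot> (u \<odot> y) = y" using that by (rule qcnj_cancel)
    finally show ?thesis using s_class[OF that] by (simp only: qmul_one)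
  qed
  moreover have "?D qone = 0" by (simp add: s1)
  ultimately have "?D g = 0" by (rule class_function_zero[OF _ _ _ g])
  then show ?thesis by (simp add: s_def)
qed

section \<open>Bi-invariant eigenfunctions\<close>

text \<open>
  Let \<open>N v\<close> be the reproducing kernel for bi-invariant eigenfunctions at \<open>v\<close> and \<open>K\<close> the kernel at the
  identity, both without normalization. A bi-invariant \<open>F \<noteq> 0\<close> with \<open>F(1) = 0\<close> is orthogonal to \<open>K\<close>, so Bessel's inequality for \<open>N v\<close>
  bounds \<open>N v v\<close> from below by the sum of the squares of the normalized values of \<open>F\<close> and \<open>K\<close> at \<open>v\<close>. Integrated over \<open>v\<close> this says
  that the space has dimension at least two, whereas \<open>\<integral> N v v\<close> is, by
  \<open>integral_character_conjugate\<close>, the dimension \<open>((\<Sum>h. \<chi>(h)) / |G|)\<^sup>2 = 1\<close> in the same units.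
\<close>

lemma biinvariant_zero:
  assumes G: "finite G" "G \<subseteq> S3" "G \<noteq> {}" "\<And>g h. g \<in> G \<Longrightarrow> h \<in> G \<Longrightarrow> g \<odot> h \<in> G"
    "\<And>g. g \<in> G \<Longrightarrow> qcnj g \<in> G"
    and sum: "(\<Sum>h\<in>G. char12 h) = card G"
    and F: "weak_eigen 168 F" and inv: "\<And>g x. g \<in> G \<Longrightarrow> x \<in> S3 \<Longrightarrow> F (g \<odot> x) = F x"
      "\<And>g x. g \<in> G \<Longrightarrow> x \<in> S3 \<Longrightarrow> F (x \<odot> g) = F x"
    and one: "F qone = 0" and p: "p \<in> S3"
  shows "F p = 0"
proof (rule ccontr)
  assume ne: "F p \<noteq> 0"
  define n where "n = real (card G)"
  define c where "c = n * n * \<kappa>"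
  have n: "n > 0" using G(1,3) by (simp add: n_def card_gt_0_iff)
  then have c: "c > 0" using \<kappa>_pos by (simp add: c_def)
  have GS: "g \<in> S3" if "g \<in> G" for g using that G(2) by blast
  have cF: "continuous_on S3 F" using F by (rule weak_eigen_cont)
  define K where "K = (\<lambda>x. \<Sum>h\<in>G. char12 (x \<odot> h))"
  \<comment> \<open>By the trace property, \<open>N v x\<close> is the sum of \<open>\<chi>(g x h v\<^sup>-\<^sup>1)\<close> over \<open>g\<close> and \<open>h\<close>.\<close>
  define N where "N = (\<lambda>v x. \<Sum>g\<in>G. \<Sum>h\<in>G. char12 (x \<odot> (h \<odot> qcnj v \<odot> g)))"
  have wK: "weak_eigen 168 K" unfolding K_def by (intro weak_eigen_sum weak_eigen_char12 GS G(1))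
  have wN: "weak_eigen 168 (N v)" if "v \<in> S3" for v
    unfolding N_def by (intro weak_eigen_sum weak_eigen_char12 GS G(1) S3_qmul S3_qcnj that)
  have rep: "(LINT x|\<sigma>. P x * char12 (x \<odot> a)) = \<kappa> * P (qcnj a)" if "weak_eigen 168 P" "a \<in> S3" for P a
    unfolding char12_qmul using that by (intro zonal_reproducing S3_qcnj)
  have i: "integrable \<sigma> (\<lambda>x. P x * char12 (x \<odot> a))" if "continuous_on S3 P" for P :: "real ^ 4 \<Rightarrow> real" and a
    by (intro integrable_cont continuous_intros that)
  have repK: "(LINT x|\<sigma>. P x * K x) = n * \<kappa> * P qone"
    if P: "weak_eigen 168 P" "\<And>g x. g \<in> G \<Longrightarrow> x \<in> S3 \<Longrightarrow> P (g \<odot> x) = P x" for P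
  proof -
    have "(LINT x|\<sigma>. P x * K x) = (\<Sum>h\<in>G. LINT x|\<sigma>. P x * char12 (x \<odot> h))"
      unfolding K_def sum_distrib_left by (rule Bochner_Integration.integral_sum) (rule i[OF weak_eigen_cont[OF P(1)]])
    also have "\<dots> = (\<Sum>h\<in>G. \<kappa> * P qone)"
    proof (rule sum.cong[OF refl])
      fix h assume h: "h \<in> G"
      show "(LINT x|\<sigma>. P x * char12 (x \<odot> h)) = \<kappa> * P qone"
        unfolding rep[OF P(1) GS[OF h]] using P(2)[OF G(5)[OF h] S3_qone] by simp
    qed
    finally show ?thesis by (simp add: n_def)
  qed
  have repN: "(LINT x|\<sigma>. P x * N v x) = c * P v"
    if P: "weak_eigen 168 P" "\<And>g x. g \<in> G \<Longrightarrow> x \<in> S3 \<Longrightarrow> P (g \<odot> x) = P x"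
      "\<And>g x. g \<in> G \<Longrightarrow> x \<in> S3 \<Longrightarrow> P (x \<odot> g) = P x" and v: "v \<in> S3" for P v
  proof -
    have "(LINT x|\<sigma>. P x * N v x) = (\<Sum>g\<in>G. \<Sum>h\<in>G. LINT x|\<sigma>. P x * char12 (x \<odot> (h \<odot> qcnj v \<odot> g)))"
      unfolding N_def sum_distrib_left
      by (simp only: Bochner_Integration.integral_sum Bochner_Integration.integrable_sum i weak_eigen_cont[OF P(1)])
    also have "\<dots> = (\<Sum>g\<in>G. \<Sum>h\<in>G. \<kappa> * P v)"
    proof (intro sum.cong refl)
      fix g h assume gh: "g \<in> G" "h \<in> G"
      have "qcnj (h \<odot> qcnj v \<odot> g) = qcnj g \<odot> (v \<odot> qcnj h)" by (simp add: qcnj_qmul)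
      then show "(LINT x|\<sigma>. P x * char12 (x \<odot> (h \<odot> qcnj v \<odot> g))) = \<kappa> * P v"
        using rep[OF P(1), of "h \<odot> qcnj v \<odot> g"] P(2)[OF G(5)[OF gh(1)], of "v \<odot> qcnj h"] P(3)[OF G(5)[OF gh(2)] v]
          GS[OF gh(1)] GS[OF gh(2)] v by (simp add: norm_qmul)
    qed
    finally show ?thesis by (simp add: n_def c_def)
  qed
  have shift_right: "(\<Sum>h\<in>G. f (h \<odot> g)) = (\<Sum>h\<in>G. f h)" if g: "g \<in> G" for g and f :: "real ^ 4 \<Rightarrow> real"
    by (rule sum.reindex_bij_witness[of _ "\<lambda>h. h \<odot> qcnj g" "\<lambda>h. h \<odot> g"]) (use g G GS in auto)
  have shift_left: "(\<Sum>h\<in>G. f (g \<odot> h)) = (\<Sum>h\<in>G. f h)" if g: "g \<in> G" for g and f :: "real ^ 4 \<Rightarrow> real"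
    by (rule sum.reindex_bij_witness[of _ "\<lambda>h. qcnj g \<odot> h" "\<lambda>h. g \<odot> h"]) (use g G GS in auto)
  have Kr: "K (x \<odot> g) = K x" if "g \<in> G" for g x
    unfolding K_def qmul_assoc using shift_left[OF that, of "\<lambda>h. char12 (x \<odot> h)"] .
  have Kl: "K (g \<odot> x) = K x" if "g \<in> G" for g x
  proof -
    have "char12 (g \<odot> x \<odot> h) = char12 (x \<odot> (h \<odot> g))" for h
      unfolding qmul_assoc using qmul_fst_commute[of g "x \<odot> h"] by (simp only: qmul_assoc)
    then show ?thesis unfolding K_def using shift_right[OF that, of "\<lambda>h. char12 (x \<odot> h)"] by simp
  qed
  have Nr: "N v (x \<odot> g') = N v x" if "g' \<in> G" for g' x v
  proof -
    have "(\<Sum>h\<in>G. char12 (x \<odot> g' \<odot> (h \<odot> qcnj v \<odot> g))) = (\<Sum>h\<in>G. char12 (x \<odot> (h \<odot> qcnj v \<odot> g)))" for g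
      using shift_left[OF that, of "\<lambda>h. char12 (x \<odot> (h \<odot> (qcnj v \<odot> g)))"] by (simp only: qmul_assoc)
    then show ?thesis unfolding N_def by simp
  qed
  have Nl: "N v (g' \<odot> x) = N v x" if "g' \<in> G" for g' x v
  proof -
    have "char12 (g' \<odot> x \<odot> (h \<odot> qcnj v \<odot> g)) = char12 (x \<odot> (h \<odot> qcnj v \<odot> (g \<odot> g')))" for g h
      unfolding qmul_assoc using qmul_fst_commute[of g' "x \<odot> (h \<odot> (qcnj v \<odot> g))"] by (simp only: qmul_assoc)
    then show ?thesis unfolding N_def
      using shift_right[OF that, of "\<lambda>g. \<Sum>h\<in>G. char12 (x \<odot> (h \<odot> qcnj v \<odot> g))"] by simp
  qed
  define A where "A = (LINT x|\<sigma>. F x * F x)"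
  have A: "A > 0"
  proof -
    have "A \<ge> 0" by (simp add: A_def)
    moreover have "A \<noteq> 0"
      using integral_zero_imp_zero[of "\<lambda>x. F x * F x" p] ne p cF by (auto simp: A_def intro!: continuous_intros)
    ultimately show ?thesis by simp
  qed
  have K1: "K qone = n" using sum by (simp add: K_def n_def)
  have bessel: "c * (F v * F v) / A + K v * K v \<le> N v v" if v: "v \<in> S3" for v
  proof -
    \<comment> \<open>The coefficients of the orthogonal projection of \<open>N v\<close> onto the span of \<open>F\<close> and \<open>K\<close>.\<close>
    define a where "a = c * F v / A"
    let ?k = "K v"
    have cN: "continuous_on S3 (N v)" by (rule weak_eigen_cont[OF wN[OF v]])
    have cK: "continuous_on S3 K" by (rule weak_eigen_cont[OF wK])
    have ii: "integrable \<sigma> (\<lambda>x. r * (P x * Q x))" if "continuous_on S3 P" "continuous_on S3 Q" for r and P Q :: "real ^ 4 \<Rightarrow> real"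
      by (intro integrable_cont continuous_intros that)
    have "0 \<le> (LINT x|\<sigma>. (N v x - a * F x - ?k * K x) * (N v x - a * F x - ?k * K x))" by simp
    also have "\<dots> = (LINT x|\<sigma>. 1 * (N v x * N v x) + (a * a) * (F x * F x) + (?k * ?k) * (K x * K x)
       - (2 * a) * (F x * N v x) - (2 * ?k) * (K x * N v x) + (2 * a * ?k) * (F x * K x))"
      by (rule integral_cong_S3) (simp add: algebra_simps)
    also have "\<dots> = 1 * (LINT x|\<sigma>. N v x * N v x) + (a * a) * (LINT x|\<sigma>. F x * F x) + (?k * ?k) * (LINT x|\<sigma>. K x * K x)
       - (2 * a) * (LINT x|\<sigma>. F x * N v x) - (2 * ?k) * (LINT x|\<sigma>. K x * N v x) + (2 * a * ?k) * (LINT x|\<sigma>. F x * K x)"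
      by (simp only: Bochner_Integration.integral_add Bochner_Integration.integral_diff
        Bochner_Integration.integrable_add Bochner_Integration.integrable_diff ii cN cK cF integral_mult_right_zero)
    also have "\<dots> = c * N v v + a * a * A + ?k * ?k * c - 2 * a * (c * F v) - 2 * ?k * (c * ?k)"
    proof -
      have "(LINT x|\<sigma>. N v x * N v x) = c * N v v" by (rule repN[OF wN[OF v] Nl Nr v])
      moreover have "(LINT x|\<sigma>. K x * N v x) = c * ?k" by (rule repN[OF wK Kl Kr v])
      moreover have "(LINT x|\<sigma>. F x * N v x) = c * F v" by (rule repN[OF F inv v])
      moreover have "(LINT x|\<sigma>. K x * K x) = c" using repK[OF wK Kl] K1 by (simp add: c_def)
      moreover have "(LINT x|\<sigma>. F x * K x) = 0" using repK[OF F inv(1)] one by simp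
      ultimately show ?thesis by (simp add: A_def)
    qed
    also have "\<dots> = c * (N v v - c * (F v * F v) / A - ?k * ?k)"
      using A by (simp add: a_def field_simps)
    finally show ?thesis using c by (simp add: zero_le_mult_iff)
  qed
  have cN: "continuous_on S3 (\<lambda>v. N v v)" unfolding N_def by (intro continuous_intros)
  have cK: "continuous_on S3 K" by (rule weak_eigen_cont[OF wK])
  have "(LINT v|\<sigma>. c / A * (F v * F v) + 1 * (K v * K v)) \<le> (LINT v|\<sigma>. N v v)"
  proof (rule integral_mono)
    show "integrable \<sigma> (\<lambda>v. c / A * (F v * F v) + 1 * (K v * K v))" "integrable \<sigma> (\<lambda>v. N v v)"
      by (intro integrable_cont continuous_intros cN cK cF)+
    fix v assume "v \<in> space \<sigma>"
    then show "c / A * (F v * F v) + 1 * (K v * K v) \<le> N v v" using bessel[of v] by simp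
  qed
  moreover have "(LINT v|\<sigma>. c / A * (F v * F v) + 1 * (K v * K v)) = c / A * (LINT v|\<sigma>. F v * F v) + 1 * (LINT v|\<sigma>. K v * K v)"
    using A by (subst Bochner_Integration.integral_add) (auto intro!: integrable_cont continuous_intros cF cK)
  moreover have "\<dots> = 2 * c"
    using repK[OF wK Kl] K1 A by (simp add: c_def A_def[symmetric])
  moreover have "(LINT v|\<sigma>. N v v) = c"
  proof -
    have "(LINT v|\<sigma>. N v v) = (\<Sum>g\<in>G. \<Sum>h\<in>G. LINT v|\<sigma>. char12 (v \<odot> (h \<odot> qcnj v \<odot> g)))"
    proof -
      have "integrable \<sigma> (\<lambda>v. char12 (v \<odot> (h \<odot> qcnj v \<odot> g)))" for g h
        by (intro integrable_cont continuous_intros)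
      then show ?thesis unfolding N_def
        by (simp only: Bochner_Integration.integral_sum Bochner_Integration.integrable_sum)
    qed
    also have "\<dots> = (\<Sum>g\<in>G. \<Sum>h\<in>G. \<kappa> * char12 g * char12 h)"
    proof (intro sum.cong refl)
      fix g h assume gh: "g \<in> G" "h \<in> G"
      have "(v \<odot> (h \<odot> qcnj v \<odot> g)) $ 1 = (g \<odot> (v \<odot> h \<odot> qcnj v)) $ 1" for v
        using qmul_fst_commute[of g "v \<odot> h \<odot> qcnj v"] by (simp only: qmul_assoc)
      then show "(LINT v|\<sigma>. char12 (v \<odot> (h \<odot> qcnj v \<odot> g))) = \<kappa> * char12 g * char12 h"
        using integral_character_conjugate[OF GS[OF gh(1)] GS[OF gh(2)]] by (simp only:)
    qed
    also have "\<dots> = \<kappa> * (\<Sum>g\<in>G. char12 g) * (\<Sum>h\<in>G. char12 h)"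
      unfolding mult.assoc sum_product by (simp only: sum_distrib_left)
    finally show ?thesis unfolding sum by (simp add: c_def n_def)
  qed
  ultimately show False using c by linarith
qed

section \<open>The unit icosians over the ring of golden integers\<close>

text \<open>
  The pair \<open>(a, b)\<close> stands for \<open>a + b \<phi>\<close> with the golden ratio \<open>\<phi>\<close>, and a quadruple of pairs for twice
  a quaternion: the doubled coordinates of the unit icosians lie in \<open>\<int>[\<phi>]\<close>, so the multiplication
  table can be checked by integer arithmetic.
\<close>

type_synonym golden_int = "int \<times> int"

type_synonym golden_quat = "golden_int \<times> golden_int \<times> golden_int \<times> golden_int"

fun gi_mul :: "golden_int \<Rightarrow> golden_int \<Rightarrow> golden_int" where
  "gi_mul (a, b) (c, d) = (a * c + b * d, a * d + b * c + b * d)"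

fun gi_add :: "golden_int \<Rightarrow> golden_int \<Rightarrow> golden_int" where
  "gi_add (a, b) (c, d) = (a + c, b + d)"

fun gi_neg :: "golden_int \<Rightarrow> golden_int" where
  "gi_neg (a, b) = (- a, - b)"

fun gq_conj :: "golden_quat \<Rightarrow> golden_quat" where
  "gq_conj (a, b, c, d) = (a, gi_neg b, gi_neg c, gi_neg d)"

fun gi_half :: "golden_int \<Rightarrow> golden_int" where
  "gi_half (a, b) = (a div 2, b div 2)"

fun gi_even :: "golden_int \<Rightarrow> bool" where
  "gi_even (a, b) \<longleftrightarrow> a mod 2 = 0 \<and> b mod 2 = 0"

fun gq_mul :: "golden_quat \<Rightarrow> golden_quat \<Rightarrow> golden_quat" where
  "gq_mul (a, b, c, d) (e, f, g, h) =
    (gi_add (gi_add (gi_mul a e) (gi_neg (gi_mul b f)))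
            (gi_add (gi_neg (gi_mul c g)) (gi_neg (gi_mul d h))),
     gi_add (gi_add (gi_mul a f) (gi_mul b e)) (gi_add (gi_mul c h) (gi_neg (gi_mul d g))),
     gi_add (gi_add (gi_mul a g) (gi_neg (gi_mul b h))) (gi_add (gi_mul c e) (gi_mul d f)),
     gi_add (gi_add (gi_mul a h) (gi_mul b g)) (gi_add (gi_neg (gi_mul c f)) (gi_mul d e)))"

fun gq_half :: "golden_quat \<Rightarrow> golden_quat" where
  "gq_half (a, b, c, d) = (gi_half a, gi_half b, gi_half c, gi_half d)"

fun gq_even :: "golden_quat \<Rightarrow> bool" where
  "gq_even (a, b, c, d) \<longleftrightarrow> gi_even a \<and> gi_even b \<and> gi_even c \<and> gi_even d"

text \<open>
  The absolute value of a doubled coordinate of an icosian: 0, 1, \<open>1/\<phi> = \<phi> - 1\<close>, \<open>\<phi>\<close> and 2 are numbered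
  0, 1, 2, 3 and 4, and 5 stands for any other number. The order of the first four is that of the vector
  permuted in \<open>unit_icosians\<close>. Comparing kinds is much cheaper than searching a list of 120
  quaternions.
\<close>

fun kind :: "golden_int \<Rightarrow> nat" where
  "kind (a, b) =
     (if b = 0 then if a = 0 then 0 else if a = 1 \<or> a = -1 then 1 else if a = 2 \<or> a = -2 then 4 else 5
      else if a = 0 \<and> (b = 1 \<or> b = -1) then 3
      else if (a, b) = (-1, 1) \<or> (a, b) = (1, -1) then 2 else 5)"

fun of_kind :: "nat \<Rightarrow> golden_int list" where
  "of_kind k = (if k = 0 then [(0, 0)] else if k = 1 then [(1, 0), (-1, 0)]
     else if k = 2 then [(-1, 1), (1, -1)] else if k = 3 then [(0, 1), (0, -1)] else [(2, 0), (-2, 0)])"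

definition even_arrangements :: "'a \<Rightarrow> 'a \<Rightarrow> 'a \<Rightarrow> 'a \<Rightarrow> ('a \<times> 'a \<times> 'a \<times> 'a) list" where
  "even_arrangements a b c d =
     [(a, b, c, d), (a, c, d, b), (a, d, b, c),
      (b, a, d, c), (b, c, a, d), (b, d, c, a),
      (c, a, b, d), (c, b, d, a), (c, d, a, b),
      (d, a, c, b), (d, b, a, c), (d, c, b, a)]"

definition hurwitz_patterns :: "(nat \<times> nat \<times> nat \<times> nat) list" where
  "hurwitz_patterns = [(4, 0, 0, 0), (0, 4, 0, 0), (0, 0, 4, 0), (0, 0, 0, 4), (1, 1, 1, 1)]"

definition patterns :: "(nat \<times> nat \<times> nat \<times> nat) list" where
  "patterns = hurwitz_patterns @ even_arrangements 0 1 2 3"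

fun pattern :: "golden_quat \<Rightarrow> nat \<times> nat \<times> nat \<times> nat" where
  "pattern (a, b, c, d) = (kind a, kind b, kind c, kind d)"

definition is_icosian :: "golden_quat \<Rightarrow> bool" where
  "is_icosian x \<longleftrightarrow> List.member patterns (pattern x)"

fun of_pattern :: "nat \<times> nat \<times> nat \<times> nat \<Rightarrow> golden_quat list" where
  "of_pattern (k, l, m, n) =
     concat (map (\<lambda>a. concat (map (\<lambda>b. concat (map (\<lambda>c. map (\<lambda>d. (a, b, c, d))
       (of_kind n)) (of_kind m))) (of_kind l))) (of_kind k))"

definition icosian_codes :: "golden_quat list" where
  "icosian_codes = concat (map of_pattern patterns)"

definition hurwitz_codes :: "golden_quat list" where
  "hurwitz_codes = concat (map of_pattern hurwitz_patterns)"

text \<open>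
  The powers of an icosian of order five. They represent the five cosets of the group of Hurwitz
  units, see \<open>fivefold_hurwitz_factorization\<close>.
\<close>

definition fivefold_codes :: "golden_quat list" where
  "fivefold_codes =
     [((2, 0), (0, 0), (0, 0), (0, 0)),
      ((-1, 1), (-1, 0), (0, -1), (0, 0)),
      ((0, -1), (1, -1), (-1, 0), (0, 0)),
      ((0, -1), (-1, 1), (1, 0), (0, 0)),
      ((-1, 1), (1, 0), (0, 1), (0, 0))]"

lemma kind_iff: "k < 5 \<Longrightarrow> kind x = k \<longleftrightarrow> x \<in> set (of_kind k)"
  by (cases x) (auto split: if_splits)

lemma pattern_iff:
  assumes "k < 5" "l < 5" "m < 5" "n < 5"
  shows "pattern x = (k, l, m, n) \<longleftrightarrow> x \<in> set (of_pattern (k, l, m, n))"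
  using assms by (cases x) (auto simp del: kind.simps of_kind.simps simp: kind_iff)

lemma member_pattern_iff:
  assumes "set ps \<subseteq> set patterns"
  shows "List.member ps (pattern x) \<longleftrightarrow> x \<in> set (concat (map of_pattern ps))"
proof -
  have *: "\<forall>p\<in>set patterns. (pattern x = p \<longleftrightarrow> x \<in> set (of_pattern p))"
    unfolding patterns_def hurwitz_patterns_def even_arrangements_def
    by (simp del: pattern.simps of_pattern.simps add: pattern_iff)
  have "List.member ps (pattern x) \<longleftrightarrow> (\<exists>p\<in>set ps. pattern x = p)"
    by (auto simp del: pattern.simps)
  also have "\<dots> \<longleftrightarrow> (\<exists>p\<in>set ps. x \<in> set (of_pattern p))"
    using * assms by blast
  also have "\<dots> \<longleftrightarrow> x \<in> set (concat (map of_pattern ps))"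
    by (simp del: of_pattern.simps)
  finally show ?thesis .
qed

lemma is_icosian_iff: "is_icosian x \<longleftrightarrow> x \<in> set icosian_codes"
  unfolding is_icosian_def icosian_codes_def by (rule member_pattern_iff) simp

lemma length_icosian_codes: "length icosian_codes = 120"
  by code_simp

lemma distinct_icosian_codes: "distinct icosian_codes"
  by code_simp

section \<open>Even permutations of four indices\<close>

text \<open>
  Sort \<open>(a, b, c, d)\<close> by three transpositions that put 1, 2 and 3 in their places in turn; the
  parity is the number of those that are not trivial.
\<close>

lemma even_permutation_table:
  "\<forall>a b c d :: 4. distinct [a, b, c, d] \<longrightarrow>
     (let b1 = Transposition.transpose a 1 b; c1 = Transposition.transpose b1 2 (Transposition.transpose a 1 c)
      in Transposition.transpose c1 3 (Transposition.transpose b1 2 (Transposition.transpose a 1 a)) = 1 \<and> Transposition.transpose c1 3 (Transposition.transpose b1 2 (Transposition.transpose a 1 b)) = 2 \<and>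
         Transposition.transpose c1 3 (Transposition.transpose b1 2 (Transposition.transpose a 1 c)) = 3 \<and> Transposition.transpose c1 3 (Transposition.transpose b1 2 (Transposition.transpose a 1 d)) = 4 \<and>
         ((((c1 = 3) = (b1 = 2)) = (a = 1)) \<longleftrightarrow> (a, b, c, d) \<in>
    {(1,2,3,4),(1,3,4,2),(1,4,2,3),(2,1,4,3),(2,3,1,4),(2,4,3,1),
     (3,1,2,4),(3,2,4,1),(3,4,1,2),(4,1,3,2),(4,2,1,3),(4,3,2,1)}))"
  unfolding forall_4 Let_def Transposition.transpose_def by simp

text \<open>
  The transpositions of \<open>even_permutation_table\<close> reduce \<open>p\<close> to the identity, and each nontrivial one changes
  the parity.
\<close>

lemma evenperm_4:
  fixes p :: "4 \<Rightarrow> 4"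
  assumes p: "p permutes UNIV"
  shows "evenperm p \<longleftrightarrow> (p 1, p 2, p 3, p 4) \<in>
    {(1,2,3,4),(1,3,4,2),(1,4,2,3),(2,1,4,3),(2,3,1,4),(2,4,3,1),
     (3,1,2,4),(3,2,4,1),(3,4,1,2),(4,1,3,2),(4,2,1,3),(4,3,2,1)}"
proof -
  have swap: "evenperm q \<longleftrightarrow> (evenperm (Transposition.transpose a b \<circ> q) \<longleftrightarrow> a = b)" if "q permutes UNIV" for q and a b :: 4
  proof -
    have "permutation q" using that by (auto simp: permutation_permutes)
    then show ?thesis
      by (subst evenperm_comp) (auto simp: permutation_swap_id evenperm_swap)
  qed
  define q1 where "q1 = Transposition.transpose (p 1) 1 \<circ> p"
  define q2 where "q2 = Transposition.transpose (q1 2) 2 \<circ> q1"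
  define q3 where "q3 = Transposition.transpose (q2 3) 3 \<circ> q2"
  have perms: "q1 permutes UNIV" "q2 permutes UNIV"
    using p by (auto simp: q1_def q2_def intro!: permutes_compose permutes_swap_id)
  have "distinct [p 1, p 2, p 3, p 4]"
    by (simp add: inj_eq[OF permutes_inj[OF p]])
  note table = even_permutation_table[rule_format, OF this, unfolded Let_def]
  have "q3 1 = 1 \<and> q3 2 = 2 \<and> q3 3 = 3 \<and> q3 4 = 4"
    unfolding q3_def q2_def q1_def o_def by (intro conjI; use table in blast)
  then have "q3 i = i" for i
    using exhaust_4[of i] by blast
  then have "evenperm q3" by (simp add: evenperm_identity[unfolded id_def] ext[of q3 "\<lambda>x. x"])
  then have parity: "evenperm p \<longleftrightarrow> (((q2 3 = 3) = (q1 2 = 2)) = (p 1 = 1))"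
    using swap[OF p, of "p 1" 1] swap[OF perms(1), of "q1 2" 2] swap[OF perms(2), of "q2 3" 3]
    by (simp add: q1_def[symmetric] q2_def[symmetric] q3_def[symmetric])
  show ?thesis
    unfolding parity[unfolded q2_def q1_def o_def]
    by (rule table[THEN conjunct2, THEN conjunct2, THEN conjunct2, THEN conjunct2])
qed

lemma ex_perm_4:
  fixes a b c d :: 4
  assumes "distinct [a, b, c, d]"
  shows "\<exists>p. p permutes UNIV \<and> p 1 = a \<and> p 2 = b \<and> p 3 = c \<and> p 4 = d"
proof -
  define p :: "4 \<Rightarrow> 4" where
    "p = (\<lambda>i. if i = 1 then a else if i = 2 then b else if i = 3 then c else d)"
  have v: "p 1 = a" "p 2 = b" "p 3 = c" "p 4 = d" by (auto simp: p_def)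
  have "inj p" unfolding inj_def forall_4 using assms v by auto
  then have "p permutes UNIV"
    by (simp add: permutes_altdef bij_betw_def finite_UNIV_inj_surj[OF finite])
  then show ?thesis using v by blast
qed

section \<open>Identification of the unit icosians\<close>

definition gi_real :: "golden_int \<Rightarrow> real" where
  "gi_real x = of_int (fst x) + of_int (snd x) * golden"

definition gq_vec :: "golden_quat \<Rightarrow> real ^ 4" where
  "gq_vec = (\<lambda>(a, b, c, d). vector [gi_real a, gi_real b, gi_real c, gi_real d])"

lemma golden_square: "golden * golden = golden + 1"
  by (simp add: golden_def field_simps)

lemma golden_gt_1: "golden > 1"
  by (simp add: golden_def real_less_rsqrt)

lemma inverse_golden: "1 / golden = golden - 1"
  using golden_gt_1 golden_square by (simp add: field_simps)

fun kind_value :: "nat \<Rightarrow> real" where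
  "kind_value k = (if k = 0 then 0 else if k = 1 then 1 else if k = 2 then 1 / golden
     else if k = 3 then golden else 2)"

lemma gi_real_of_kind:
  "gi_real ` set (of_kind k) = {s * kind_value k | s. s \<in> {-1, 1}}"
proof -
  have "{s * v | s. s \<in> {-1, 1}} = {v, - v}" for v :: real
    by (auto intro: exI[of _ "-1"] exI[of _ 1])
  then show ?thesis
    by (auto simp: gi_real_def inverse_golden)
qed

fun signed :: "nat \<times> nat \<times> nat \<times> nat \<Rightarrow> (real ^ 4) set" where
  "signed (k, l, m, n) =
     {vector [a, b, c, d] | a b c d. a \<in> gi_real ` set (of_kind k) \<and> b \<in> gi_real ` set (of_kind l) \<and>
        c \<in> gi_real ` set (of_kind m) \<and> d \<in> gi_real ` set (of_kind n)}"

lemma set_of_pattern: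
  "set (of_pattern (k, l, m, n)) = {(a, b, c, d). a \<in> set (of_kind k) \<and> b \<in> set (of_kind l) \<and>
     c \<in> set (of_kind m) \<and> d \<in> set (of_kind n)}"
  by (auto simp del: of_kind.simps)

lemma gq_vec_of_pattern: "gq_vec ` set (of_pattern P) = signed P"
proof -
  obtain k l m n where P: "P = (k, l, m, n)" by (cases P)
  show ?thesis
    unfolding P set_of_pattern
  proof (intro equalityI subsetI)
    fix x assume "x \<in> signed (k, l, m, n)"
    then obtain a b c d where "x = vector [gi_real a, gi_real b, gi_real c, gi_real d]"
      "a \<in> set (of_kind k)" "b \<in> set (of_kind l)" "c \<in> set (of_kind m)" "d \<in> set (of_kind n)"
      unfolding signed.simps image_iff by blast
    then show "x \<in> gq_vec ` {(a, b, c, d). a \<in> set (of_kind k) \<and> b \<in> set (of_kind l) \<and>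
        c \<in> set (of_kind m) \<and> d \<in> set (of_kind n)}"
      by (intro image_eqI[of _ _ "(a, b, c, d)"]) (simp_all add: gq_vec_def)
  next
    fix x assume "x \<in> gq_vec ` {(a, b, c, d). a \<in> set (of_kind k) \<and> b \<in> set (of_kind l) \<and>
        c \<in> set (of_kind m) \<and> d \<in> set (of_kind n)}"
    then obtain a b c d where "x = gq_vec (a, b, c, d)"
      "a \<in> set (of_kind k)" "b \<in> set (of_kind l)" "c \<in> set (of_kind m)" "d \<in> set (of_kind n)"
      by blast
    then have "x = vector [gi_real a, gi_real b, gi_real c, gi_real d]"
      "a \<in> set (of_kind k)" "b \<in> set (of_kind l)" "c \<in> set (of_kind m)" "d \<in> set (of_kind n)"
      unfolding gq_vec_def by simp_all
    then show "x \<in> signed (k, l, m, n)"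
      unfolding signed.simps by blast
  qed
qed

lemma gq_vec_codes: "gq_vec ` set icosian_codes = (\<Union>P\<in>set patterns. signed P)"
  by (simp add: icosian_codes_def gq_vec_of_pattern[symmetric] image_UN del: signed.simps of_pattern.simps)

lemma signed_eq:
  "signed (k, l, m, n) =
     {\<chi> i. s i * (vector [kind_value k, kind_value l, kind_value m, kind_value n] :: real ^ 4) $ i | s.
       \<forall>i. s i \<in> {-1, 1}}" (is "?L = ?R")
proof
  have *: "vector [a, b, c, d] \<in> ?R" if "a \<in> {s * kind_value k | s. s \<in> {-1, 1}}"
    "b \<in> {s * kind_value l | s. s \<in> {-1, 1}}" "c \<in> {s * kind_value m | s. s \<in> {-1, 1}}"
    "d \<in> {s * kind_value n | s. s \<in> {-1, 1}}" for a b c d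
  proof -
    from that obtain s1 s2 s3 s4 where s: "a = s1 * kind_value k" "b = s2 * kind_value l"
      "c = s3 * kind_value m" "d = s4 * kind_value n"
      "s1 \<in> {-1, 1}" "s2 \<in> {-1, 1}" "s3 \<in> {-1, 1}" "s4 \<in> {-1, 1}" by blast
    define s where "s = (\<lambda>i::4. (vector [s1, s2, s3, s4] :: real ^ 4) $ i)"
    have "\<forall>i. s i \<in> {-1, 1}" unfolding forall_4 s_def using s by simp
    moreover have "vector [a, b, c, d] = (\<chi> i. s i * (vector [kind_value k, kind_value l, kind_value m, kind_value n] :: real ^ 4) $ i)"
      by (simp add: vec_eq_iff forall_4 s_def s del: kind_value.simps)
    ultimately show ?thesis by blast
  qed
  show "?L \<subseteq> ?R"
    unfolding signed.simps gi_real_of_kind using * by blast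
  show "?R \<subseteq> ?L"
  proof
    fix x assume "x \<in> ?R"
    then obtain s where s: "\<forall>i. s i \<in> {-1, 1}"
      "x = (\<chi> i. s i * (vector [kind_value k, kind_value l, kind_value m, kind_value n] :: real ^ 4) $ i)"
      by blast
    have "x = vector [s 1 * kind_value k, s 2 * kind_value l, s 3 * kind_value m, s 4 * kind_value n]"
      by (simp add: vec_eq_iff forall_4 s(2) del: kind_value.simps)
    then show "x \<in> ?L"
      unfolding signed.simps gi_real_of_kind using s(1) by blast
  qed
qed

text \<open>
  The three families of \<open>unit_icosians\<close> are the sign choices for the kind patterns: the four axes, the
  all-ones pattern, and the twelve even arrangements.
\<close>

lemma unit_icosians_eq: "unit_icosians = (\<lambda>x. (1 / 2) *\<^sub>R gq_vec x) ` set icosian_codes"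
proof -
  let ?w = "vector [0, 1, 1 / golden, golden] :: real ^ 4"
  let ?h = "\<lambda>S. (\<lambda>v. (1 / 2) *\<^sub>R v) ` (S :: (real ^ 4) set)"
  have half: "?h {\<chi> i. s i * v $ i | s. \<forall>i. s i \<in> {-1, 1}} = {\<chi> i. s i * v $ i / 2 | s. \<forall>i. s i \<in> {-1, 1}}"
    for v :: "real ^ 4"
  proof -
    have eq: "(1 / 2) *\<^sub>R (\<chi> i. s i * v $ i) = (\<chi> i. s i * v $ i / 2)" for s
      by (simp add: vec_eq_iff)
    show ?thesis
    proof (intro equalityI subsetI)
      fix x assume "x \<in> ?h {\<chi> i. s i * v $ i | s. \<forall>i. s i \<in> {-1, 1}}"
      then obtain s where "x = (1 / 2) *\<^sub>R (\<chi> i. s i * v $ i)" "\<forall>i. s i \<in> {-1, 1}" by blast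
      then show "x \<in> {\<chi> i. s i * v $ i / 2 | s. \<forall>i. s i \<in> {-1, 1}}" unfolding eq by blast
    next
      fix x assume "x \<in> {\<chi> i. s i * v $ i / 2 | s. \<forall>i. s i \<in> {-1, 1}}"
      then obtain s where "x = (1 / 2) *\<^sub>R (\<chi> i. s i * v $ i)" "\<forall>i. s i \<in> {-1, 1}" unfolding eq by blast
      then show "x \<in> ?h {\<chi> i. s i * v $ i | s. \<forall>i. s i \<in> {-1, 1}}" by blast
    qed
  qed
  have h: "?h (signed (k, l, m, n)) =
     {\<chi> i. s i * (vector [kind_value k, kind_value l, kind_value m, kind_value n] :: real ^ 4) $ i / 2 | s.
       \<forall>i. s i \<in> {-1, 1}}" for k l m n
    unfolding signed_eq half ..
  have axis: "{s *\<^sub>R axis i 1 | s. s \<in> {-1, 1}} =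
      {\<chi> j. s j * (2 *\<^sub>R axis i 1 :: real ^ 4) $ j / 2 | s. \<forall>j. s j \<in> {-1, 1}}" (is "?L = ?R") for i :: 4
  proof
    show "?L \<subseteq> ?R"
    proof clarify
      fix s :: real assume "s \<in> {-1, 1}"
      then show "\<exists>t. s *\<^sub>R axis i 1 = (\<chi> j. t j * (2 *\<^sub>R axis i 1 :: real ^ 4) $ j / 2) \<and> (\<forall>j. t j \<in> {-1, 1})"
        by (intro exI[of _ "\<lambda>_. s"]) (simp add: vec_eq_iff)
    qed
    show "?R \<subseteq> ?L"
    proof clarify
      fix t :: "4 \<Rightarrow> real" assume "\<forall>j. t j \<in> {-1, 1}"
      then show "\<exists>s. (\<chi> j. t j * (2 *\<^sub>R axis i 1 :: real ^ 4) $ j / 2) = s *\<^sub>R axis i 1 \<and> s \<in> {-1, 1}"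
        by (intro exI[of _ "t i"]) (auto simp: vec_eq_iff axis_def)
    qed
  qed
  have two: "(2 *\<^sub>R axis 1 1 :: real ^ 4) = vector [2, 0, 0, 0]"
    "(2 *\<^sub>R axis 2 1 :: real ^ 4) = vector [0, 2, 0, 0]"
    "(2 *\<^sub>R axis 3 1 :: real ^ 4) = vector [0, 0, 2, 0]"
    "(2 *\<^sub>R axis 4 1 :: real ^ 4) = vector [0, 0, 0, 2]"
    by (simp_all add: vec_eq_iff forall_4 axis_def)
  have "?h (signed (4,0,0,0)) = {s *\<^sub>R axis 1 1 | s. s \<in> {-1, 1}}"
    "?h (signed (0,4,0,0)) = {s *\<^sub>R axis 2 1 | s. s \<in> {-1, 1}}"
    "?h (signed (0,0,4,0)) = {s *\<^sub>R axis 3 1 | s. s \<in> {-1, 1}}"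
    "?h (signed (0,0,0,4)) = {s *\<^sub>R axis 4 1 | s. s \<in> {-1, 1}}"
    unfolding h axis two by simp_all
  moreover have "{s *\<^sub>R axis i 1 | s i. s \<in> {-1, 1}} = (\<Union>i::4. {s *\<^sub>R axis i 1 | s. s \<in> {-1, 1::real}})"
    by blast
  ultimately have axes: "{s *\<^sub>R axis i 1 | s i. s \<in> {-1, 1}} =
    ?h (signed (4,0,0,0)) \<union> ?h (signed (0,4,0,0)) \<union> ?h (signed (0,0,4,0)) \<union> ?h (signed (0,0,0,4))"
    by (simp only: UNIV_4 UN_insert UN_empty Un_empty_right Un_assoc)
  have "vector [1, 1, 1, 1] $ i = (1 :: real)" for i :: 4
    using exhaust_4[of i] by auto
  then have ones: "{\<chi> i. s i / 2 | s. \<forall>i. s i \<in> {-1, 1}} = ?h (signed (1,1,1,1))"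
    unfolding h by simp
  let ?A = "\<lambda>p. {\<chi> i. s i * ?w $ p i / 2 | s. \<forall>i. s i \<in> {-1, 1 :: real}}"
  have A: "?A p = ?h (signed (k, l, m, n))"
    if "?w $ p 1 = kind_value k" "?w $ p 2 = kind_value l" "?w $ p 3 = kind_value m" "?w $ p 4 = kind_value n"
    for p k l m n
  proof -
    have "\<forall>i. ?w $ p i = (vector [kind_value k, kind_value l, kind_value m, kind_value n] :: real ^ 4) $ i"
      unfolding forall_4 using that by (simp del: kind_value.simps)
    then show ?thesis unfolding h by simp
  qed
  have perms: "{\<chi> i. s i * ?w $ p i / 2 | s p. (\<forall>i. s i \<in> {-1, 1}) \<and> p permutes UNIV \<and> evenperm p}
    = (\<Union>P\<in>set (even_arrangements 0 1 2 3). ?h (signed P))" (is "?L = ?R")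
  proof
    show "?L \<subseteq> ?R"
    proof
      fix x assume "x \<in> ?L"
      then obtain p where p: "p permutes UNIV" "evenperm p" "x \<in> ?A p" by blast
      have sub: "?A p \<subseteq> ?R"
        if "(k, l, m, n) \<in> set (even_arrangements 0 1 2 3)"
          "?w $ p 1 = kind_value k" "?w $ p 2 = kind_value l" "?w $ p 3 = kind_value m" "?w $ p 4 = kind_value n"
        for k l m n
        unfolding A[OF that(2-5)] using that(1) by blast
      have "?A p \<subseteq> ?R"
        using p(2)[unfolded evenperm_4[OF p(1)]]
        apply (elim insertE emptyE Pair_inject)
        apply (rule sub[of 0 1 2 3]; simp add: even_arrangements_def)
        apply (rule sub[of 0 2 3 1]; simp add: even_arrangements_def)
        apply (rule sub[of 0 3 1 2]; simp add: even_arrangements_def)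
        apply (rule sub[of 1 0 3 2]; simp add: even_arrangements_def)
        apply (rule sub[of 1 2 0 3]; simp add: even_arrangements_def)
        apply (rule sub[of 1 3 2 0]; simp add: even_arrangements_def)
        apply (rule sub[of 2 0 1 3]; simp add: even_arrangements_def)
        apply (rule sub[of 2 1 3 0]; simp add: even_arrangements_def)
        apply (rule sub[of 2 3 0 1]; simp add: even_arrangements_def)
        apply (rule sub[of 3 0 2 1]; simp add: even_arrangements_def)
        apply (rule sub[of 3 1 0 2]; simp add: even_arrangements_def)
        apply (rule sub[of 3 2 1 0]; simp add: even_arrangements_def)
        done
      then show "x \<in> ?R" using p(3) by blast
    qed
    have "?h (signed P) \<subseteq> ?L" if P: "P \<in> set (even_arrangements 0 1 2 3)" for P
    proof -
      have ex: "?h (signed (k, l, m, n)) \<subseteq> ?L"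
        if "(a, b, c, d) \<in> {(1,2,3,4),(1,3,4,2),(1,4,2,3),(2,1,4,3),(2,3,1,4),(2,4,3,1),
          (3,1,2,4),(3,2,4,1),(3,4,1,2),(4,1,3,2),(4,2,1,3),(4,3,2,1)}"
          "?w $ a = kind_value k" "?w $ b = kind_value l" "?w $ c = kind_value m" "?w $ d = kind_value n"
        for a b c d k l m n
      proof -
        have "distinct [a, b, c, d]" using that(1) by auto
        then obtain p where p: "p permutes UNIV" "p 1 = a" "p 2 = b" "p 3 = c" "p 4 = d"
          using ex_perm_4 by blast
        have "evenperm p" unfolding evenperm_4[OF p(1)] p(2-5) by (rule that(1))
        moreover have "?h (signed (k, l, m, n)) = ?A p" by (rule A[symmetric]) (use that p in auto)
        ultimately show ?thesis using p(1) by blast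
      qed
      show ?thesis
        using P unfolding even_arrangements_def list.set
        apply (elim insertE emptyE; hypsubst)
                   apply (rule ex[of 1 2 3 4]; simp)
                  apply (rule ex[of 1 3 4 2]; simp)
                 apply (rule ex[of 1 4 2 3]; simp)
                apply (rule ex[of 2 1 4 3]; simp)
               apply (rule ex[of 2 3 1 4]; simp)
              apply (rule ex[of 2 4 3 1]; simp)
             apply (rule ex[of 3 1 2 4]; simp)
            apply (rule ex[of 3 2 4 1]; simp)
           apply (rule ex[of 3 4 1 2]; simp)
          apply (rule ex[of 4 1 3 2]; simp)
         apply (rule ex[of 4 2 1 3]; simp)
        apply (rule ex[of 4 3 2 1]; simp)
        done
    qed
    then show "?R \<subseteq> ?L" by blast
  qed
  have "(\<lambda>x. (1 / 2) *\<^sub>R gq_vec x) ` set icosian_codes = ?h (gq_vec ` set icosian_codes)"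
    by (simp only: image_image)
  also have "\<dots> = (\<Union>P\<in>set patterns. ?h (signed P))"
    unfolding gq_vec_codes by (rule image_UN)
  also have "\<dots> = (?h (signed (4,0,0,0)) \<union> ?h (signed (0,4,0,0)) \<union> ?h (signed (0,0,4,0)) \<union> ?h (signed (0,0,0,4)))
      \<union> ?h (signed (1,1,1,1)) \<union> (\<Union>P\<in>set (even_arrangements 0 1 2 3). ?h (signed P))"
    unfolding patterns_def hurwitz_patterns_def
    by (simp only: set_append list.set UN_Un UN_insert UN_empty Un_empty_right Un_assoc)
  finally show ?thesis
    unfolding unit_icosians_def axes ones perms by (rule sym)
qed

section \<open>The group of unit icosians and its character sum\<close>

lemma gi_real_simps:
  "gi_real (gi_add x y) = gi_real x + gi_real y" "gi_real (gi_neg x) = - gi_real x"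
  "gi_real (gi_mul x y) = gi_real x * gi_real y"
proof -
  show "gi_real (gi_add x y) = gi_real x + gi_real y" "gi_real (gi_neg x) = - gi_real x"
    by (cases x; cases y; simp add: gi_real_def algebra_simps)+
  obtain a b c d where xy: "x = (a, b)" "y = (c, d)" by (cases x, cases y)
  have "gi_real x * gi_real y = real_of_int (a * c) + real_of_int (a * d + b * c) * golden
      + real_of_int (b * d) * (golden * golden)"
    by (simp add: xy gi_real_def algebra_simps)
  then show "gi_real (gi_mul x y) = gi_real x * gi_real y"
    unfolding golden_square by (simp add: xy gi_real_def algebra_simps)
qed

lemma gi_real_half: "gi_even x \<Longrightarrow> gi_real x = 2 * gi_real (gi_half x)"
proof (cases x)
  case (Pair a b)
  assume "gi_even x"
  then have "a = 2 * (a div 2)" "b = 2 * (b div 2)" using Pair by auto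
  then have "real_of_int a = 2 * real_of_int (a div 2)" "real_of_int b = 2 * real_of_int (b div 2)"
    by (metis of_int_mult of_int_numeral)+
  then show ?thesis by (simp add: Pair gi_real_def)
qed

lemma gq_vec_mul: "gq_vec (gq_mul x y) = gq_vec x \<odot> gq_vec y"
proof -
  obtain a b c d e f g h where "x = (a, b, c, d)" "y = (e, f, g, h)"
    by (metis prod_cases4)
  then show ?thesis
    by (simp add: gq_vec_def vec4_eq_iff gi_real_simps del: gi_mul.simps gi_add.simps gi_neg.simps)
qed

lemma gq_vec_half: "gq_even x \<Longrightarrow> gq_vec x = 2 *\<^sub>R gq_vec (gq_half x)"
  by (cases x) (simp add: gq_vec_def vec4_eq_iff gi_real_half)

lemma icosian_codes_norm:
  "list_all (\<lambda>(a, b, c, d). gi_add (gi_add (gi_mul a a) (gi_mul b b)) (gi_add (gi_mul c c) (gi_mul d d)) = (4, 0))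
     icosian_codes"
  by code_simp

lemma unit_icosians_S3: "unit_icosians \<subseteq> S3"
proof
  fix x assume "x \<in> unit_icosians"
  then obtain a b c d where abcd: "(a, b, c, d) \<in> set icosian_codes" "x = (1 / 2) *\<^sub>R gq_vec (a, b, c, d)"
    unfolding unit_icosians_eq by auto
  have "gi_add (gi_add (gi_mul a a) (gi_mul b b)) (gi_add (gi_mul c c) (gi_mul d d)) = (4, 0)"
    using icosian_codes_norm abcd(1) unfolding list_all_iff by blast
  then have "gi_real (gi_add (gi_add (gi_mul a a) (gi_mul b b)) (gi_add (gi_mul c c) (gi_mul d d))) = 4"
    by (simp add: gi_real_def)
  then show "x \<in> S3"
    unfolding S3_iff gi_real_simps by (simp add: abcd(2) inner_4 gq_vec_def)
qed

text \<open>
  A quarter of the multiplication table. Together with the factorization below it gives closure under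
  multiplication: \<open>(a b) h = a (b h)\<close>.
\<close>

lemma fivefold_hurwitz_mult_closed:
  "list_all (\<lambda>x. list_all (\<lambda>y. let z = gq_mul x y in gq_even z \<and> is_icosian (gq_half z)) icosian_codes)
     (fivefold_codes @ hurwitz_codes)"
  by code_simp

lemma fivefold_icosian: "list_all is_icosian fivefold_codes"
  by code_simp

lemma fivefold_hurwitz_factorization:
  "list_all (\<lambda>x. list_ex (\<lambda>a. let z = gq_mul (gq_conj a) x
       in gq_even z \<and> List.member hurwitz_patterns (pattern (gq_half z))) fivefold_codes) icosian_codes"
  by code_simp

lemma gq_vec_conj: "gq_vec (gq_conj x) = qcnj (gq_vec x)"
proof -
  obtain a b c d where "x = (a, b, c, d)" by (metis prod_cases4)
  then show ?thesis by (simp add: gq_vec_def vec4_eq_iff gi_real_simps del: gi_neg.simps)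
qed

lemma unit_icosians_mult:
  assumes g: "g \<in> unit_icosians" and h: "h \<in> unit_icosians" shows "g \<odot> h \<in> unit_icosians"
proof -
  let ?r = "\<lambda>x. (1 / 2) *\<^sub>R gq_vec x"
  have half: "?r a \<odot> ?r b = ?r (gq_half (gq_mul a b))" if "gq_even (gq_mul a b)" for a b
  proof -
    have "?r a \<odot> ?r b = (1 / 4) *\<^sub>R gq_vec (gq_mul a b)" by (simp add: gq_vec_mul)
    then show ?thesis unfolding gq_vec_half[OF that] by simp
  qed
  have partial: "?r x \<odot> h' \<in> unit_icosians"
    if x: "x \<in> set (fivefold_codes @ hurwitz_codes)" and h': "h' \<in> unit_icosians" for x h'
  proof -
    obtain y where y: "y \<in> set icosian_codes" "h' = ?r y" using h' unfolding unit_icosians_eq by blast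
    let ?z = "gq_mul x y"
    have "gq_even ?z" "gq_half ?z \<in> set icosian_codes"
      using fivefold_hurwitz_mult_closed x y(1) unfolding list_all_iff Let_def is_icosian_iff by blast+
    then show ?thesis unfolding y(2) using half unit_icosians_eq by auto
  qed
  obtain x where x: "x \<in> set icosian_codes" "g = ?r x" using g unfolding unit_icosians_eq by blast
  obtain a where a: "a \<in> set fivefold_codes" "gq_even (gq_mul (gq_conj a) x)"
    "List.member hurwitz_patterns (pattern (gq_half (gq_mul (gq_conj a) x)))"
    using fivefold_hurwitz_factorization x(1) unfolding list_all_iff list_ex_iff Let_def by blast
  define b where "b = gq_half (gq_mul (gq_conj a) x)"
  have "b \<in> set hurwitz_codes"
    using a(3) member_pattern_iff[of hurwitz_patterns b] unfolding hurwitz_codes_def b_def patterns_def by auto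
  have "?r a \<in> unit_icosians"
    using a(1) fivefold_icosian unfolding unit_icosians_eq list_all_iff is_icosian_iff by blast
  then have aS: "?r a \<in> S3" using unit_icosians_S3 by blast
  have "qcnj (?r a) = ?r (gq_conj a)" by (simp add: gq_vec_conj vec4_eq_iff)
  then have "?r b = qcnj (?r a) \<odot> g" unfolding x(2) b_def half[OF a(2), symmetric] by (simp only:)
  then have "g = ?r a \<odot> ?r b" by (simp only: qcnj_cancel(2)[OF aS])
  then have "g \<odot> h = ?r a \<odot> (?r b \<odot> h)" by (simp only: qmul_assoc)
  then show ?thesis
    using partial[of a "?r b \<odot> h"] partial[of b h] h a(1) \<open>b \<in> set hurwitz_codes\<close> by simp
qed

lemma finite_unit_icosians: "finite unit_icosians"
  unfolding unit_icosians_eq by simp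

lemma qone_unit_icosian: "qone \<in> unit_icosians"
  unfolding unit_icosians_def by (intro UnI1) (auto intro!: exI[of _ 1])

text \<open>
  Left multiplication by \<open>g\<close> is an injective map of a finite set into itself, hence hits the
  identity.
\<close>

lemma unit_icosians_qcnj:
  assumes g: "g \<in> unit_icosians" shows "qcnj g \<in> unit_icosians"
proof -
  have gS: "g \<in> S3" using g unit_icosians_S3 by blast
  have "inj_on (\<lambda>h. g \<odot> h) unit_icosians"
    by (rule inj_on_inverseI[of _ "\<lambda>h. qcnj g \<odot> h"]) (use gS in simp)
  then have "(\<lambda>h. g \<odot> h) ` unit_icosians = unit_icosians"
    by (intro endo_inj_surj finite_unit_icosians) (use unit_icosians_mult[OF g] in blast)
  then obtain h where h: "h \<in> unit_icosians" "g \<odot> h = qone"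
    using qone_unit_icosian by (metis imageE)
  have "h = qcnj g \<odot> (g \<odot> h)" using gS by simp
  then show ?thesis using h by simp
qed

lemma golden_bounds: "8 / 5 < golden" "golden < 17 / 10"
proof -
  have "sqrt 5 > 11 / 5" by (rule real_less_rsqrt) (simp add: power2_eq_square)
  then show "8 / 5 < golden" by (simp add: golden_def)
  have "sqrt 5 < 12 / 5" by (rule real_less_lsqrt) (simp_all add: power2_eq_square)
  then show "golden < 17 / 10" by (simp add: golden_def)
qed

lemma inj_gi_real:
  assumes "kind x < 5" "kind y < 5" "gi_real x = gi_real y" shows "x = y"
proof -
  have "x \<in> {(0, 0), (1, 0), (-1, 0), (-1, 1), (1, -1), (0, 1), (0, -1), (2, 0), (-2, 0)}"
    "y \<in> {(0, 0), (1, 0), (-1, 0), (-1, 1), (1, -1), (0, 1), (0, -1), (2, 0), (-2, 0)}"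
    using assms(1,2) by (cases x; cases y; auto split: if_splits)+
  then show ?thesis
    using assms(3) golden_bounds by (auto simp: gi_real_def)
qed

lemma inj_on_gq_vec: "inj_on gq_vec (set icosian_codes)"
proof (rule inj_onI)
  fix x y assume xy: "x \<in> set icosian_codes" "y \<in> set icosian_codes" "gq_vec x = gq_vec y"
  obtain a b c d e f g h where eq: "x = (a, b, c, d)" "y = (e, f, g, h)" by (cases x, cases y)
  have k: "kind a < 5 \<and> kind b < 5 \<and> kind c < 5 \<and> kind d < 5" if "is_icosian (a, b, c, d)" for a b c d
    using that by (auto simp: is_icosian_def patterns_def hurwitz_patterns_def even_arrangements_def simp del: kind.simps)
  have "gi_real a = gi_real e \<and> gi_real b = gi_real f \<and> gi_real c = gi_real g \<and> gi_real d = gi_real h"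
    using xy(3) by (simp add: eq gq_vec_def vec4_eq_iff)
  then show "x = y"
    using k[of a b c d] k[of e f g h] xy(1,2) inj_gi_real unfolding eq is_icosian_iff[symmetric] by auto
qed

lemma unit_icosians_sum: "(\<Sum>g\<in>unit_icosians. f g) = (\<Sum>x\<leftarrow>icosian_codes. f ((1 / 2) *\<^sub>R gq_vec x))"
  for f :: "real ^ 4 \<Rightarrow> real"
proof -
  have "inj_on (\<lambda>x. (1 / 2) *\<^sub>R gq_vec x) (set icosian_codes)"
    using inj_on_gq_vec by (auto simp: inj_on_def)
  then show ?thesis
    unfolding unit_icosians_eq by (simp add: sum.reindex sum_list_distinct_conv_sum_set distinct_icosian_codes)
qed

lemma card_unit_icosians: "card unit_icosians = 120"
proof -
  have "inj_on (\<lambda>x. (1 / 2) *\<^sub>R gq_vec x) (set icosian_codes)"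
    using inj_on_gq_vec by (auto simp: inj_on_def)
  then show ?thesis
    unfolding unit_icosians_eq
    by (simp add: card_image distinct_card distinct_icosian_codes length_icosian_codes)
qed

text \<open>
  With \<open>\<phi> = 2 cos (\<pi>/5)\<close> and \<open>\<phi> - 1 = 2 cos (2\<pi>/5)\<close> these are values of \<open>sin (13 t) / sin t\<close>. Powers of
  \<open>\<phi>\<close> reduce by \<open>\<phi>\<^sup>2 = \<phi> + 1\<close>.
\<close>

lemma U12_kind_values:
  "U12 0 = 1" "U12 (1 / 2) = 1" "U12 (golden / 2) = golden" "U12 ((golden - 1) / 2) = 1 - golden"
proof -
  have g2: "golden * golden = golden + 1" by (rule golden_square)
  have g4: "golden ^ 4 = 3 * golden + 2"
    using g2 by (simp add: eval_nat_numeral) (simp add: algebra_simps)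
  have g6: "golden ^ 6 = 8 * golden + 5"
  proof -
    have "golden ^ 6 = golden ^ 4 * (golden * golden)" by (simp add: eval_nat_numeral)
    then show ?thesis unfolding g4 g2 using g2 by (simp add: algebra_simps)
  qed
  have g8: "golden ^ 8 = 21 * golden + 13"
  proof -
    have "golden ^ 8 = golden ^ 6 * (golden * golden)" by (simp add: eval_nat_numeral)
    then show ?thesis unfolding g6 g2 using g2 by (simp add: algebra_simps)
  qed
  have g10: "golden ^ 10 = 55 * golden + 34"
  proof -
    have "golden ^ 10 = golden ^ 8 * (golden * golden)" by (simp add: eval_nat_numeral)
    then show ?thesis unfolding g8 g2 using g2 by (simp add: algebra_simps)
  qed
  have g12: "golden ^ 12 = 144 * golden + 89"
  proof -
    have "golden ^ 12 = golden ^ 10 * (golden * golden)" by (simp add: eval_nat_numeral)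
    then show ?thesis unfolding g10 g2 using g2 by (simp add: algebra_simps)
  qed
  show "U12 0 = 1" "U12 (1 / 2) = 1" by (simp_all add: U12_def power_divide)
  show "U12 (golden / 2) = golden"
    unfolding U12_def power_divide g4 g6 g8 g10 g12 power2_eq_square g2 by (simp add: g2 field_simps)
  have h2: "(golden - 1) * (golden - 1) = 2 - golden" using g2 by (simp add: algebra_simps)
  have h4: "(golden - 1) ^ 4 = 5 - 3 * golden"
  proof -
    have "(golden - 1) ^ 4 = ((golden - 1) * (golden - 1)) * ((golden - 1) * (golden - 1))" by (simp add: eval_nat_numeral)
    then show ?thesis unfolding h2 using g2 by (simp add: algebra_simps)
  qed
  have h6: "(golden - 1) ^ 6 = 13 - 8 * golden"
  proof -
    have "(golden - 1) ^ 6 = (golden - 1) ^ 4 * ((golden - 1) * (golden - 1))" by (simp add: eval_nat_numeral)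
    then show ?thesis unfolding h4 h2 using g2 by (simp add: algebra_simps)
  qed
  have h8: "(golden - 1) ^ 8 = 34 - 21 * golden"
  proof -
    have "(golden - 1) ^ 8 = (golden - 1) ^ 6 * ((golden - 1) * (golden - 1))" by (simp add: eval_nat_numeral)
    then show ?thesis unfolding h6 h2 using g2 by (simp add: algebra_simps)
  qed
  have h10: "(golden - 1) ^ 10 = 89 - 55 * golden"
  proof -
    have "(golden - 1) ^ 10 = (golden - 1) ^ 8 * ((golden - 1) * (golden - 1))" by (simp add: eval_nat_numeral)
    then show ?thesis unfolding h8 h2 using g2 by (simp add: algebra_simps)
  qed
  have h12: "(golden - 1) ^ 12 = 233 - 144 * golden"
  proof -
    have "(golden - 1) ^ 12 = (golden - 1) ^ 10 * ((golden - 1) * (golden - 1))" by (simp add: eval_nat_numeral)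
    then show ?thesis unfolding h10 h2 using g2 by (simp add: algebra_simps)
  qed
  show "U12 ((golden - 1) / 2) = 1 - golden"
    unfolding U12_def power_divide h4 h6 h8 h10 h12 power2_eq_square h2 by (simp add: h2 field_simps) (simp add: algebra_simps g2)?
qed

fun U12_kind :: "nat \<Rightarrow> golden_int" where
  "U12_kind k = (if k = 3 then (0, 1) else if k = 2 then (1, -1) else if k = 4 then (13, 0) else (1, 0))"

lemma U12_uminus: "U12 (- s) = U12 s" by (simp add: U12_def)

lemma U12_gi_real: "kind x < 5 \<Longrightarrow> U12 (gi_real x / 2) = gi_real (U12_kind (kind x))"
proof -
  assume "kind x < 5"
  then have "x \<in> {(0, 0), (1, 0), (-1, 0), (-1, 1), (1, -1), (0, 1), (0, -1), (2, 0), (-2, 0)}"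
    by (cases x) (auto split: if_splits)
  moreover have "U12 (- 1 / 2) = 1" "U12 (- golden / 2) = golden" "U12 ((1 - golden) / 2) = 1 - golden" "U12 (-1) = 13"
  proof -
    have "- 1 / 2 = - (1 / 2 :: real)" "- golden / 2 = - (golden / 2)" by simp_all
    moreover have "(1 - golden) / 2 = - ((golden - 1) / 2)" by (simp only: minus_divide_left minus_diff_eq)
    ultimately show "U12 (- 1 / 2) = 1" "U12 (- golden / 2) = golden" "U12 ((1 - golden) / 2) = 1 - golden" "U12 (-1) = 13"
      by (simp_all only: U12_uminus U12_kind_values U12_1)
  qed
  ultimately show ?thesis
    using U12_kind_values by (auto simp: gi_real_def)
qed

lemma sum_U12_codes: "foldr (\<lambda>x s. gi_add (U12_kind (kind (fst x))) s) icosian_codes (0, 0) = (120, 0)"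
  by code_simp

text \<open>
  The multiplicity of the trivial representation of the icosahedral group in the irreducible
  representation of dimension 13 is one.
\<close>

lemma sum_character_unit_icosians: "(\<Sum>h\<in>unit_icosians. char12 h) = card unit_icosians"
proof -
  have k: "kind (fst x) < 5" if "x \<in> set icosian_codes" for x
    using that unfolding is_icosian_iff[symmetric]
    by (cases x) (auto simp: is_icosian_def patterns_def hurwitz_patterns_def even_arrangements_def simp del: kind.simps)
  have c: "char12 ((1 / 2) *\<^sub>R gq_vec x) = gi_real (U12_kind (kind (fst x)))" if "x \<in> set icosian_codes" for x
    using U12_gi_real[OF k[OF that]] by (cases x) (simp add: gq_vec_def del: kind.simps U12_kind.simps)
  have "(\<Sum>h\<in>unit_icosians. char12 h) = (\<Sum>x\<leftarrow>icosian_codes. gi_real (U12_kind (kind (fst x))))"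
    unfolding unit_icosians_sum using c by (intro arg_cong[where f = sum_list] map_cong) auto
  also have "\<dots> = gi_real (foldr (\<lambda>x s. gi_add (U12_kind (kind (fst x))) s) icosian_codes (0, 0))"
  proof -
    have "(\<Sum>x\<leftarrow>xs. gi_real (U12_kind (kind (fst x)))) = gi_real (foldr (\<lambda>x s. gi_add (U12_kind (kind (fst x))) s) xs (0, 0))"
      for xs :: "golden_quat list"
      by (induction xs) (simp_all add: gi_real_simps del: kind.simps U12_kind.simps, simp add: gi_real_def)
    then show ?thesis .
  qed
  finally show ?thesis unfolding sum_U12_codes by (simp add: card_unit_icosians gi_real_def)
qed

section \<open>Smooth functions on punctured space\<close>

text \<open>
  Only values on the open set \<open>S\<close> enter the derivatives at points of \<open>S\<close>.
\<close>

lemma Ck_on_cong: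
  assumes S: "open S"
  shows "(\<And>x. x \<in> S \<Longrightarrow> f x = g x) \<Longrightarrow> Ck_on k S f \<Longrightarrow> Ck_on k S g"
proof (induction k arbitrary: f g)
  case 0
  then show ?case by (simp cong: continuous_on_cong)
next
  case (Suc k)
  have fd: "f differentiable (at x)" if "x \<in> S" for x using Suc.prems(2) that by simp
  have eq: "frechet_derivative f (at x) = frechet_derivative g (at x)" if "x \<in> S" for x
    by (rule frechet_derivative_transform_within_open[OF fd[OF that] S that Suc.prems(1)])
  have "g differentiable (at x)" if x: "x \<in> S" for x
  proof -
    obtain D where "(f has_derivative D) (at x)" using fd[OF x] unfolding differentiable_def by blast
    then have "(g has_derivative D) (at x)"
      by (rule has_derivative_transform_within_open[OF _ S x Suc.prems(1)])
    then show ?thesis unfolding differentiable_def by blast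
  qed
  moreover have "Ck_on k S (\<lambda>x. frechet_derivative g (at x) v)" for v
    by (rule Suc.IH[of "\<lambda>x. frechet_derivative f (at x) v"]) (use eq Suc.prems(2) in auto)
  ultimately show ?case by simp
qed

lemma Ck_on_lin:
  assumes S: "open S"
  shows "Ck_on k S f \<Longrightarrow> Ck_on k S g \<Longrightarrow> Ck_on k S (\<lambda>x. a * f x + b * g x)"
proof (induction k arbitrary: f g)
  case 0
  then show ?case by (auto intro!: continuous_intros)
next
  case (Suc k)
  have der: "((\<lambda>x. a * f x + b * g x) has_derivative
      (\<lambda>v. a * frechet_derivative f (at x) v + b * frechet_derivative g (at x) v)) (at x)" if "x \<in> S" for x
  proof -
    have "f differentiable (at x)" "g differentiable (at x)" using Suc.prems that by auto
    then have "(f has_derivative frechet_derivative f (at x)) (at x)" "(g has_derivative frechet_derivative g (at x)) (at x)"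
      by (simp_all add: frechet_derivative_works)
    then show ?thesis by (intro has_derivative_add has_derivative_mult_right)
  qed
  have "Ck_on k S (\<lambda>x. frechet_derivative (\<lambda>x. a * f x + b * g x) (at x) v)" for v
  proof (rule Ck_on_cong[OF S])
    show "Ck_on k S (\<lambda>x. a * frechet_derivative f (at x) v + b * frechet_derivative g (at x) v)"
      by (rule Suc.IH) (use Suc.prems in auto)
    fix x assume "x \<in> S"
    from fun_cong[OF frechet_derivative_at[OF der[OF this]], of v]
    show "a * frechet_derivative f (at x) v + b * frechet_derivative g (at x) v =
      frechet_derivative (\<lambda>x. a * f x + b * g x) (at x) v" .
  qed
  moreover have "(\<lambda>x. a * f x + b * g x) differentiable (at x)" if "x \<in> S" for x
    using der[OF that] unfolding differentiable_def by blast
  ultimately show ?case by simp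
qed

text \<open>
  A class of expressions closed under differentiation off the origin, rich enough for polynomials
  composed with the radial projection.
\<close>

inductive smooth_expr :: "(real ^ 4 \<Rightarrow> real) \<Rightarrow> bool" where
  se_const: "smooth_expr (\<lambda>_. c)"
| se_inner: "smooth_expr (\<lambda>x. x \<bullet> v)"
| se_inverse_norm: "smooth_expr (\<lambda>x. inverse (norm x))"
| se_add: "smooth_expr f \<Longrightarrow> smooth_expr g \<Longrightarrow> smooth_expr (\<lambda>x. f x + g x)"
| se_mult: "smooth_expr f \<Longrightarrow> smooth_expr g \<Longrightarrow> smooth_expr (\<lambda>x. f x * g x)"

lemma smooth_expr_derivative:
  "smooth_expr f \<Longrightarrow> \<exists>D. \<forall>v. smooth_expr (D v) \<and> (\<forall>x. x \<noteq> 0 \<longrightarrow> (f has_derivative (\<lambda>v. D v x)) (at x))"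
proof (induction rule: smooth_expr.induct)
  case (se_const c)
  show ?case by (intro exI[of _ "\<lambda>_ _. 0"]) (auto intro: smooth_expr.intros)
next
  case (se_inner w)
  show ?case by (intro exI[of _ "\<lambda>v _. v \<bullet> w"]) (auto intro!: smooth_expr.intros derivative_eq_intros)
next
  case se_inverse_norm
  let ?i = "\<lambda>x :: real ^ 4. inverse (norm x)"
  have "((\<lambda>x :: real ^ 4. inverse (norm x)) has_derivative (\<lambda>v. - 1 * ((x \<bullet> v) * (?i x * (?i x * ?i x))))) (at x)"
    if "x \<noteq> 0" for x
  proof -
    have "((\<lambda>x. inverse (norm x)) has_derivative (\<lambda>v. - (?i x * (v \<bullet> sgn x) * ?i x))) (at x)"
      using that by (intro Deriv.has_derivative_inverse has_derivative_norm) auto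
    moreover have "(\<lambda>v. - (?i x * (v \<bullet> sgn x) * ?i x)) = (\<lambda>v. - 1 * ((x \<bullet> v) * (?i x * (?i x * ?i x))))"
      by (rule ext) (simp add: sgn_div_norm inner_commute)
    ultimately show ?thesis by simp
  qed
  then show ?case
    by (intro exI[of _ "\<lambda>v x. - 1 * ((x \<bullet> v) * (?i x * (?i x * ?i x)))"] allI conjI impI smooth_expr.intros)
next
  case (se_add f g)
  then obtain D E where "\<forall>v. smooth_expr (D v) \<and> (\<forall>x. x \<noteq> 0 \<longrightarrow> (f has_derivative (\<lambda>v. D v x)) (at x))"
    "\<forall>v. smooth_expr (E v) \<and> (\<forall>x. x \<noteq> 0 \<longrightarrow> (g has_derivative (\<lambda>v. E v x)) (at x))" by blast
  then show ?case
    by (intro exI[of _ "\<lambda>v x. D v x + E v x"]) (auto intro!: smooth_expr.intros has_derivative_add)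
next
  case (se_mult f g)
  then obtain D E where DE: "\<forall>v. smooth_expr (D v) \<and> (\<forall>x. x \<noteq> 0 \<longrightarrow> (f has_derivative (\<lambda>v. D v x)) (at x))"
    "\<forall>v. smooth_expr (E v) \<and> (\<forall>x. x \<noteq> 0 \<longrightarrow> (g has_derivative (\<lambda>v. E v x)) (at x))" by blast
  show ?case
  proof (intro exI[of _ "\<lambda>v x. f x * E v x + D v x * g x"] allI conjI impI)
    show "smooth_expr (\<lambda>x. f x * E v x + D v x * g x)" for v
      using DE se_mult by (intro smooth_expr.se_add smooth_expr.se_mult) auto
    show "((\<lambda>x. f x * g x) has_derivative (\<lambda>v. f x * E v x + D v x * g x)) (at x)" if "x \<noteq> 0" for x
      using DE that by (intro has_derivative_mult) auto
  qed
qed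

lemma smooth_expr_Ck: "smooth_expr f \<Longrightarrow> Ck_on k (- {0}) f"
proof (induction k arbitrary: f)
  case 0
  obtain D where "\<forall>v. smooth_expr (D v) \<and> (\<forall>x. x \<noteq> 0 \<longrightarrow> (f has_derivative (\<lambda>v. D v x)) (at x))"
    using smooth_expr_derivative[OF 0] by blast
  then have "continuous (at x) f" if "x \<noteq> 0" for x using that has_derivative_continuous by blast
  then show ?case by (auto intro!: continuous_at_imp_continuous_on)
next
  case (Suc k)
  obtain D where D: "\<And>v. smooth_expr (D v)" "\<And>x. x \<noteq> 0 \<Longrightarrow> (f has_derivative (\<lambda>v. D v x)) (at x)"
    using smooth_expr_derivative[OF Suc.prems] by blast
  have "Ck_on k (- {0}) (\<lambda>x. frechet_derivative f (at x) v)" for v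
  proof (rule Ck_on_cong[OF _ _ Suc.IH[OF D(1)]])
    fix x :: "real ^ 4" assume "x \<in> - {0}"
    then have "x \<noteq> 0" by simp
    from fun_cong[OF frechet_derivative_at[OF D(2)[OF this]], of v]
    show "D v x = frechet_derivative f (at x) v" .
  qed auto
  moreover have "f differentiable (at x)" if "x \<in> - {0}" for x
    using D(2)[of x] that unfolding differentiable_def by blast
  ultimately show ?case by simp
qed

lemma smooth_expr_power: "smooth_expr f \<Longrightarrow> smooth_expr (\<lambda>x. f x ^ n)"
  by (induction n) (auto intro: smooth_expr.intros)

lemma smooth_expr_sum: "(\<And>i. i \<in> A \<Longrightarrow> smooth_expr (f i)) \<Longrightarrow> smooth_expr (\<lambda>x. \<Sum>i\<in>A. f i x)"
  by (induction A rule: infinite_finite_induct) (auto intro: smooth_expr.intros)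

lemma smooth_expr_U12:
  assumes "smooth_expr f" shows "smooth_expr (\<lambda>x. U12 (f x))"
proof -
  have "smooth_expr (\<lambda>x. 4096 * f x ^ 12 + (- 11264) * f x ^ 10 + 11520 * f x ^ 8 + (- 5376) * f x ^ 6
      + 1120 * f x ^ 4 + (- 84) * f x ^ 2 + 1)"
    by (intro smooth_expr.intros smooth_expr_power assms)
  then show ?thesis by (simp add: U12_def)
qed

lemma smooth_expr_zonal: "smooth_expr (\<lambda>x. zonal v (sgn x))"
proof -
  have "smooth_expr (\<lambda>x. U12 (inverse (norm x) * (x \<bullet> v)))"
    by (intro smooth_expr_U12 smooth_expr.intros)
  then show ?thesis by (simp add: sgn_div_norm)
qed

lemma frechet_derivative_components:
  fixes H :: "real ^ 4 \<Rightarrow> real"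
  assumes "H differentiable (at x)"
  shows "frechet_derivative H (at x) v = (\<Sum>j\<in>UNIV. v $ j * frechet_derivative H (at x) (axis j 1))"
proof -
  have l: "linear (frechet_derivative H (at x))" using assms by (rule linear_frechet_derivative)
  have "v = (\<Sum>j\<in>UNIV. v $ j *\<^sub>R axis j 1)"
    by (rule basis_expansion[of v, unfolded scalar_mult_eq_scaleR, symmetric])
  then have "frechet_derivative H (at x) v = frechet_derivative H (at x) (\<Sum>j\<in>UNIV. v $ j *\<^sub>R axis j 1)"
    by (rule arg_cong)
  also have "\<dots> = (\<Sum>j\<in>UNIV. v $ j * frechet_derivative H (at x) (axis j 1))"
    by (simp add: linear_sum[OF l] linear_scale[OF l])
  finally show ?thesis .
qed

lemma curve_derivative:
  fixes H :: "real ^ 4 \<Rightarrow> real"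
  assumes H: "H differentiable (at (c t))" and c: "(c has_vector_derivative c') (at t)"
  shows "((\<lambda>t. H (c t)) has_real_derivative frechet_derivative H (at (c t)) c') (at t)"
proof -
  have l: "linear (frechet_derivative H (at (c t)))" using H by (rule linear_frechet_derivative)
  have "((\<lambda>t. H (c t)) has_derivative (\<lambda>s. frechet_derivative H (at (c t)) (s *\<^sub>R c'))) (at t)"
    by (rule has_derivative_compose[OF c[unfolded has_vector_derivative_def]])
       (use H in \<open>simp add: frechet_derivative_works\<close>)
  then show ?thesis
    by (simp add: has_field_derivative_def linear_scale[OF l] mult_commute_abs)
qed

text \<open>
  The derivative of \<open>G\<close> along \<open>x \<odot> circ e t\<close> is the contraction of its gradient with \<open>x \<odot> e\<close>; written with
  partial derivatives it can be differentiated a second time.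
\<close>

lemma C2_second_deriv_along:
  assumes G: "Ck_on 2 (- {0}) G" and e: "e \<in> imag_units"
  shows "\<exists>G2. second_deriv_along e G G2"
proof -
  define P where "P = (\<lambda>i x. frechet_derivative G (at x) (axis i 1))"
  define Q where "Q = (\<lambda>i j x. frechet_derivative (P i) (at x) (axis j 1))"
  have Gd: "G differentiable (at x)" if "x \<noteq> 0" for x using G that by (simp add: numeral_2_eq_2)
  have Pd: "P i differentiable (at x)" if "x \<noteq> 0" for i x using G that by (simp add: numeral_2_eq_2 P_def)
  have Qc: "continuous_on (- {0}) (Q i j)" for i j using G by (simp add: numeral_2_eq_2 P_def Q_def)
  have Gc: "continuous_on (- {0}) G" and Pc: "continuous_on (- {0}) (P i)" for i
    using Gd Pd by (auto intro!: continuous_at_imp_continuous_on differentiable_imp_continuous_within)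
  define G1 where "G1 = (\<lambda>x. \<Sum>i\<in>UNIV. (x \<odot> e) $ i * P i x)"
  define G2 where "G2 = (\<lambda>x. \<Sum>i\<in>UNIV. (x \<odot> e \<odot> e) $ i * P i x + (\<Sum>j\<in>UNIV. (x \<odot> e) $ j * Q i j x) * (x \<odot> e) $ i)"
  have S0: "S3 \<subseteq> - {0}" by auto
  have "((\<lambda>t. G (x \<odot> circ e t)) has_real_derivative G1 (x \<odot> circ e t)) (at t)"
    "((\<lambda>t. G1 (x \<odot> circ e t)) has_real_derivative G2 (x \<odot> circ e t)) (at t)" if x: "x \<in> S3" for x t
  proof -
    let ?c = "\<lambda>t. x \<odot> circ e t"
    have c0: "?c t \<noteq> 0" for t using S3_qmul[OF x circ_S3[OF e], of t] by (metis norm_zero mem_sphere_0 zero_neq_one)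
    note c' = circ_deriv[OF e, of x t]
    show "((\<lambda>t. G (?c t)) has_real_derivative G1 (?c t)) (at t)"
      unfolding G1_def P_def frechet_derivative_components[OF Gd[OF c0], symmetric]
      by (rule curve_derivative[OF Gd[OF c0] c'])
    have "((\<lambda>t. P i (?c t)) has_real_derivative (\<Sum>j\<in>UNIV. (?c t \<odot> e) $ j * Q i j (?c t))) (at t)" for i
      unfolding Q_def frechet_derivative_components[OF Pd[OF c0], symmetric]
      by (rule curve_derivative[OF Pd[OF c0] c'])
    moreover have "((\<lambda>t. (?c t \<odot> e) $ i) has_real_derivative (?c t \<odot> e \<odot> e) $ i) (at t)" for i
    proof -
      have "((\<lambda>t. ?c t \<odot> e) has_vector_derivative (?c t \<odot> e) \<odot> e) (at t)"
        by (rule bounded_linear.has_vector_derivative[OF bounded_bilinear.bounded_linear_left[OF bounded_bilinear_qmul] c'])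
      then show ?thesis
        unfolding has_real_derivative_iff_has_vector_derivative
        by (rule bounded_linear.has_vector_derivative[OF bounded_linear_vec_nth])
    qed
    ultimately show "((\<lambda>t. G1 (?c t)) has_real_derivative G2 (?c t)) (at t)"
      unfolding G1_def G2_def by (intro DERIV_sum DERIV_mult)
  qed
  moreover have "continuous_on S3 G" by (rule continuous_on_subset[OF Gc S0])
  moreover have "continuous_on S3 G2"
    unfolding G2_def
    by (intro continuous_intros continuous_on_subset[OF Pc S0] continuous_on_subset[OF Qc S0])
  ultimately show ?thesis unfolding second_deriv_along_def by blast
qed

lemma second_deriv_along_cong:
  assumes "second_deriv_along e G G2" "\<And>x. x \<in> S3 \<Longrightarrow> F x = G x" "e \<in> imag_units"
  shows "second_deriv_along e F G2"
proof -
  have eq: "(\<lambda>t. F (x \<odot> circ e t)) = (\<lambda>t. G (x \<odot> circ e t))" if "x \<in> S3" for x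
    using assms(2) S3_qmul[OF that circ_S3[OF assms(3)]] by blast
  have "continuous_on S3 F" using assms(1,2) unfolding second_deriv_along_def by (metis continuous_on_cong)
  then show ?thesis using assms(1) eq unfolding second_deriv_along_def by metis
qed

lemma second_deriv_along_deriv2:
  assumes "second_deriv_along e F F2" "x \<in> S3"
  shows "(deriv ^^ 2) (\<lambda>t. F (x \<odot> circ e t)) 0 = F2 x"
proof -
  obtain F1 where F1: "\<And>t. ((\<lambda>t. F (x \<odot> circ e t)) has_real_derivative F1 (x \<odot> circ e t)) (at t)"
    "\<And>t. ((\<lambda>t. F1 (x \<odot> circ e t)) has_real_derivative F2 (x \<odot> circ e t)) (at t)"
    using assms unfolding second_deriv_along_def by blast
  have "deriv (\<lambda>t. F (x \<odot> circ e t)) = (\<lambda>t. F1 (x \<odot> circ e t))"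
    using DERIV_imp_deriv[OF F1(1)] by blast
  then show ?thesis using DERIV_imp_deriv[OF F1(2), of 0] by (simp add: numeral_2_eq_2)
qed

lemma laplacian_quat:
  assumes "\<And>e. e \<in> imag_units \<Longrightarrow> second_deriv_along e (\<lambda>x. F (quat x)) (F2 e)" and x: "x \<in> S3"
  shows "laplacian_SU2 F (quat x) = - (\<Sum>e\<in>imag_units. F2 e x)"
proof -
  have "(deriv ^^ 2) (\<lambda>t. F (quat x ** quat (cos t *\<^sub>R axis 1 1 + sin t *\<^sub>R e))) 0 = F2 e x"
    if "e \<in> imag_units" for e
    using second_deriv_along_deriv2[OF assms(1)[OF that] x] by (simp only: quat_qmul circ_def)
  then show ?thesis unfolding laplacian_SU2_def sum_imag_units by (simp add: add.assoc)
qed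

lemma second_deriv_along_lin:
  assumes "second_deriv_along e F F2" "second_deriv_along e P P2"
  shows "second_deriv_along e (\<lambda>x. a * F x + b * P x) (\<lambda>x. a * F2 x + b * P2 x)"
proof -
  obtain F1 P1 where "\<And>x t. x \<in> S3 \<Longrightarrow>
        ((\<lambda>t. F (x \<odot> circ e t)) has_real_derivative F1 (x \<odot> circ e t)) (at t) \<and>
        ((\<lambda>t. F1 (x \<odot> circ e t)) has_real_derivative F2 (x \<odot> circ e t)) (at t)"
    "\<And>x t. x \<in> S3 \<Longrightarrow>
        ((\<lambda>t. P (x \<odot> circ e t)) has_real_derivative P1 (x \<odot> circ e t)) (at t) \<and>
        ((\<lambda>t. P1 (x \<odot> circ e t)) has_real_derivative P2 (x \<odot> circ e t)) (at t)"
    using assms unfolding second_deriv_along_def by blast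
  then show ?thesis
    unfolding second_deriv_along_def
    by (intro conjI exI[of _ "\<lambda>x. a * F1 x + b * P1 x"] ballI allI DERIV_add DERIV_cmult continuous_intros)
       (use assms in \<open>auto simp: second_deriv_along_def\<close>)
qed

lemma second_deriv_along_sum:
  assumes "finite A" "\<And>i. i \<in> A \<Longrightarrow> second_deriv_along e (F i) (F2 i)"
  shows "second_deriv_along e (\<lambda>x. \<Sum>i\<in>A. F i x) (\<lambda>x. \<Sum>i\<in>A. F2 i x)"
  using assms
proof (induction A rule: finite_induct)
  case empty
  show ?case by (auto simp: second_deriv_along_def intro!: exI[of _ "\<lambda>_. 0"])
next
  case (insert i A)
  then show ?case
    using second_deriv_along_lin[of e "F i" "F2 i" "\<lambda>x. \<Sum>i\<in>A. F i x" "\<lambda>x. \<Sum>i\<in>A. F2 i x" 1 1] by simp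
qed

section \<open>Functions on the quotient\<close>

lemma icosian_S3: "g \<in> unit_icosians \<Longrightarrow> g \<in> S3"
  using unit_icosians_S3 by blast

lemma coset_image: "(\<lambda>h. quat x ** h) ` binary_icosahedral = quat ` (\<lambda>g. x \<odot> g) ` unit_icosians"
  by (simp add: binary_icosahedral_def image_image quat_qmul)

lemma Rep_coset_quat:
  assumes "x \<in> S3"
  shows "Rep_dodecahedral_space (coset (quat x)) = quat ` (\<lambda>g. x \<odot> g) ` unit_icosians"
  unfolding coset_def coset_image[symmetric]
  by (rule Abs_dodecahedral_space_inverse) (use quat_SU2[OF assms] in blast)

text \<open>
  Cosets of a group, by closure under products and inverses.
\<close>

lemma coset_quat_eq_iff:
  assumes x: "x \<in> S3" and y: "y \<in> S3"
  shows "coset (quat x) = coset (quat y) \<longleftrightarrow> (\<exists>g\<in>unit_icosians. y = x \<odot> g)"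
proof
  assume "coset (quat x) = coset (quat y)"
  then have "quat ` (\<lambda>g. x \<odot> g) ` unit_icosians = quat ` (\<lambda>g. y \<odot> g) ` unit_icosians"
    using Rep_coset_quat x y by metis
  then have "(\<lambda>g. x \<odot> g) ` unit_icosians = (\<lambda>g. y \<odot> g) ` unit_icosians"
    by (simp add: inj_image_eq_iff[OF inj_quat])
  moreover have "y \<in> (\<lambda>g. y \<odot> g) ` unit_icosians"
    using qone_unit_icosian by (intro image_eqI[of _ _ qone]) simp_all
  ultimately show "\<exists>g\<in>unit_icosians. y = x \<odot> g" by blast
next
  assume "\<exists>g\<in>unit_icosians. y = x \<odot> g"
  then obtain g where g: "g \<in> unit_icosians" "y = x \<odot> g" by blast
  have "(\<lambda>h. y \<odot> h) ` unit_icosians = (\<lambda>h. x \<odot> h) ` unit_icosians"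
  proof
    show "(\<lambda>h. y \<odot> h) ` unit_icosians \<subseteq> (\<lambda>h. x \<odot> h) ` unit_icosians"
      using unit_icosians_mult[OF g(1)] by (auto simp: g(2) qmul_assoc)
    show "(\<lambda>h. x \<odot> h) ` unit_icosians \<subseteq> (\<lambda>h. y \<odot> h) ` unit_icosians"
    proof clarify
      fix h assume "h \<in> unit_icosians"
      then have "qcnj g \<odot> h \<in> unit_icosians" by (intro unit_icosians_mult unit_icosians_qcnj g)
      moreover have "x \<odot> h = y \<odot> (qcnj g \<odot> h)"
        using icosian_S3[OF g(1)] by (simp add: g(2) qmul_assoc)
      ultimately show "x \<odot> h \<in> (\<lambda>h. y \<odot> h) ` unit_icosians" by blast
    qed
  qed
  then show "coset (quat x) = coset (quat y)" unfolding coset_def coset_image by simp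
qed

lemma coset_quat_right: "x \<in> S3 \<Longrightarrow> g \<in> unit_icosians \<Longrightarrow> coset (quat (x \<odot> g)) = coset (quat x)"
  using coset_quat_eq_iff[of x "x \<odot> g"] icosian_S3[of g] S3_qmul[of x g] by metis

lemma coset_quat_surj: obtains x where "x \<in> S3" "p = coset (quat x)"
proof -
  obtain X where X: "p = Abs_dodecahedral_space X" "X \<in> {(\<lambda>h. a ** h) ` binary_icosahedral | a. a \<in> SU2}"
    by (rule Abs_dodecahedral_space_cases)
  then obtain a where "a \<in> SU2" "X = (\<lambda>h. a ** h) ` binary_icosahedral" by blast
  moreover obtain x where "x \<in> S3" "a = quat x" using \<open>a \<in> SU2\<close> unfolding SU2_eq by blast
  ultimately show ?thesis using that[of x] X(1) unfolding coset_def by simp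
qed

definition pull :: "(dodecahedral_space \<Rightarrow> real) \<Rightarrow> real ^ 4 \<Rightarrow> real" where
  "pull f x = f (coset (quat x))"

lemma pull_eqI: "(\<And>x. x \<in> S3 \<Longrightarrow> pull f x = pull g x) \<Longrightarrow> f = g"
  unfolding pull_def by (rule ext) (metis coset_quat_surj)

lemma pull_right: "x \<in> S3 \<Longrightarrow> g \<in> unit_icosians \<Longrightarrow> pull f (x \<odot> g) = pull f x"
  by (simp add: pull_def coset_quat_right)

lemma descend:
  assumes "\<And>x g. x \<in> S3 \<Longrightarrow> g \<in> unit_icosians \<Longrightarrow> P (x \<odot> g) = P x"
  obtains f where "\<And>x. x \<in> S3 \<Longrightarrow> pull f x = P x"
proof -
  define f where "f = (\<lambda>p. P (SOME x. x \<in> S3 \<and> p = coset (quat x)))"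
  have "pull f x = P x" if x: "x \<in> S3" for x
  proof -
    let ?y = "SOME y. y \<in> S3 \<and> coset (quat x) = coset (quat y)"
    have "?y \<in> S3 \<and> coset (quat x) = coset (quat ?y)"
      by (rule someI[of "\<lambda>y. y \<in> S3 \<and> coset (quat x) = coset (quat y)" x]) (use x in simp)
    then obtain g where "g \<in> unit_icosians" "?y = x \<odot> g" using coset_quat_eq_iff[OF x] by blast
    then show ?thesis using assms[OF x] by (simp add: f_def pull_def)
  qed
  then show ?thesis using that by blast
qed

lemma base_point_quat: "base_point = coset (quat qone)"
  by (simp add: base_point_def quat_qone)

lemma act_coset_quat:
  assumes "a \<in> S3" "x \<in> S3"
  shows "act (quat a) (coset (quat x)) = coset (quat (a \<odot> x))"
  unfolding act_def Rep_coset_quat[OF assms(2)]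
  by (simp add: coset_def coset_image image_image quat_qmul qmul_assoc)

lemma card_binary_icosahedral: "card binary_icosahedral = 120"
  unfolding binary_icosahedral_def
  by (simp add: card_image[OF inj_on_subset[OF inj_quat subset_UNIV]] card_unit_icosians)

lemma integral_M_pull: "integral_M f = (LINT x|\<sigma>. pull f x) / 120"
  by (simp add: integral_M_def pull_def card_binary_icosahedral)

lemma L2_inner_pull: "L2_inner f g = (LINT x|\<sigma>. pull f x * pull g x) / 120"
  by (simp add: L2_inner_def integral_M_def pull_def card_binary_icosahedral)

lemma smooth_second_deriv:
  assumes "f \<in> smooth_functions" "e \<in> imag_units"
  shows "\<exists>F2. second_deriv_along e (pull f) F2"
proof -
  have "Ck_on 2 (- {0}) (\<lambda>x. f (coset (quat (sgn x))))" using assms(1) by (simp add: smooth_functions_def)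
  from C2_second_deriv_along[OF this assms(2)] obtain F2
    where "second_deriv_along e (\<lambda>x. f (coset (quat (sgn x)))) F2" by blast
  then have "second_deriv_along e (pull f) F2"
    by (rule second_deriv_along_cong[OF _ _ assms(2)]) (simp add: pull_def sgn_div_norm)
  then show ?thesis by blast
qed

text \<open>
  The eigenvalue equation in terms of the second derivatives along great circles of the function
  pulled back to the sphere.
\<close>

lemma E168_iff:
  "f \<in> E168 \<longleftrightarrow> f \<in> smooth_functions \<and>
     (\<exists>F2. (\<forall>e\<in>imag_units. second_deriv_along e (pull f) (F2 e)) \<and>
       (\<forall>x\<in>S3. (\<Sum>e\<in>imag_units. F2 e x) = - 168 * pull f x))" (is "_ \<longleftrightarrow> _ \<and> ?R")
proof (cases "f \<in> smooth_functions")
  case True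
  have lap: "laplacian_SU2 (\<lambda>b. f (coset b)) (quat x) = - (\<Sum>e\<in>imag_units. F2 e x)"
    if "\<And>e. e \<in> imag_units \<Longrightarrow> second_deriv_along e (pull f) (F2 e)" "x \<in> S3" for F2 x
    by (rule laplacian_quat) (use that in \<open>simp_all add: pull_def[abs_def]\<close>)
  have "(\<forall>a\<in>SU2. laplacian_SU2 (\<lambda>b. f (coset b)) a = 168 * f (coset a)) \<longleftrightarrow> ?R"
  proof
    assume L: "\<forall>a\<in>SU2. laplacian_SU2 (\<lambda>b. f (coset b)) a = 168 * f (coset a)"
    have "\<forall>e. \<exists>F2. e \<in> imag_units \<longrightarrow> second_deriv_along e (pull f) F2"
      using smooth_second_deriv[OF True] by blast
    from choice[OF this] obtain F2 where F2: "\<And>e. e \<in> imag_units \<Longrightarrow> second_deriv_along e (pull f) (F2 e)"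
      by blast
    moreover have "(\<Sum>e\<in>imag_units. F2 e x) = - 168 * pull f x" if x: "x \<in> S3" for x
    proof -
      have "- (\<Sum>e\<in>imag_units. F2 e x) = 168 * pull f x"
        using L quat_SU2[OF x] lap[OF F2 x] by (simp add: pull_def)
      then show ?thesis by simp
    qed
    ultimately show ?R by blast
  next
    assume ?R
    then obtain F2 where F2: "\<And>e. e \<in> imag_units \<Longrightarrow> second_deriv_along e (pull f) (F2 e)"
      "\<And>x. x \<in> S3 \<Longrightarrow> (\<Sum>e\<in>imag_units. F2 e x) = - 168 * pull f x" by blast
    show "\<forall>a\<in>SU2. laplacian_SU2 (\<lambda>b. f (coset b)) a = 168 * f (coset a)"
      unfolding SU2_eq
    proof clarify
      fix x :: "real ^ 4" assume x: "x \<in> S3"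
      have "laplacian_SU2 (\<lambda>b. f (coset b)) (quat x) = - (\<Sum>e\<in>imag_units. F2 e x)"
        by (rule lap[OF _ x]) (fact F2(1))
      also have "\<dots> = 168 * f (coset (quat x))" unfolding F2(2)[OF x] by (simp add: pull_def)
      finally show "laplacian_SU2 (\<lambda>b. f (coset b)) (quat x) = 168 * f (coset (quat x))" .
    qed
  qed
  then show ?thesis using True unfolding laplace_eigenspace_def by simp
qed (simp add: laplace_eigenspace_def)

lemma E168_weak_eigen:
  assumes "f \<in> E168" shows "weak_eigen 168 (pull f)"
proof -
  obtain F2 where F2: "\<And>e. e \<in> imag_units \<Longrightarrow> second_deriv_along e (pull f) (F2 e)"
    "\<And>x. x \<in> S3 \<Longrightarrow> (\<Sum>e\<in>imag_units. F2 e x) = - 168 * pull f x"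
    using assms unfolding E168_iff by blast
  then have "continuous_on S3 (pull f)" unfolding second_deriv_along_def by blast
  then show ?thesis using F2 by (rule eigen_imp_weak_eigen)
qed

lemma E168_lin:
  assumes f: "f \<in> E168" and g: "g \<in> E168"
  shows "(\<lambda>x. a * f x + b * g x) \<in> E168"
proof -
  obtain F2 where F2: "\<And>e. e \<in> imag_units \<Longrightarrow> second_deriv_along e (pull f) (F2 e)"
    "\<And>x. x \<in> S3 \<Longrightarrow> (\<Sum>e\<in>imag_units. F2 e x) = - 168 * pull f x"
    using f unfolding E168_iff by blast
  obtain G2 where G2: "\<And>e. e \<in> imag_units \<Longrightarrow> second_deriv_along e (pull g) (G2 e)"
    "\<And>x. x \<in> S3 \<Longrightarrow> (\<Sum>e\<in>imag_units. G2 e x) = - 168 * pull g x"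
    using g unfolding E168_iff by blast
  have p: "pull (\<lambda>x. a * f x + b * g x) = (\<lambda>x. a * pull f x + b * pull g x)"
    by (rule ext) (simp add: pull_def)
  have "(\<lambda>x. a * f x + b * g x) \<in> smooth_functions"
    using f g unfolding laplace_eigenspace_def smooth_functions_def by (auto intro!: Ck_on_lin)
  moreover have "\<forall>e\<in>imag_units. second_deriv_along e (\<lambda>x. a * pull f x + b * pull g x) (\<lambda>x. a * F2 e x + b * G2 e x)"
    by (intro ballI second_deriv_along_lin F2(1) G2(1))
  moreover have "\<forall>x\<in>S3. (\<Sum>e\<in>imag_units. a * F2 e x + b * G2 e x) = - 168 * (a * pull f x + b * pull g x)"
  proof
    fix x assume "x \<in> S3"
    have "(\<Sum>e\<in>imag_units. a * F2 e x + b * G2 e x) = a * (\<Sum>e\<in>imag_units. F2 e x) + b * (\<Sum>e\<in>imag_units. G2 e x)"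
      by (simp only: sum.distrib sum_distrib_left)
    then show "(\<Sum>e\<in>imag_units. a * F2 e x + b * G2 e x) = - 168 * (a * pull f x + b * pull g x)"
      unfolding F2(2)[OF \<open>x \<in> S3\<close>] G2(2)[OF \<open>x \<in> S3\<close>] by (simp add: algebra_simps)
  qed
  ultimately show ?thesis
    unfolding E168_iff p by (intro conjI exI[of _ "\<lambda>e x. a * F2 e x + b * G2 e x"])
qed

text \<open>
  Each summand is the zonal function at \<open>qcnj h\<close>. Summation over the group makes the function right invariant, so
  it descends to the quotient.
\<close>

lemma E168_kernel:
  obtains k where "k \<in> E168" "\<And>x. x \<in> S3 \<Longrightarrow> pull k x = (\<Sum>h\<in>unit_icosians. char12 (x \<odot> h))"
proof -
  let ?K = "\<lambda>x. \<Sum>h\<in>unit_icosians. char12 (x \<odot> h)"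
  have "?K (x \<odot> g) = ?K x" if g: "g \<in> unit_icosians" for x g
    unfolding qmul_assoc
    by (rule sum.reindex_bij_witness[of _ "\<lambda>h. qcnj g \<odot> h" "\<lambda>h. g \<odot> h"])
       (use g icosian_S3[OF g] in \<open>auto intro: unit_icosians_mult unit_icosians_qcnj\<close>)
  then obtain k where k: "\<And>x. x \<in> S3 \<Longrightarrow> pull k x = ?K x" using descend[of ?K] by blast
  have "k \<in> smooth_functions"
    unfolding smooth_functions_def
  proof (intro CollectI allI)
    fix n
    have "smooth_expr (\<lambda>x. \<Sum>h\<in>unit_icosians. zonal (qcnj h) (sgn x))"
      by (intro smooth_expr_sum smooth_expr_zonal)
    then have "Ck_on n (- {0}) (\<lambda>x. \<Sum>h\<in>unit_icosians. zonal (qcnj h) (sgn x))" by (rule smooth_expr_Ck)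
    then show "Ck_on n (- {0}) (\<lambda>x. k (coset (quat (sgn x))))"
    proof (rule Ck_on_cong[rotated 2])
      fix x :: "real ^ 4" assume "x \<in> - {0}"
      then have "sgn x \<in> S3" by (intro sgn_S3) simp
      from k[OF this] show "(\<Sum>h\<in>unit_icosians. zonal (qcnj h) (sgn x)) = k (coset (quat (sgn x)))"
        by (simp only: pull_def char12_qmul)
    qed auto
  qed
  moreover
  let ?D = "\<lambda>h e x. ddU12 (x \<bullet> qcnj h) * ((x \<odot> e) \<bullet> qcnj h)\<^sup>2 - dU12 (x \<bullet> qcnj h) * (x \<bullet> qcnj h)"
  have "second_deriv_along e (pull k) (\<lambda>x. \<Sum>h\<in>unit_icosians. ?D h e x)" if e: "e \<in> imag_units" for e
  proof (rule second_deriv_along_cong[OF _ _ e])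
    show "second_deriv_along e (\<lambda>x. \<Sum>h\<in>unit_icosians. zonal (qcnj h) x) (\<lambda>x. \<Sum>h\<in>unit_icosians. ?D h e x)"
      by (intro second_deriv_along_sum finite_unit_icosians zonal_second_deriv_U12 e)
  qed (simp only: k char12_qmul)
  moreover have "(\<Sum>e\<in>imag_units. \<Sum>h\<in>unit_icosians. ?D h e x) = - 168 * pull k x" if x: "x \<in> S3" for x
  proof -
    have "(\<Sum>e\<in>imag_units. \<Sum>h\<in>unit_icosians. ?D h e x) = (\<Sum>h\<in>unit_icosians. \<Sum>e\<in>imag_units. ?D h e x)"
      by (rule sum.swap)
    also have "\<dots> = (\<Sum>h\<in>unit_icosians. - 168 * zonal (qcnj h) x)"
      by (intro sum.cong refl zonal_eigen x S3_qcnj icosian_S3)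
    finally show ?thesis unfolding k[OF x] char12_qmul by (simp only: sum_distrib_left)
  qed
  ultimately have "k \<in> E168"
    unfolding E168_iff by (intro conjI ballI exI[of _ "\<lambda>e x. \<Sum>h\<in>unit_icosians. ?D h e x"])
  then show ?thesis using that k by blast
qed

section \<open>Riesz representation in finite dimension\<close>

definition lin_closed :: "('a \<Rightarrow> real) set \<Rightarrow> bool" where
  "lin_closed V \<longleftrightarrow> V \<noteq> {} \<and> (\<forall>f\<in>V. \<forall>g\<in>V. \<forall>a b. (\<lambda>x. a * f x + b * g x) \<in> V)"

text \<open>
  Linearity is stated relative to \<open>V\<close> because integrals are additive only on integrable functions.
\<close>

definition lin_on :: "('a \<Rightarrow> real) set \<Rightarrow> (('a \<Rightarrow> real) \<Rightarrow> real) \<Rightarrow> bool" where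
  "lin_on V L \<longleftrightarrow> (\<forall>f\<in>V. \<forall>g\<in>V. \<forall>a b. L (\<lambda>x. a * f x + b * g x) = a * L f + b * L g)"

lemma lin_on_subset: "lin_on V L \<Longrightarrow> W \<subseteq> V \<Longrightarrow> lin_on W L"
  unfolding lin_on_def by blast

lemma lin_on_zero: "lin_on V L \<Longrightarrow> f \<in> V \<Longrightarrow> L (\<lambda>_. 0) = 0"
proof -
  assume "lin_on V L" "f \<in> V"
  then have "L (\<lambda>x. 0 * f x + 0 * f x) = 0 * L f + 0 * L f" unfolding lin_on_def by blast
  then show ?thesis by simp
qed

text \<open>
  Induction on the number of functionals \<open>\<l> i\<close> that separate the points of \<open>V\<close>, which plays the role of
  the dimension. The kernel of one of them has codimension at most one; its orthogonal
  complement is spanned by a vector \<open>u\<close>, and the representing element is corrected by a multiple of \<open>u\<close>.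
\<close>

lemma riesz_exists:
  fixes ip :: "('a \<Rightarrow> real) \<Rightarrow> ('a \<Rightarrow> real) \<Rightarrow> real" and \<l> :: "'i \<Rightarrow> ('a \<Rightarrow> real) \<Rightarrow> real"
  assumes ip: "\<And>h. h \<in> V\<^sub>0 \<Longrightarrow> lin_on V\<^sub>0 (\<lambda>f. ip f h)"
    "\<And>f h. f \<in> V\<^sub>0 \<Longrightarrow> h \<in> V\<^sub>0 \<Longrightarrow> ip f h = ip h f"
    "\<And>f. f \<in> V\<^sub>0 \<Longrightarrow> ip f f = 0 \<Longrightarrow> f = (\<lambda>_. 0)"
    and \<l>: "\<And>i. lin_on V\<^sub>0 (\<l> i)"
    and I: "finite I"
  shows "V \<subseteq> V\<^sub>0 \<Longrightarrow> lin_closed V \<Longrightarrow> (\<And>f. f \<in> V \<Longrightarrow> (\<And>i. i \<in> I \<Longrightarrow> \<l> i f = 0) \<Longrightarrow> f = (\<lambda>_. 0)) \<Longrightarrow>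
    lin_on V L \<Longrightarrow> \<exists>q\<in>V. \<forall>h\<in>V. L h = ip q h"
  using I
proof (induction I arbitrary: V L rule: finite_induct)
  case empty
  then have V: "f = (\<lambda>_. 0)" if "f \<in> V" for f using that by blast
  obtain f where f: "f \<in> V" using empty.prems(2) by (auto simp: lin_closed_def)
  have "L h = ip f h" if h: "h \<in> V" for h
  proof -
    have "ip (\<lambda>_. 0) h = 0" using ip(1)[of h] h empty.prems(1) lin_on_zero by blast
    moreover have "L (\<lambda>_. 0) = 0" by (rule lin_on_zero[OF empty.prems(4) f])
    ultimately show ?thesis using V[OF f] V[OF h] by metis
  qed
  then show ?case using f by blast
next
  case (insert j I)
  define V' where "V' = {f \<in> V. \<l> j f = 0}"
  have lc: "(\<lambda>x. a * f x + b * g x) \<in> V" if "f \<in> V" "g \<in> V" for f g a b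
    using insert.prems(2) that unfolding lin_closed_def by blast
  have lj: "lin_on V (\<l> j)" by (rule lin_on_subset[OF \<l> insert.prems(1)])
  obtain f0 where f0: "f0 \<in> V" using insert.prems(2) by (auto simp: lin_closed_def)
  have z: "(\<lambda>x. 0) \<in> V" using lc[OF f0 f0, of 0 0] by simp
  have V': "V' \<subseteq> V\<^sub>0" "lin_closed V'" "V' \<subseteq> V"
  proof -
    show "V' \<subseteq> V\<^sub>0" "V' \<subseteq> V" using insert.prems(1) by (auto simp: V'_def)
    have "(\<lambda>_. 0) \<in> V'" using z lin_on_zero[OF lj z] by (simp add: V'_def)
    moreover have "(\<lambda>x. a * f x + b * g x) \<in> V'" if "f \<in> V'" "g \<in> V'" for f g a b
      using that lc lj unfolding V'_def lin_on_def by simp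
    ultimately show "lin_closed V'" unfolding lin_closed_def by blast
  qed
  have sep: "f = (\<lambda>_. 0)" if "f \<in> V'" "\<And>i. i \<in> I \<Longrightarrow> \<l> i f = 0" for f
    using insert.prems(3)[of f] that by (auto simp: V'_def)
  have IH: "\<exists>q\<in>V'. \<forall>h\<in>V'. L' h = ip q h" if "lin_on V' L'" for L'
    by (rule insert.IH[OF V'(1,2) _ that]) (fact sep)
  show ?case
  proof (cases "V' = V")
    case True
    then show ?thesis using IH[of L] insert.prems(4) by simp
  next
    case False
    then obtain w where w: "w \<in> V" "\<l> j w \<noteq> 0" by (auto simp: V'_def)
    have ipl: "ip (\<lambda>x. a * f x + b * g x) h = a * ip f h + b * ip g h" if "f \<in> V" "g \<in> V" "h \<in> V" for f g h a b
      using ip(1)[of h] that insert.prems(1) unfolding lin_on_def by blast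
    have sym: "ip f h = ip h f" if "f \<in> V" "h \<in> V" for f h using ip(2) that insert.prems(1) by blast
    have ipr: "ip h (\<lambda>x. a * f x + b * g x) = a * ip h f + b * ip h g" if "f \<in> V" "g \<in> V" "h \<in> V" for f g h a b
      using ipl[OF that] sym that lc by metis
    have "lin_on V' (\<lambda>h. ip w h)" unfolding lin_on_def using ipr w V'(3) by blast
    from IH[OF this] obtain p where p: "p \<in> V'" "\<And>h. h \<in> V' \<Longrightarrow> ip w h = ip p h" by blast
    \<comment> \<open>The component of \<open>w\<close> orthogonal to \<open>V'\<close>.\<close>
    define u where "u = (\<lambda>x. 1 * w x + - 1 * p x)"
    have pV: "p \<in> V" using p V'(3) by blast
    have u: "u \<in> V" unfolding u_def by (rule lc[OF w(1) pV])
    have uV': "ip u h = 0" if "h \<in> V'" for h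
      using ipl[OF w(1) pV, of h 1 "-1"] that p(2) V'(3) by (auto simp: u_def)
    have lu: "\<l> j u = \<l> j w"
    proof -
      have "\<l> j u = 1 * \<l> j w + - 1 * \<l> j p" using lj w(1) pV unfolding u_def lin_on_def by blast
      then show ?thesis using p(1) by (simp add: V'_def)
    qed
    then have "u \<noteq> (\<lambda>_. 0)" using w(2) lin_on_zero[OF lj w(1)] by metis
    then have uu: "ip u u \<noteq> 0" using ip(3) u insert.prems(1) by blast
    obtain q' where q': "q' \<in> V'" "\<And>h. h \<in> V' \<Longrightarrow> L h = ip q' h"
      using IH[OF lin_on_subset[OF insert.prems(4) V'(3)]] by blast
    have q'V: "q' \<in> V" using q' V'(3) by blast
    define q where "q = (\<lambda>x. 1 * q' x + (L u / ip u u) * u x)"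
    have q: "q \<in> V" unfolding q_def by (rule lc[OF q'V u])
    have "L h = ip q h" if h: "h \<in> V" for h
    proof -
      define c where "c = \<l> j h / \<l> j w"
      define h' where "h' = (\<lambda>x. 1 * h x + - c * u x)"
      have h': "h' \<in> V'"
      proof -
        have "h' \<in> V" unfolding h'_def by (rule lc[OF h u])
        moreover have "\<l> j h' = 1 * \<l> j h + - c * \<l> j u"
          using lj h u unfolding h'_def lin_on_def by blast
        ultimately show ?thesis using w(2) by (simp add: V'_def lu c_def)
      qed
      have h'V: "h' \<in> V" using h' V'(3) by blast
      have hh: "h = (\<lambda>x. 1 * h' x + c * u x)" by (rule ext) (simp add: h'_def)
      have "L h = 1 * L h' + c * L u"
        using insert.prems(4) h'V u unfolding lin_on_def by (subst hh) blast
      moreover have "ip q h = 1 * ip q h' + c * ip q u"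
        by (subst hh) (rule ipr[OF h'V u q])
      moreover have "ip q h' = L h'"
        unfolding q_def ipl[OF q'V u h'V] using q'(2)[OF h'] uV'[OF h'] by simp
      moreover have "ip q u = L u"
        unfolding q_def ipl[OF q'V u u] using uV'[OF q'(1)] sym[OF u q'V] uu by simp
      ultimately show ?thesis by simp
    qed
    then show ?thesis using q by blast
  qed
qed

lemma L2_inner_lin:
  assumes "continuous_on S3 (pull f)" "continuous_on S3 (pull g)" "continuous_on S3 (pull h)"
  shows "L2_inner (\<lambda>x. a * f x + b * g x) h = a * L2_inner f h + b * L2_inner g h"
proof -
  have "(LINT x|\<sigma>. pull (\<lambda>x. a * f x + b * g x) x * pull h x)
    = (LINT x|\<sigma>. a * (pull f x * pull h x) + b * (pull g x * pull h x))"
    by (rule integral_cong_S3) (simp add: pull_def algebra_simps)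
  also have "\<dots> = a * (LINT x|\<sigma>. pull f x * pull h x) + b * (LINT x|\<sigma>. pull g x * pull h x)"
    by (subst Bochner_Integration.integral_add) (auto intro!: integrable_cont continuous_intros assms)
  finally show ?thesis by (simp add: L2_inner_pull add_divide_distrib)
qed

lemma L2_inner_commute: "L2_inner f g = L2_inner g f"
  by (simp add: L2_inner_def mult.commute)

lemma L2_inner_definite:
  assumes f: "continuous_on S3 (pull f)" and 0: "L2_inner f f = 0"
  shows "f = (\<lambda>_. 0)"
proof (rule pull_eqI)
  fix x assume x: "x \<in> S3"
  have "(LINT x|\<sigma>. pull f x * pull f x) = 0" using 0 by (simp add: L2_inner_pull)
  from integral_zero_imp_zero[OF _ _ this x] f show "pull f x = pull (\<lambda>_. 0) x"
    by (simp add: continuous_on_mult pull_def)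
qed

text \<open>
  After pulling back to the sphere, \<open>V\<close> lies in the span of finitely many continuous functions. They
  may fail to be right invariant, so they live on the sphere and not on the quotient. Pairs of words serve as indices because products of
  two eigenfunctions are expanded in products of two monomials.
\<close>

definition fin_spanned :: "(dodecahedral_space \<Rightarrow> real) set \<Rightarrow> bool" where
  "fin_spanned V \<longleftrightarrow> (\<exists>(W :: (4 list \<times> 4 list) set) m. finite W \<and> (\<forall>w. continuous_on S3 (m w)) \<and>
     (\<forall>f\<in>V. \<exists>a. \<forall>x\<in>S3. pull f x = (\<Sum>w\<in>W. a w * m w x)))"

lemma fin_spanned_cont:
  assumes "fin_spanned V" "f \<in> V" shows "continuous_on S3 (pull f)"
proof -
  obtain W :: "(4 list \<times> 4 list) set" and m a where "\<And>w. continuous_on S3 (m w)"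
    "\<And>x. x \<in> S3 \<Longrightarrow> pull f x = (\<Sum>w\<in>W. a w * m w x)"
    using assms unfolding fin_spanned_def by blast
  then show ?thesis by (subst continuous_on_cong[OF refl]) (auto intro!: continuous_intros)
qed

text \<open>
  The integrals against the spanning functions separate the points of \<open>V\<close>: if they all vanish
  on \<open>f\<close>, then \<open>\<integral> f\<^sup>2\<close> vanishes as well.
\<close>

lemma riesz:
  assumes V: "lin_closed V" "fin_spanned V" and L: "lin_on V L"
  shows "\<exists>!q. q \<in> V \<and> (\<forall>h\<in>V. L2_inner q h = L h)"
proof -
  obtain W :: "(4 list \<times> 4 list) set" and m where W: "finite W" "\<And>w. continuous_on S3 (m w)"
    "\<And>f. f \<in> V \<Longrightarrow> \<exists>a. \<forall>x\<in>S3. pull f x = (\<Sum>w\<in>W. a w * m w x)"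
    using V(2) unfolding fin_spanned_def by blast
  note c = fin_spanned_cont[OF V(2)]
  have lc: "(\<lambda>x. a * f x + b * g x) \<in> V" if "f \<in> V" "g \<in> V" for f g a b
    using V(1) that unfolding lin_closed_def by blast
  define \<l> where "\<l> = (\<lambda>w f. LINT x|\<sigma>. m w x * pull f x)"
  have "\<exists>q\<in>V. \<forall>h\<in>V. L h = L2_inner q h"
  proof (rule riesz_exists[where V\<^sub>0 = V and \<l> = \<l> and I = W])
    show "lin_on V (\<lambda>f. L2_inner f h)" if "h \<in> V" for h
      unfolding lin_on_def using L2_inner_lin c that by blast
    show "f = (\<lambda>_. 0)" if "f \<in> V" "L2_inner f f = 0" for f
      using L2_inner_definite c that by blast
    show "lin_on V (\<l> w)" for w
      unfolding lin_on_def
    proof (intro ballI allI)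
      fix f g a b assume fg: "f \<in> V" "g \<in> V"
      have "\<l> w (\<lambda>x. a * f x + b * g x) = (LINT x|\<sigma>. a * (m w x * pull f x) + b * (m w x * pull g x))"
        unfolding \<l>_def by (rule integral_cong_S3) (simp add: pull_def algebra_simps)
      also have "\<dots> = a * \<l> w f + b * \<l> w g"
        unfolding \<l>_def
        by (subst Bochner_Integration.integral_add) (auto intro!: integrable_cont continuous_intros W c fg)
      finally show "\<l> w (\<lambda>x. a * f x + b * g x) = a * \<l> w f + b * \<l> w g" .
    qed
    show "f = (\<lambda>_. 0)" if f: "f \<in> V" and 0: "\<And>w. w \<in> W \<Longrightarrow> \<l> w f = 0" for f
    proof (rule L2_inner_definite[OF c[OF f]])
      obtain a where a: "\<And>x. x \<in> S3 \<Longrightarrow> pull f x = (\<Sum>w\<in>W. a w * m w x)" using W(3)[OF f] by blast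
      have "(LINT x|\<sigma>. pull f x * pull f x) = (LINT x|\<sigma>. (\<Sum>w\<in>W. a w * (m w x * pull f x)))"
      proof (rule integral_cong_S3)
        fix x assume "x \<in> S3"
        have "pull f x * pull f x = (\<Sum>w\<in>W. a w * m w x) * pull f x" using a[OF \<open>x \<in> S3\<close>] by simp
        then show "pull f x * pull f x = (\<Sum>w\<in>W. a w * (m w x * pull f x))"
          by (simp only: sum_distrib_right mult.assoc)
      qed
      also have "\<dots> = (\<Sum>w\<in>W. LINT x|\<sigma>. a w * (m w x * pull f x))"
        by (rule Bochner_Integration.integral_sum) (intro integrable_cont continuous_intros W c f)
      also have "\<dots> = 0" using 0 by (simp add: \<l>_def)
      finally show "L2_inner f f = 0" by (simp add: L2_inner_pull)
    qed
  qed (use W(1) V(1) L L2_inner_commute in auto)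
  then obtain q where q: "q \<in> V" "\<And>h. h \<in> V \<Longrightarrow> L2_inner q h = L h" by metis
  show ?thesis
  proof (rule ex1I[of _ q])
    fix r assume r: "r \<in> V \<and> (\<forall>h\<in>V. L2_inner r h = L h)"
    let ?d = "\<lambda>x. 1 * r x + - 1 * q x"
    have d: "?d \<in> V" using r q lc by blast
    have "L2_inner ?d ?d = 1 * L2_inner r ?d + - 1 * L2_inner q ?d"
      using r q d by (intro L2_inner_lin c) auto
    then have "L2_inner ?d ?d = 0" using r q(2)[OF d] d by simp
    then have "?d = (\<lambda>_. 0)" by (rule L2_inner_definite[OF c[OF d]])
    then show "r = q" by (simp add: fun_eq_iff)
  qed (use q in blast)
qed

section \<open>Eigenfunctions are polynomials\<close>

text \<open>
  Words in the indices of coordinates enumerate the terms of an expanded power; a monomial may be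
  listed several times.
\<close>

definition words :: "nat \<Rightarrow> 4 list set" where
  "words n = {xs. length xs = n}"

definition monomial :: "4 list \<Rightarrow> real ^ 4 \<Rightarrow> real" where
  "monomial xs v = prod_list (map (\<lambda>i. v $ i) xs)"

lemma finite_words: "finite (words n)"
  using finite_lists_length_eq[of "UNIV :: 4 set" n] by (simp add: words_def)

lemma continuous_monomial: "continuous_on A (monomial xs)"
  unfolding monomial_def by (induction xs) (auto intro!: continuous_intros)

lemma inner_power_monomials: "(x \<bullet> v) ^ n = (\<Sum>xs\<in>words n. monomial xs x * monomial xs v)"
proof (induction n)
  case 0
  then show ?case by (simp add: words_def monomial_def)
next
  case (Suc n)
  have W: "words (Suc n) = (\<lambda>(i, xs). i # xs) ` (UNIV \<times> words n)"
    by (auto simp: words_def length_Suc_conv)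
  have "(\<Sum>xs\<in>words (Suc n). monomial xs x * monomial xs v)
      = (\<Sum>(i, xs)\<in>UNIV \<times> words n. (x $ i * v $ i) * (monomial xs x * monomial xs v))"
    unfolding W by (subst sum.reindex) (auto simp: inj_on_def monomial_def algebra_simps intro!: sum.cong)
  also have "\<dots> = (\<Sum>i\<in>UNIV. x $ i * v $ i) * (\<Sum>xs\<in>words n. monomial xs x * monomial xs v)"
    by (simp add: sum_product sum.cartesian_product)
  finally show ?case unfolding Suc[symmetric] by (simp add: inner_vec_def)
qed

lemma E168_cont: "f \<in> E168 \<Longrightarrow> continuous_on S3 (pull f)"
  by (rule weak_eigen_cont[OF E168_weak_eigen])

text \<open>
  The reproducing formula expresses \<open>f\<close> by its twelfth moments, which are polynomials in \<open>v\<close>.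
\<close>

lemma E168_polynomial:
  assumes f: "f \<in> E168"
  shows "\<exists>a. \<forall>v\<in>S3. pull f v = (\<Sum>w\<in>words 12. a w * monomial w v)"
proof -
  note F = E168_weak_eigen[OF f]
  have "pull f v = (\<Sum>w\<in>words 12. (4096 / \<kappa> * (LINT x|\<sigma>. pull f x * monomial w x)) * monomial w v)"
    if v: "v \<in> S3" for v
  proof -
    have "(LINT x|\<sigma>. pull f x * (x \<bullet> v) ^ 12) = (LINT x|\<sigma>. (\<Sum>w\<in>words 12. pull f x * monomial w x * monomial w v))"
      unfolding inner_power_monomials sum_distrib_left by (simp only: mult.assoc)
    also have "\<dots> = (\<Sum>w\<in>words 12. LINT x|\<sigma>. pull f x * monomial w x * monomial w v)"
      by (rule Bochner_Integration.integral_sum)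
         (intro integrable_cont continuous_intros continuous_monomial E168_cont f)
    also have "\<dots> = (\<Sum>w\<in>words 12. (LINT x|\<sigma>. pull f x * monomial w x) * monomial w v)" by simp
    finally show ?thesis
      unfolding weak_eigen_eq_moment[OF F v] by (simp only: sum_distrib_left mult.assoc)
  qed
  then show ?thesis by (intro exI[of _ "\<lambda>w. 4096 / \<kappa> * (LINT x|\<sigma>. pull f x * monomial w x)"]) blast
qed

lemma fin_spanned_E168: "fin_spanned E168"
  unfolding fin_spanned_def
proof (intro exI[of _ "words 12 \<times> {[]}"] exI[of _ "\<lambda>w. monomial (fst w)"] conjI ballI allI)
  show "finite (words 12 \<times> {[]})" by (simp add: finite_words)
  show "continuous_on S3 (monomial (fst w))" for w
    by (rule continuous_monomial)
  fix f assume "f \<in> E168"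
  then obtain a where a: "\<And>v. v \<in> S3 \<Longrightarrow> pull f v = (\<Sum>w\<in>words 12. a w * monomial w v)"
    using E168_polynomial by blast
  have eq: "(\<Sum>w\<in>words 12. a w * monomial w v) = (\<Sum>w\<in>words 12 \<times> {[]}. a (fst w) * monomial (fst w) v)" for v
    by (rule sum.reindex_bij_witness[of _ fst "\<lambda>w. (w, [])"]) auto
  show "\<exists>a. \<forall>x\<in>S3. pull f x = (\<Sum>w\<in>words 12 \<times> {[]}. a w * monomial (fst w) x)"
    by (intro exI[of _ "\<lambda>w. a (fst w)"] ballI) (rule trans[OF a eq])
qed

lemma lin_closed_E168: "lin_closed E168"
  unfolding lin_closed_def using E168_kernel E168_lin by (metis empty_iff)

text \<open>
  Multiply out the expansions of the factors.
\<close>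

lemma fin_spanned_product_span: "fin_spanned product_span"
  unfolding fin_spanned_def
proof (intro exI[of _ "words 12 \<times> words 12"] exI[of _ "\<lambda>w v. monomial (fst w) v * monomial (snd w) v"] conjI ballI allI)
  show "finite (words 12 \<times> words 12)" by (simp add: finite_words)
  show "continuous_on S3 (\<lambda>v. monomial (fst w) v * monomial (snd w) v)" for w
    by (intro continuous_intros continuous_monomial)
  fix q assume "q \<in> product_span"
  then obtain n c f g where q: "q = (\<lambda>x. \<Sum>i<(n::nat). c i * (f i x * g i x))" "\<forall>i<n. f i \<in> E168 \<and> g i \<in> E168"
    unfolding product_span_def by blast
  have "\<forall>i. \<exists>a. i < n \<longrightarrow> (\<forall>v\<in>S3. pull (f i) v = (\<Sum>w\<in>words 12. a w * monomial w v))"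
    using q(2) E168_polynomial by blast
  from choice[OF this] obtain a where a: "\<And>i v. i < n \<Longrightarrow> v \<in> S3 \<Longrightarrow> pull (f i) v = (\<Sum>w\<in>words 12. a i w * monomial w v)"
    by blast
  have "\<forall>i. \<exists>b. i < n \<longrightarrow> (\<forall>v\<in>S3. pull (g i) v = (\<Sum>w\<in>words 12. b w * monomial w v))"
    using q(2) E168_polynomial by blast
  from choice[OF this] obtain b where b: "\<And>i v. i < n \<Longrightarrow> v \<in> S3 \<Longrightarrow> pull (g i) v = (\<Sum>w\<in>words 12. b i w * monomial w v)"
    by blast
  have "pull q v = (\<Sum>w\<in>words 12 \<times> words 12. (\<Sum>i<n. c i * (a i (fst w) * b i (snd w))) * (monomial (fst w) v * monomial (snd w) v))"
    if v: "v \<in> S3" for v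
  proof -
    have "pull q v = (\<Sum>i<n. c i * (pull (f i) v * pull (g i) v))" by (simp add: pull_def q(1))
    also have "\<dots> = (\<Sum>i<n. \<Sum>w\<in>words 12 \<times> words 12.
        c i * (a i (fst w) * b i (snd w)) * (monomial (fst w) v * monomial (snd w) v))"
    proof (rule sum.cong[OF refl])
      fix i assume "i \<in> {..<n}"
      then have i: "i < n" by simp
      show "c i * (pull (f i) v * pull (g i) v) = (\<Sum>w\<in>words 12 \<times> words 12.
        c i * (a i (fst w) * b i (snd w)) * (monomial (fst w) v * monomial (snd w) v))"
        unfolding a[OF i v] b[OF i v]
        by (subst sum_product, subst sum.cartesian_product, subst sum_distrib_left, rule sum.cong)
           (auto simp: algebra_simps)
    qed
    also have "\<dots> = (\<Sum>w\<in>words 12 \<times> words 12. \<Sum>i<n. 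
        c i * (a i (fst w) * b i (snd w)) * (monomial (fst w) v * monomial (snd w) v))"
      by (rule sum.swap)
    finally show ?thesis by (simp only: sum_distrib_right)
  qed
  then show "\<exists>a. \<forall>x\<in>S3. pull q x = (\<Sum>w\<in>words 12 \<times> words 12. a w * (monomial (fst w) x * monomial (snd w) x))"
    by (intro exI[of _ "\<lambda>w. \<Sum>i<n. c i * (a i (fst w) * b i (snd w))"]) blast
qed

lemma product_in_span: "f \<in> E168 \<Longrightarrow> g \<in> E168 \<Longrightarrow> (\<lambda>x. f x * g x) \<in> product_span"
  unfolding product_span_def
  by (intro CollectI exI[of _ "1 :: nat"] exI[of _ "\<lambda>_. 1"] exI[of _ "\<lambda>_. f"] exI[of _ "\<lambda>_. g"]) simp

lemma lin_closed_product_span: "lin_closed product_span"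
  unfolding lin_closed_def
proof (intro conjI ballI allI)
  show "product_span \<noteq> {}"
    using E168_kernel product_in_span by (metis empty_iff)
  fix p q a b assume "p \<in> product_span" "q \<in> product_span"
  then obtain n c f g n' c' f' g' where
    p: "p = (\<lambda>x. \<Sum>i<(n::nat). c i * (f i x * g i x))" "\<And>i. i < n \<Longrightarrow> f i \<in> E168 \<and> g i \<in> E168" and
    q: "q = (\<lambda>x. \<Sum>i<(n'::nat). c' i * (f' i x * g' i x))" "\<And>i. i < n' \<Longrightarrow> f' i \<in> E168 \<and> g' i \<in> E168"
    unfolding product_span_def by blast
  define C where "C = (\<lambda>i. if i < n then a * c i else b * c' (i - n))"
  define F where "F = (\<lambda>i. if i < n then f i else f' (i - n))"
  define G where "G = (\<lambda>i. if i < n then g i else g' (i - n))"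
  have "a * p x + b * q x = (\<Sum>i<n + n'. C i * (F i x * G i x))" for x
  proof -
    have "(\<Sum>i<n + n'. C i * (F i x * G i x)) = (\<Sum>i<n. C i * (F i x * G i x)) + (\<Sum>i<n'. C (n + i) * (F (n + i) x * G (n + i) x))"
      by (induction n') simp_all
    then show ?thesis by (simp add: p(1) q(1) C_def F_def G_def sum_distrib_left mult.assoc)
  qed
  moreover have "\<forall>i<n + n'. F i \<in> E168 \<and> G i \<in> E168"
    using p(2) q(2) by (auto simp: F_def G_def)
  ultimately show "(\<lambda>x. a * p x + b * q x) \<in> product_span"
    unfolding product_span_def by blast
qed

lemma product_span_cont: "q \<in> product_span \<Longrightarrow> continuous_on S3 (pull q)"
  by (rule fin_spanned_cont[OF fin_spanned_product_span])

section \<open>The operators and the representing elements\<close>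

lemma B_op_unique:
  assumes q: "continuous_on S3 (pull q)" and f: "f \<in> E168"
  shows "\<exists>!h. h \<in> E168 \<and> (\<forall>g\<in>E168. L2_inner h g = - integral_M (\<lambda>x. q x * (f x * g x)))"
proof (rule riesz[OF lin_closed_E168 fin_spanned_E168])
  show "lin_on E168 (\<lambda>g. - integral_M (\<lambda>x. q x * (f x * g x)))"
    unfolding lin_on_def
  proof (intro ballI allI)
    fix g h a b assume gh: "g \<in> E168" "h \<in> E168"
    have "(LINT x|\<sigma>. pull (\<lambda>x. q x * (f x * (a * g x + b * h x))) x) =
       (LINT x|\<sigma>. a * (pull q x * (pull f x * pull g x)) + b * (pull q x * (pull f x * pull h x)))"
      by (rule integral_cong_S3) (simp add: pull_def algebra_simps)
    also have "\<dots> = a * (LINT x|\<sigma>. pull q x * (pull f x * pull g x)) + b * (LINT x|\<sigma>. pull q x * (pull f x * pull h x))"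
      by (subst Bochner_Integration.integral_add) (auto intro!: integrable_cont continuous_intros E168_cont gh f q)
    finally show "- integral_M (\<lambda>x. q x * (f x * (a * g x + b * h x))) =
      a * - integral_M (\<lambda>x. q x * (f x * g x)) + b * - integral_M (\<lambda>x. q x * (f x * h x))"
      by (simp add: integral_M_pull add_divide_distrib pull_def[abs_def])
  qed
qed

lemma B_op_eqI:
  assumes q: "continuous_on S3 (pull q)" and f: "f \<in> E168"
    and h: "h \<in> E168" "\<And>g. g \<in> E168 \<Longrightarrow> L2_inner h g = - integral_M (\<lambda>x. q x * (f x * g x))"
  shows "B_op q f = h"
  unfolding B_op_def using f by (simp only: restrict_apply if_True) (rule the1_equality[OF B_op_unique[OF q f]], use h in blast)

lemma B_op_props:
  assumes q: "continuous_on S3 (pull q)" and f: "f \<in> E168"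
  shows "B_op q f \<in> E168"
    "g \<in> E168 \<Longrightarrow> L2_inner (B_op q f) g = - integral_M (\<lambda>x. q x * (f x * g x))"
  using theI'[OF B_op_unique[OF q f]] f unfolding B_op_def by auto

lemma B_space_Sym: "B_space \<subseteq> Sym_E"
proof
  fix T assume "T \<in> B_space"
  then obtain q where q: "q \<in> product_span" "T = B_op q" unfolding B_space_def by blast
  note cq = product_span_cont[OF q(1)]
  show "T \<in> Sym_E"
    unfolding Sym_E_def q(2)
  proof (intro CollectI conjI ballI allI)
    show "B_op q \<in> E168 \<rightarrow>\<^sub>E E168"
      using B_op_props(1)[OF cq] by (auto simp: PiE_def extensional_def B_op_def)
    fix f g assume fg: "f \<in> E168" "g \<in> E168"
    show "L2_inner (B_op q f) g = L2_inner f (B_op q g)"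
      unfolding L2_inner_commute[of f] B_op_props(2)[OF cq fg] B_op_props(2)[OF cq fg(2,1)]
      by (simp only: mult.commute mult.left_commute)
    fix c d
    show "B_op q (\<lambda>x. c * f x + d * g x) = (\<lambda>x. c * B_op q f x + d * B_op q g x)"
    proof (rule B_op_eqI[OF cq E168_lin[OF fg]])
      show "(\<lambda>x. c * B_op q f x + d * B_op q g x) \<in> E168"
        by (intro E168_lin B_op_props(1)[OF cq] fg)
      fix h assume h: "h \<in> E168"
      have cF: "continuous_on S3 (\<lambda>x. pull q x * (pull P x * pull h x))" if "P \<in> E168" for P
        by (intro continuous_intros cq E168_cont h that)
      have "(LINT x|\<sigma>. pull (\<lambda>x. q x * ((c * f x + d * g x) * h x)) x) =
         (LINT x|\<sigma>. c * (pull q x * (pull f x * pull h x)) + d * (pull q x * (pull g x * pull h x)))"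
        by (rule integral_cong_S3) (simp add: pull_def algebra_simps)
      also have "\<dots> = c * (LINT x|\<sigma>. pull q x * (pull f x * pull h x)) + d * (LINT x|\<sigma>. pull q x * (pull g x * pull h x))"
        by (subst Bochner_Integration.integral_add) (auto intro!: integrable_cont continuous_on_mult_left cF fg)
      finally have "integral_M (\<lambda>x. q x * ((c * f x + d * g x) * h x)) =
        c * integral_M (\<lambda>x. q x * (f x * h x)) + d * integral_M (\<lambda>x. q x * (g x * h x))"
        by (simp add: integral_M_pull add_divide_distrib pull_def[abs_def])
      then show "L2_inner (\<lambda>x. c * B_op q f x + d * B_op q g x) h =
          - integral_M (\<lambda>x. q x * ((c * f x + d * g x) * h x))"
        unfolding L2_inner_lin[OF E168_cont[OF B_op_props(1)[OF cq fg(1)]] E168_cont[OF B_op_props(1)[OF cq fg(2)]] E168_cont[OF h]]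
          B_op_props(2)[OF cq fg(1) h] B_op_props(2)[OF cq fg(2) h] by simp
    qed
  qed
qed

lemma q_base_props:
  "q_base \<in> product_span" "h \<in> product_span \<Longrightarrow> integral_M (\<lambda>x. q_base x * h x) = h base_point"
proof -
  have "lin_on product_span (\<lambda>h. h base_point)" by (simp add: lin_on_def)
  from riesz[OF lin_closed_product_span fin_spanned_product_span this]
  have "\<exists>!q. q \<in> product_span \<and> (\<forall>h\<in>product_span. h base_point = integral_M (\<lambda>x. q x * h x))"
    unfolding L2_inner_def by (simp add: eq_commute)
  from theI'[OF this] show "q_base \<in> product_span"
    "h \<in> product_span \<Longrightarrow> integral_M (\<lambda>x. q_base x * h x) = h base_point"
    unfolding q_base_def by auto
qed

text \<open>
  Integrating \<open>f\<close> against the sum of the zonal functions at \<open>qcnj h\<close> gives \<open>\<kappa>\<close> times the sum of the values \<open>f (qcnj h)\<close>,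
  and each of these is \<open>f\<close> at the base point. The value of the kernel there is positive because of the character sum.
\<close>

lemma reproducing_kernel:
  obtains k where "k \<in> E168" "\<And>f. f \<in> E168 \<Longrightarrow> L2_inner k f = f base_point" "k base_point > 0"
    "\<And>x. x \<in> S3 \<Longrightarrow> pull k x = 1 / \<kappa> * (\<Sum>h\<in>unit_icosians. char12 (x \<odot> h))"
proof -
  obtain k0 where k0: "k0 \<in> E168" "\<And>x. x \<in> S3 \<Longrightarrow> pull k0 x = (\<Sum>h\<in>unit_icosians. char12 (x \<odot> h))"
    using E168_kernel by blast
  define k where "k = (\<lambda>x. 1 / \<kappa> * k0 x + 0 * k0 x)"
  have k: "k \<in> E168" unfolding k_def by (rule E168_lin[OF k0(1) k0(1)])
  have pk: "pull k x = 1 / \<kappa> * (\<Sum>h\<in>unit_icosians. char12 (x \<odot> h))" if "x \<in> S3" for x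
    using k0(2)[OF that] by (simp add: pull_def k_def)
  have rep: "L2_inner k f = f base_point" if f: "f \<in> E168" for f
  proof -
    note F = E168_weak_eigen[OF f]
    have "(LINT x|\<sigma>. pull k x * pull f x) = (LINT x|\<sigma>. 1 / \<kappa> * (\<Sum>h\<in>unit_icosians. pull f x * zonal (qcnj h) x))"
      by (rule integral_cong_S3) (simp only: pk char12_qmul sum_distrib_left mult.assoc mult.commute mult.left_commute)
    also have "\<dots> = 1 / \<kappa> * (\<Sum>h\<in>unit_icosians. LINT x|\<sigma>. pull f x * zonal (qcnj h) x)"
      by (subst Bochner_Integration.integral_sum[symmetric]) (auto intro!: integrable_cont continuous_intros E168_cont f)
    also have "\<dots> = 1 / \<kappa> * (\<Sum>h\<in>unit_icosians. \<kappa> * f base_point)"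
    proof (intro arg_cong2[where f = "(*)"] refl sum.cong)
      fix h assume h: "h \<in> unit_icosians"
      have "pull f (qcnj h) = pull f qone"
        using pull_right[OF S3_qone unit_icosians_qcnj[OF h], of f] by simp
      then show "(LINT x|\<sigma>. pull f x * zonal (qcnj h) x) = \<kappa> * f base_point"
        using zonal_reproducing[OF F S3_qcnj[OF icosian_S3[OF h]]] by (simp add: pull_def base_point_quat)
    qed
    also have "\<dots> = 120 * f base_point" using \<kappa>_pos by (simp add: card_unit_icosians)
    finally show ?thesis by (simp add: L2_inner_pull)
  qed
  have "k base_point = 120 / \<kappa>"
    using pk[OF S3_qone] sum_character_unit_icosians by (simp add: pull_def base_point_quat card_unit_icosians)
  then have "k base_point > 0" using \<kappa>_pos by simp
  then show ?thesis using that k rep pk by blast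
qed

lemma invariant_iff:
  "left_translate (quat g) f = f \<longleftrightarrow> (\<forall>x\<in>S3. pull f (qcnj g \<odot> x) = pull f x)" if g: "g \<in> S3"
proof -
  have "pull (left_translate (quat g) f) x = pull f (qcnj g \<odot> x)" if "x \<in> S3" for x
    using that g by (simp add: pull_def left_translate_def matrix_inv_quat act_coset_quat)
  then show ?thesis using pull_eqI[of "left_translate (quat g) f" f] by metis
qed

theorem corollary11p7:
  shows "seed_operator \<in> B_space \<and> B_space \<subseteq> Sym_E \<and>
    (\<exists>F\<^sub>0 \<mu>. F\<^sub>0 \<in> E168 \<and> F\<^sub>0 \<noteq> (\<lambda>_. 0) \<and> icosahedral_invariants = line_through F\<^sub>0 \<and>
       is_lowest_eigenvalue seed_operator \<mu> \<and>
       is_simple_eigenvalue seed_operator \<mu> \<and>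
       op_eigenspace seed_operator \<mu> = line_through F\<^sub>0)"
proof -
  obtain k where k: "k \<in> E168" "\<And>f. f \<in> E168 \<Longrightarrow> L2_inner k f = f base_point" "k base_point > 0"
    "\<And>x. x \<in> S3 \<Longrightarrow> pull k x = 1 / \<kappa> * (\<Sum>h\<in>unit_icosians. char12 (x \<odot> h))"
    using reproducing_kernel by blast
  have scale: "(\<lambda>x. c * f x) \<in> E168" if "f \<in> E168" for c f
    using E168_lin[OF that that, of c 0] by simp
  have k0: "k \<noteq> (\<lambda>_. 0)" using k(3) by auto
  \<comment> \<open>The operator has rank one because \<open>q_base\<close> represents evaluation on products of eigenfunctions.\<close>
  have seed: "seed_operator f = (\<lambda>x. - f base_point * k x)" if f: "f \<in> E168" for f
    unfolding seed_operator_def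
  proof (rule B_op_eqI[OF product_span_cont[OF q_base_props(1)] f scale[OF k(1)]])
    fix g assume g: "g \<in> E168"
    have "L2_inner (\<lambda>x. - f base_point * k x) g = - f base_point * L2_inner k g"
      using L2_inner_lin[OF E168_cont[OF k(1)] E168_cont[OF k(1)] E168_cont[OF g], of "- f base_point" 0] by simp
    then show "L2_inner (\<lambda>x. - f base_point * k x) g = - integral_M (\<lambda>x. q_base x * (f x * g x))"
      unfolding q_base_props(2)[OF product_in_span[OF f g]] k(2)[OF g] by simp
  qed
  define \<mu> where "\<mu> = - k base_point"
  have space: "op_eigenspace seed_operator \<mu> = line_through k"
  proof
    show "op_eigenspace seed_operator \<mu> \<subseteq> line_through k"
    proof
      fix f assume "f \<in> op_eigenspace seed_operator \<mu>"
      then have f: "f \<in> E168" "seed_operator f = (\<lambda>x. \<mu> * f x)" by (auto simp: op_eigenspace_def)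
      have "f x = f base_point / k base_point * k x" for x
        using fun_cong[OF f(2)[unfolded seed[OF f(1)]], of x] k(3) by (simp add: \<mu>_def field_simps)
      then show "f \<in> line_through k" unfolding line_through_def by blast
    qed
    show "line_through k \<subseteq> op_eigenspace seed_operator \<mu>"
      by (auto simp: line_through_def op_eigenspace_def scale[OF k(1)] seed[OF scale[OF k(1)]] \<mu>_def)
  qed
  have k_line: "k \<in> line_through k" unfolding line_through_def by (intro CollectI exI[of _ 1]) simp
  have lowest: "is_lowest_eigenvalue seed_operator \<mu>"
    unfolding is_lowest_eigenvalue_def
  proof (intro conjI allI impI)
    show "is_eigenvalue seed_operator \<mu>"
      unfolding is_eigenvalue_def space using k_line k0 by blast
    fix \<nu> assume "is_eigenvalue seed_operator \<nu>"
    then obtain f where f: "f \<in> E168" "seed_operator f = (\<lambda>x. \<nu> * f x)" "f \<noteq> (\<lambda>_. 0)"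
      by (auto simp: is_eigenvalue_def op_eigenspace_def)
    have eq: "- f base_point * k x = \<nu> * f x" for x
      using fun_cong[OF f(2)[unfolded seed[OF f(1)]], of x] .
    show "\<mu> \<le> \<nu>"
    proof (cases "f base_point = 0")
      case True
      then have "\<nu> = 0" using eq f(3) by auto
      then show ?thesis using k(3) by (simp add: \<mu>_def)
    next
      case False
      have "f base_point * \<nu> = f base_point * (- k base_point)" using eq[of base_point] by (simp add: mult.commute)
      then have "\<nu> = - k base_point" using mult_left_cancel[OF False] by blast
      then show ?thesis by (simp add: \<mu>_def)
    qed
  qed
  have simple: "is_simple_eigenvalue seed_operator \<mu>"
    unfolding is_simple_eigenvalue_def using space k0 by blast
  have kl: "pull k (g \<odot> x) = pull k x" if g: "g \<in> unit_icosians" and x: "x \<in> S3" for g x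
  proof -
    have "(\<Sum>h\<in>unit_icosians. char12 (g \<odot> x \<odot> h)) = (\<Sum>h\<in>unit_icosians. char12 (x \<odot> (h \<odot> g)))"
    proof (rule sum.cong[OF refl])
      fix h
      have "(g \<odot> x \<odot> h) $ 1 = (x \<odot> (h \<odot> g)) $ 1"
        unfolding qmul_assoc using qmul_fst_commute[of g "x \<odot> h"] by (simp only: qmul_assoc)
      then show "char12 (g \<odot> x \<odot> h) = char12 (x \<odot> (h \<odot> g))" by (rule arg_cong)
    qed
    also have "\<dots> = (\<Sum>h\<in>unit_icosians. char12 (x \<odot> h))"
      by (rule sum.reindex_bij_witness[of _ "\<lambda>h. h \<odot> qcnj g" "\<lambda>h. h \<odot> g"])
         (use g icosian_S3[OF g] in \<open>auto intro: unit_icosians_mult unit_icosians_qcnj\<close>)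
    finally show ?thesis
      unfolding k(4)[OF S3_qmul[OF icosian_S3[OF g] x]] k(4)[OF x] by (rule arg_cong)
  qed
  have inv: "icosahedral_invariants = line_through k"
  proof
    show "icosahedral_invariants \<subseteq> line_through k"
    proof
      fix f assume "f \<in> icosahedral_invariants"
      then have f: "f \<in> E168" "\<And>g. g \<in> unit_icosians \<Longrightarrow> left_translate (quat g) f = f"
        by (auto simp: icosahedral_invariants_def binary_icosahedral_def)
      have fl: "pull f (g \<odot> x) = pull f x" if "g \<in> unit_icosians" "x \<in> S3" for g x
        using f(2)[OF unit_icosians_qcnj[OF that(1)]] that icosian_S3[OF that(1)]
        by (subst (asm) invariant_iff) auto
      \<comment> \<open>The difference \<open>d\<close> of \<open>f\<close> and the multiple of \<open>k\<close> with the same value at the base point.\<close>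
      let ?c = "f base_point / k base_point"
      define d where "d = (\<lambda>x. 1 * f x + - ?c * k x)"
      have d: "d \<in> E168" unfolding d_def by (rule E168_lin[OF f(1) k(1)])
      have "pull d x = 0" if x: "x \<in> S3" for x
      proof (rule biinvariant_zero[OF finite_unit_icosians unit_icosians_S3 _ unit_icosians_mult unit_icosians_qcnj
            sum_character_unit_icosians E168_weak_eigen[OF d] _ _ _ x])
        show "unit_icosians \<noteq> {}" using qone_unit_icosian by blast
        show "pull d (g \<odot> y) = pull d y" if "g \<in> unit_icosians" "y \<in> S3" for g y
          using fl[OF that] kl[OF that] by (simp add: d_def pull_def)
        show "pull d (y \<odot> g) = pull d y" if "g \<in> unit_icosians" "y \<in> S3" for g y
          by (rule pull_right[OF that(2,1)])
        show "pull d qone = 0" using k(3) by (simp add: d_def pull_def flip: base_point_quat)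
      qed
      then have "d = (\<lambda>_. 0)" by (intro pull_eqI) (simp add: pull_def)
      then have "f x = ?c * k x" for x unfolding d_def by (metis add.commute add_eq_0_iff mult_1 mult_minus_left minus_minus)
      then show "f \<in> line_through k" unfolding line_through_def by blast
    qed
    show "line_through k \<subseteq> icosahedral_invariants"
    proof
      fix f assume "f \<in> line_through k"
      then obtain c where f: "f = (\<lambda>x. c * k x)" unfolding line_through_def by blast
      have "left_translate (quat g) f = f" if g: "g \<in> unit_icosians" for g
        unfolding invariant_iff[OF icosian_S3[OF g]]
        using kl[OF unit_icosians_qcnj[OF g]] by (simp add: f pull_def)
      then show "f \<in> icosahedral_invariants"
        using scale[OF k(1)] by (auto simp: icosahedral_invariants_def binary_icosahedral_def f)
    qed
  qed
  have "seed_operator \<in> B_space"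
    unfolding B_space_def seed_operator_def using q_base_props(1) by blast
  then show ?thesis using B_space_Sym k(1) k0 inv lowest simple space by blast
qed

end
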